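(* Let $\chi\in\mathcal X$. Let $\mathcal I^+\subset\mathcal U^+(\chi)\cap\ker\varepsilon$ be a (not necessarily $\mathbb Z$-graded) ideal of $\mathcal U^+(\chi)$ and let $\mathcal I^-\subset\mathcal U^-(\chi)\cap\ker\varepsilon$ be a (not necessarily $\mathbb Z$-graded) ideal of $\mathcal U^-(\chi)$. Then the following statements are equivalent. (1) The multiplication map $\mathcal U^+(\chi)\otimes\mathcal U^0(\chi)\otimes\mathcal U^-(\chi)\to\mathcal U(\chi)$ induces an isomorphism $$\mathcal U^+(\chi)/\mathcal I^+\otimes\mathcal U^0(\chi)\otimes\mathcal U^-(\chi)/\mathcal I^-\to\mathcal U(\chi)/(\mathcal I^++\mathcal I^-)$$ of vector spaces, where $(\mathcal I^++\mathcal I^-)$ is the ideal of $\mathcal U(\chi)$ generated by $\mathcal I^++\mathcal I^-$. (2) The equation $\mathcal U(\chi)\mathcal I^+\mathcal U(\chi)+\mathcal U(\chi)\mathcal I^-\mathcal U(\chi)=\mathcal I^+\mathcal U^0(\chi)\mathcal U^-(\chi)+\mathcal U^+(\chi)\mathcal U^0(\chi)\mathcal I^-$ holds. (3) The vector spaces $\mathcal I^+\mathcal U^0(\chi)\mathcal U^-(\chi)$ and $\mathcal U^+(\chi)\mathcal U^0(\chi)\mathcal I^-$ are ideals of $\mathcal U(\chi)$. (4) For all $X\in\mathcal U^0(\chi)$ and $i\in I$ one has $X\cdot\mathcal I^+\subset\mathcal I^+$, $X\cdot\mathcal I^-\subset\mathcal I^-$, $\partial^K_i(\mathcal I^+)\subset\mathcal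 I^+$, $\partial^L_i(\mathcal I^+)\subset\mathcal I^+$, $\partial^K_i(\phi_4(\mathcal I^-))\subset\phi_4(\mathcal I^-)$, and $\partial^L_i(\phi_4(\mathcal I^-))\subset\phi_4(\mathcal I^-)$.
   Context: Let $\Bbbk$ be a field, $\Bbbk^\times=\Bbbk\setminus\{0\}$, $I$ a non-empty finite set, $\{\alpha_i\mid i\in I\}$ the standard basis of $\mathbb Z^I$. $\mathcal X$ is the set of bicharacters $\chi:\mathbb Z^I\times\mathbb Z^I\to\Bbbk^\times$ (multiplicative in each argument: $\chi(a+b,c)=\chi(a,c)\chi(b,c)$, $\chi(c,a+b)=\chi(c,a)\chi(c,b)$). Put $q_{ij}=\chi(\alpha_i,\alpha_j)$. $\mathcal U(\chi)$ is the unital associative $\Bbbk$-algebra generated by $K_i,K_i^{-1},L_i,L_i^{-1},E_i,F_i$ ($i\in I$) with relations: all $K_i^{\pm1},L_i^{\pm1}$ commute; $K_iK_i^{-1}=L_iL_i^{-1}=1$; $K_iE_jK_i^{-1}=q_{ij}E_j$; $L_iE_jL_i^{-1}=q_{ji}^{-1}E_j$; $K_iF_jK_i^{-1}=q_{ij}^{-1}F_j$; $L_iF_jL_i^{-1}=q_{ji}F_j$; $E_iF_j-F_jE_i=\delta_{i,j}(K_i-L_i)$. It is a Hopf algebra with $K_i,L_i$ group-like, $\Delta(E_i)=E_i\otimes1+K_i\otimes E_i$, $\Delta(F_i)=1\otimes F_i+F_i\otimes L_i$, counit $\varepsilon(E_i)=\varepsilon(F_i)=0$, $\varepsilon(K_i)=\varepsilon(L_i)=1$,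 antipode $S$. $\mathcal U^+(\chi)$, $\mathcal U^-(\chi)$, $\mathcal U^0(\chi)$ are the subalgebras generated by the $E_i$, the $F_i$, and the $K_i^{\pm1},L_i^{\pm1}$, respectively; $\mathcal U^\pm(\chi)$ are free algebras on these generators. For $X\in\mathcal U^0(\chi)$, $Y\in\mathcal U(\chi)$ put $X\cdot Y=X_{(1)}YS(X_{(2)})$ (left adjoint action). $\phi_4$ is the algebra antiautomorphism of $\mathcal U(\chi)$ with $\phi_4(K_i)=K_i$, $\phi_4(L_i)=L_i$, $\phi_4(E_i)=F_i$, $\phi_4(F_i)=E_i$. $\partial^K_i,\partial^L_i$ are the unique linear endomorphisms of $\mathcal U^+(\chi)$ with $EF_i-F_iE=\partial^K_i(E)K_i-L_i\partial^L_i(E)$ for all $E\in\mathcal U^+(\chi)$. "Ideal" means two-sided ideal. *)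

theory Defs
  imports
    "HOL-Algebra.QuotRing"
    "HOL-Algebra.Module"
    "HOL-Library.Poly_Mapping"
    "HOL-Analysis.Finite_Cartesian_Product"
begin

section \<open>Linear algebra over a field\<close>

text \<open>
  The ground field is a type \<open>'k\<close> of class \<^class>\<open>field\<close>. A (unital, associative) \<open>'k\<close>-algebra
  is a HOL-Algebra record of type \<open>('k, 'a) module\<close>: a ring together with a scalar multiplication.
  Subspaces and subalgebras are subsets of the carrier, and a subalgebra \<open>S\<close> of \<open>A\<close> is turned
  into an algebra by \<open>A\<lparr>carrier := S\<rparr>\<close>.
\<close>

inductive_set lin_span :: "('k, 'a) module \<Rightarrow> 'a set \<Rightarrow> 'a set"
  for A :: "('k, 'a) module" and S :: "'a set"
where
  zero: "\<zero>\<^bsub>A\<^esub> \<in> lin_span A S"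
| base: "x \<in> S \<Longrightarrow> x \<in> lin_span A S"
| add: "x \<in> lin_span A S \<Longrightarrow> y \<in> lin_span A S \<Longrightarrow> x \<oplus>\<^bsub>A\<^esub> y \<in> lin_span A S"
| smult: "x \<in> lin_span A S \<Longrightarrow> c \<odot>\<^bsub>A\<^esub> x \<in> lin_span A S"

inductive_set subalg_gen :: "('k, 'a) module \<Rightarrow> 'a set \<Rightarrow> 'a set"
  for A :: "('k, 'a) module" and S :: "'a set"
where
  one: "\<one>\<^bsub>A\<^esub> \<in> subalg_gen A S"
| base: "x \<in> S \<Longrightarrow> x \<in> subalg_gen A S"
| add: "x \<in> subalg_gen A S \<Longrightarrow> y \<in> subalg_gen A S \<Longrightarrow> x \<oplus>\<^bsub>A\<^esub> y \<in> subalg_gen A S"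
| smult: "x \<in> subalg_gen A S \<Longrightarrow> c \<odot>\<^bsub>A\<^esub> x \<in> subalg_gen A S"
| mult: "x \<in> subalg_gen A S \<Longrightarrow> y \<in> subalg_gen A S \<Longrightarrow> x \<otimes>\<^bsub>A\<^esub> y \<in> subalg_gen A S"

text \<open>The product \<open>XYZ\<close> of three subspaces is the span of all products, not just their set.\<close>

definition subspace_prod :: "('k, 'a) module \<Rightarrow> 'a set \<Rightarrow> 'a set \<Rightarrow> 'a set \<Rightarrow> 'a set" where
  "subspace_prod A X Y Z = lin_span A (X <#>\<^bsub>A\<^esub> Y <#>\<^bsub>A\<^esub> Z)"

definition lin_hom :: "('k, 'a) module \<Rightarrow> ('k, 'b) module \<Rightarrow> ('a \<Rightarrow> 'b) set" where
  "lin_hom A B = {f \<in> carrier A \<rightarrow> carrier B.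
     (\<forall>x\<in>carrier A. \<forall>y\<in>carrier A. f (x \<oplus>\<^bsub>A\<^esub> y) = f x \<oplus>\<^bsub>B\<^esub> f y) \<and>
     (\<forall>c. \<forall>x\<in>carrier A. f (c \<odot>\<^bsub>A\<^esub> x) = c \<odot>\<^bsub>B\<^esub> f x)}"

definition alg_hom :: "('k, 'a) module \<Rightarrow> ('k, 'b) module \<Rightarrow> ('a \<Rightarrow> 'b) set" where
  "alg_hom A B = lin_hom A B \<inter> ring_hom A B"

definition alg_antiaut :: "('k, 'a) module \<Rightarrow> ('a \<Rightarrow> 'a) set" where
  "alg_antiaut A = {f \<in> lin_hom A A. bij_betw f (carrier A) (carrier A) \<and> f \<one>\<^bsub>A\<^esub> = \<one>\<^bsub>A\<^esub> \<and>
     (\<forall>x\<in>carrier A. \<forall>y\<in>carrier A. f (x \<otimes>\<^bsub>A\<^esub> y) = f y \<otimes>\<^bsub>A\<^esub> f x)}"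

definition ground_alg :: "('k::field, 'k) module" where
  "ground_alg = \<lparr>carrier = UNIV, mult = (*), one = 1, zero = 0, add = (+), smult = (*)\<rparr>"

text \<open>The ring \<open>A Quot I\<close> of cosets of \<open>I\<close>, with the scalar multiplication inherited from \<open>A\<close>.\<close>

definition quot_alg :: "('k, 'a) module \<Rightarrow> 'a set \<Rightarrow> ('k, 'a set) module" where
  "quot_alg A I = \<lparr>carrier = carrier (A Quot I), mult = mult (A Quot I), one = one (A Quot I),
     zero = zero (A Quot I), add = add (A Quot I),
     smult = (\<lambda>c X. \<Union>x\<in>X. I +>\<^bsub>A\<^esub> (c \<odot>\<^bsub>A\<^esub> x))\<rparr>"

definition monoid_alg :: "('m, 'z) monoid_scheme \<Rightarrow> ('k::field, 'm \<Rightarrow>\<^sub>0 'k) module" where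
  "monoid_alg M = \<lparr>carrier = {p. Poly_Mapping.keys p \<subseteq> carrier M},
     mult = (\<lambda>p q. \<Sum>a\<in>Poly_Mapping.keys p. \<Sum>b\<in>Poly_Mapping.keys q.
       Poly_Mapping.single (a \<otimes>\<^bsub>M\<^esub> b) (Poly_Mapping.lookup p a * Poly_Mapping.lookup q b)),
     one = Poly_Mapping.single \<one>\<^bsub>M\<^esub> 1, zero = 0, add = (+),
     smult = (\<lambda>c. Poly_Mapping.map ((*) c))\<rparr>"

definition free_alg :: "('k::field, 'g list \<Rightarrow>\<^sub>0 'k) module" where
  "free_alg = monoid_alg \<lparr>carrier = UNIV, mult = (@), one = []\<rparr>"

subsection \<open>Tensor products\<close>

text \<open>
  \<open>A \<otimes> B\<close> is the vector space with basis \<open>carrier A \<times> carrier B\<close> modulo the bilinearity relations.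
  Taking the monoid algebra of the multiplicative monoid \<open>A \<times>\<times> B\<close> for this vector space makes the
  quotient carry the multiplication \<open>(a \<otimes> b)(a' \<otimes> b') = aa' \<otimes> bb'\<close>.
\<close>

definition tensor_rels :: "('k::field, 'a) module \<Rightarrow> ('k, 'b) module \<Rightarrow> ('a \<times> 'b \<Rightarrow>\<^sub>0 'k) set" where
  "tensor_rels A B = lin_span (monoid_alg (A \<times>\<times> B)) (
     {Poly_Mapping.single (a \<oplus>\<^bsub>A\<^esub> a', b) 1
        - Poly_Mapping.single (a, b) 1 - Poly_Mapping.single (a', b) 1 | a a' b.
        a \<in> carrier A \<and> a' \<in> carrier A \<and> b \<in> carrier B} \<union>
     {Poly_Mapping.single (a, b \<oplus>\<^bsub>B\<^esub> b') 1
        - Poly_Mapping.single (a, b) 1 - Poly_Mapping.single (a, b') 1 | a b b'.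
        a \<in> carrier A \<and> b \<in> carrier B \<and> b' \<in> carrier B} \<union>
     {Poly_Mapping.single (c \<odot>\<^bsub>A\<^esub> a, b) 1 - Poly_Mapping.single (a, b) c | c a b.
        a \<in> carrier A \<and> b \<in> carrier B} \<union>
     {Poly_Mapping.single (a, c \<odot>\<^bsub>B\<^esub> b) 1 - Poly_Mapping.single (a, b) c | c a b.
        a \<in> carrier A \<and> b \<in> carrier B})"

definition tensor ::
    "('k::field, 'a) module \<Rightarrow> ('k, 'b) module \<Rightarrow> ('k, ('a \<times> 'b \<Rightarrow>\<^sub>0 'k) set) module" where
  "tensor A B = quot_alg (monoid_alg (A \<times>\<times> B)) (tensor_rels A B)"

definition pure_tensor ::
    "('k::field, 'a) module \<Rightarrow> ('k, 'b) module \<Rightarrow> 'a \<Rightarrow> 'b \<Rightarrow> ('a \<times> 'b \<Rightarrow>\<^sub>0 'k) set" where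
  "pure_tensor A B a b =
     tensor_rels A B +>\<^bsub>(monoid_alg (A \<times>\<times> B) :: ('k, _) module)\<^esub> Poly_Mapping.single (a, b) 1"

text \<open>Meaningful for bilinear \<open>f\<close> only.\<close>

definition tensor_lift :: "('k::field, 'a) module \<Rightarrow> ('k, 'b) module \<Rightarrow> ('k, 'c) module \<Rightarrow>
    ('a \<Rightarrow> 'b \<Rightarrow> 'c) \<Rightarrow> ('a \<times> 'b \<Rightarrow>\<^sub>0 'k) set \<Rightarrow> 'c" where
  "tensor_lift A B C f = (THE h. h \<in> lin_hom (tensor A B) C \<and>
     h \<in> extensional (carrier (tensor A B)) \<and>
     (\<forall>a\<in>carrier A. \<forall>b\<in>carrier B. h (pure_tensor A B a b) = f a b))"


section \<open>The algebra attached to a bicharacter\<close>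

text \<open>The index set \<open>I\<close> is the finite (and nonempty) type \<open>'i\<close>, and \<open>\<alpha>\<^sub>i\<close> is \<open>axis i 1\<close>.\<close>

definition bicharacter :: "(int ^ 'i \<Rightarrow> int ^ 'i \<Rightarrow> 'k::field) \<Rightarrow> bool" where
  "bicharacter chi \<longleftrightarrow> (\<forall>a b. chi a b \<noteq> 0) \<and>
     (\<forall>a b c. chi (a + b) c = chi a c * chi b c) \<and> (\<forall>a b c. chi c (a + b) = chi c a * chi c b)"

definition qcoef :: "(int ^ 'i \<Rightarrow> int ^ 'i \<Rightarrow> 'k::field) \<Rightarrow> 'i \<Rightarrow> 'i \<Rightarrow> 'k" where
  "qcoef chi i j = chi (axis i 1) (axis j 1)"

text \<open>\<open>GKi i\<close> and \<open>GLi i\<close> stand for \<open>K\<^sub>i\<^sup>-\<^sup>1\<close> and \<open>L\<^sub>i\<^sup>-\<^sup>1\<close>.\<close>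

datatype 'i gen = GK 'i | GKi 'i | GL 'i | GLi 'i | GE 'i | GF 'i

definition torus_gens :: "'i gen set" where
  "torus_gens = range GK \<union> range GKi \<union> range GL \<union> range GLi"

abbreviation mon :: "'g list \<Rightarrow> 'g list \<Rightarrow>\<^sub>0 'k::field" where
  "mon w \<equiv> Poly_Mapping.single w 1"

text \<open>Each element \<open>r\<close> of this set is a defining relation \<open>r = 0\<close>.\<close>

definition U_rels :: "(int ^ 'i \<Rightarrow> int ^ 'i \<Rightarrow> 'k::field) \<Rightarrow> ('i gen list \<Rightarrow>\<^sub>0 'k) set" where
  "U_rels chi =
     {mon [a, b] - mon [b, a] | a b. a \<in> torus_gens \<and> b \<in> torus_gens} \<union>
     {mon [GK i, GKi i] - mon [] | i. True} \<union>
     {mon [GL i, GLi i] - mon [] | i. True} \<union>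
     {mon [GK i, GE j, GKi i] - Poly_Mapping.single [GE j] (qcoef chi i j) | i j. True} \<union>
     {mon [GL i, GE j, GLi i] - Poly_Mapping.single [GE j] (inverse (qcoef chi j i)) | i j. True} \<union>
     {mon [GK i, GF j, GKi i] - Poly_Mapping.single [GF j] (inverse (qcoef chi i j)) | i j. True} \<union>
     {mon [GL i, GF j, GLi i] - Poly_Mapping.single [GF j] (qcoef chi j i) | i j. True} \<union>
     {mon [GE i, GF j] - mon [GF j, GE i] - (if i = j then mon [GK i] - mon [GL i] else 0)
        | i j. True}"

definition U_ideal :: "(int ^ 'i \<Rightarrow> int ^ 'i \<Rightarrow> 'k::field) \<Rightarrow> ('i gen list \<Rightarrow>\<^sub>0 'k) set" where
  "U_ideal chi = Idl\<^bsub>(free_alg :: ('k, _) module)\<^esub> (U_rels chi)"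

definition U ::
    "(int ^ 'i \<Rightarrow> int ^ 'i \<Rightarrow> 'k::field) \<Rightarrow> ('k, ('i gen list \<Rightarrow>\<^sub>0 'k) set) module" where
  "U chi = quot_alg free_alg (U_ideal chi)"

definition ugen ::
    "(int ^ 'i \<Rightarrow> int ^ 'i \<Rightarrow> 'k::field) \<Rightarrow> 'i gen \<Rightarrow> ('i gen list \<Rightarrow>\<^sub>0 'k) set" where
  "ugen chi g = U_ideal chi +>\<^bsub>(free_alg :: ('k, _) module)\<^esub> mon [g]"

definition Uplus ::
    "(int ^ 'i \<Rightarrow> int ^ 'i \<Rightarrow> 'k::field) \<Rightarrow> ('k, ('i gen list \<Rightarrow>\<^sub>0 'k) set) module" where
  "Uplus chi = (U chi)\<lparr>carrier := subalg_gen (U chi) (ugen chi ` range GE)\<rparr>"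

definition Uminus ::
    "(int ^ 'i \<Rightarrow> int ^ 'i \<Rightarrow> 'k::field) \<Rightarrow> ('k, ('i gen list \<Rightarrow>\<^sub>0 'k) set) module" where
  "Uminus chi = (U chi)\<lparr>carrier := subalg_gen (U chi) (ugen chi ` range GF)\<rparr>"

definition Uzero ::
    "(int ^ 'i \<Rightarrow> int ^ 'i \<Rightarrow> 'k::field) \<Rightarrow> ('k, ('i gen list \<Rightarrow>\<^sub>0 'k) set) module" where
  "Uzero chi = (U chi)\<lparr>carrier := subalg_gen (U chi) (ugen chi ` torus_gens)\<rparr>"

subsection \<open>Hopf algebra structure\<close>

text \<open>
  The structure maps below are determined by the conditions given; membership in
  \<^const>\<open>extensional\<close> only fixes their values outside the carrier.
\<close>

definition comult :: "(int ^ 'i \<Rightarrow> int ^ 'i \<Rightarrow> 'k::field) \<Rightarrow> ('i gen list \<Rightarrow>\<^sub>0 'k) set \<Rightarrow>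
    (('i gen list \<Rightarrow>\<^sub>0 'k) set \<times> ('i gen list \<Rightarrow>\<^sub>0 'k) set \<Rightarrow>\<^sub>0 'k) set" where
  "comult chi = (THE D. D \<in> alg_hom (U chi) (tensor (U chi) (U chi)) \<and> D \<in> extensional (carrier (U chi)) \<and>
     (\<forall>i. D (ugen chi (GK i)) = pure_tensor (U chi) (U chi) (ugen chi (GK i)) (ugen chi (GK i)) \<and>
          D (ugen chi (GL i)) = pure_tensor (U chi) (U chi) (ugen chi (GL i)) (ugen chi (GL i)) \<and>
          D (ugen chi (GE i)) = pure_tensor (U chi) (U chi) (ugen chi (GE i)) \<one>\<^bsub>U chi\<^esub>
            \<oplus>\<^bsub>tensor (U chi) (U chi)\<^esub> pure_tensor (U chi) (U chi) (ugen chi (GK i)) (ugen chi (GE i)) \<and>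
          D (ugen chi (GF i)) = pure_tensor (U chi) (U chi) \<one>\<^bsub>U chi\<^esub> (ugen chi (GF i))
            \<oplus>\<^bsub>tensor (U chi) (U chi)\<^esub> pure_tensor (U chi) (U chi) (ugen chi (GF i)) (ugen chi (GL i))))"

definition counit ::
    "(int ^ 'i \<Rightarrow> int ^ 'i \<Rightarrow> 'k::field) \<Rightarrow> ('i gen list \<Rightarrow>\<^sub>0 'k) set \<Rightarrow> 'k" where
  "counit chi = (THE e. e \<in> alg_hom (U chi) ground_alg \<and> e \<in> extensional (carrier (U chi)) \<and>
     (\<forall>i. e (ugen chi (GE i)) = 0 \<and> e (ugen chi (GF i)) = 0 \<and>
          e (ugen chi (GK i)) = 1 \<and> e (ugen chi (GL i)) = 1))"

text \<open>
  \<open>S(x\<^sub>(\<^sub>1\<^sub>)) x\<^sub>(\<^sub>2\<^sub>) = \<epsilon>(x) 1 = x\<^sub>(\<^sub>1\<^sub>) S(x\<^sub>(\<^sub>2\<^sub>))\<close>. An antipode is the convolution inverse of the identity,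
  so it is unique and the choice is immaterial.
\<close>

definition antipode :: "(int ^ 'i \<Rightarrow> int ^ 'i \<Rightarrow> 'k::field) \<Rightarrow>
    ('i gen list \<Rightarrow>\<^sub>0 'k) set \<Rightarrow> ('i gen list \<Rightarrow>\<^sub>0 'k) set" where
  "antipode chi = (SOME S. S \<in> lin_hom (U chi) (U chi) \<and> S \<in> extensional (carrier (U chi)) \<and>
     (\<forall>x\<in>carrier (U chi).
        tensor_lift (U chi) (U chi) (U chi) (\<lambda>a b. S a \<otimes>\<^bsub>U chi\<^esub> b) (comult chi x)
          = counit chi x \<odot>\<^bsub>U chi\<^esub> \<one>\<^bsub>U chi\<^esub> \<and>
        tensor_lift (U chi) (U chi) (U chi) (\<lambda>a b. a \<otimes>\<^bsub>U chi\<^esub> S b) (comult chi x)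
          = counit chi x \<odot>\<^bsub>U chi\<^esub> \<one>\<^bsub>U chi\<^esub>))"

text \<open>\<open>X \<cdot> Y = X\<^sub>(\<^sub>1\<^sub>) Y S(X\<^sub>(\<^sub>2\<^sub>))\<close>\<close>

definition adj_action :: "(int ^ 'i \<Rightarrow> int ^ 'i \<Rightarrow> 'k::field) \<Rightarrow>
    ('i gen list \<Rightarrow>\<^sub>0 'k) set \<Rightarrow> ('i gen list \<Rightarrow>\<^sub>0 'k) set \<Rightarrow> ('i gen list \<Rightarrow>\<^sub>0 'k) set" where
  "adj_action chi X Y = tensor_lift (U chi) (U chi) (U chi)
     (\<lambda>a b. a \<otimes>\<^bsub>U chi\<^esub> Y \<otimes>\<^bsub>U chi\<^esub> antipode chi b) (comult chi X)"

subsection \<open>The antiautomorphism and the skew derivations\<close>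

definition phi4 :: "(int ^ 'i \<Rightarrow> int ^ 'i \<Rightarrow> 'k::field) \<Rightarrow>
    ('i gen list \<Rightarrow>\<^sub>0 'k) set \<Rightarrow> ('i gen list \<Rightarrow>\<^sub>0 'k) set" where
  "phi4 chi = (THE f. f \<in> alg_antiaut (U chi) \<and> f \<in> extensional (carrier (U chi)) \<and>
     (\<forall>i. f (ugen chi (GK i)) = ugen chi (GK i) \<and> f (ugen chi (GL i)) = ugen chi (GL i) \<and>
          f (ugen chi (GE i)) = ugen chi (GF i) \<and> f (ugen chi (GF i)) = ugen chi (GE i)))"

definition skew_derivs :: "(int ^ 'i \<Rightarrow> int ^ 'i \<Rightarrow> 'k::field) \<Rightarrow> 'i \<Rightarrow>
    (('i gen list \<Rightarrow>\<^sub>0 'k) set \<Rightarrow> ('i gen list \<Rightarrow>\<^sub>0 'k) set) \<Rightarrow>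
    (('i gen list \<Rightarrow>\<^sub>0 'k) set \<Rightarrow> ('i gen list \<Rightarrow>\<^sub>0 'k) set) \<Rightarrow> bool" where
  "skew_derivs chi i dK dL \<longleftrightarrow>
     dK \<in> lin_hom (Uplus chi) (Uplus chi) \<and> dK \<in> extensional (carrier (Uplus chi)) \<and>
     dL \<in> lin_hom (Uplus chi) (Uplus chi) \<and> dL \<in> extensional (carrier (Uplus chi)) \<and>
     (\<forall>x\<in>carrier (Uplus chi).
        x \<otimes>\<^bsub>U chi\<^esub> ugen chi (GF i) \<ominus>\<^bsub>U chi\<^esub> ugen chi (GF i) \<otimes>\<^bsub>U chi\<^esub> x =
        dK x \<otimes>\<^bsub>U chi\<^esub> ugen chi (GK i) \<ominus>\<^bsub>U chi\<^esub> ugen chi (GL i) \<otimes>\<^bsub>U chi\<^esub> dL x)"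

definition derivK :: "(int ^ 'i \<Rightarrow> int ^ 'i \<Rightarrow> 'k::field) \<Rightarrow> 'i \<Rightarrow>
    ('i gen list \<Rightarrow>\<^sub>0 'k) set \<Rightarrow> ('i gen list \<Rightarrow>\<^sub>0 'k) set" where
  "derivK chi i = (THE dK. \<exists>dL. skew_derivs chi i dK dL)"

definition derivL :: "(int ^ 'i \<Rightarrow> int ^ 'i \<Rightarrow> 'k::field) \<Rightarrow> 'i \<Rightarrow>
    ('i gen list \<Rightarrow>\<^sub>0 'k) set \<Rightarrow> ('i gen list \<Rightarrow>\<^sub>0 'k) set" where
  "derivL chi i = (THE dL. \<exists>dK. skew_derivs chi i dK dL)"

subsection \<open>Triangular decomposition of a quotient\<close>

text \<open>
  \<open>P\<close> and \<open>M\<close> are the ideals \<open>I\<^sup>+\<close> and \<open>I\<^sup>-\<close>. The displayed condition on pure tensors says that \<open>h\<close> is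
  induced by multiplication; pure tensors span, so it determines the linear map \<open>h\<close>.
\<close>

definition mult_induces_iso :: "(int ^ 'i \<Rightarrow> int ^ 'i \<Rightarrow> 'k::field) \<Rightarrow>
    ('i gen list \<Rightarrow>\<^sub>0 'k) set set \<Rightarrow> ('i gen list \<Rightarrow>\<^sub>0 'k) set set \<Rightarrow> bool" where
  "mult_induces_iso chi P M \<longleftrightarrow>
     (let QP = quot_alg (Uplus chi) P; QM = quot_alg (Uminus chi) M;
          J = Idl\<^bsub>U chi\<^esub> (P <+>\<^bsub>U chi\<^esub> M); Q = quot_alg (U chi) J;
          T = tensor (tensor QP (Uzero chi)) QM
      in \<exists>h \<in> lin_hom T Q. bij_betw h (carrier T) (carrier Q) \<and>
           (\<forall>x\<in>carrier (Uplus chi). \<forall>y\<in>carrier (Uzero chi). \<forall>z\<in>carrier (Uminus chi).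
              h (pure_tensor (tensor QP (Uzero chi)) QM
                   (pure_tensor QP (Uzero chi) (P +>\<^bsub>Uplus chi\<^esub> x) y) (M +>\<^bsub>Uminus chi\<^esub> z))
              = J +>\<^bsub>U chi\<^esub> (x \<otimes>\<^bsub>U chi\<^esub> y \<otimes>\<^bsub>U chi\<^esub> z)))"

end

theory Submission
  imports Defs
begin

text \<open>
  Let \<open>A\<close>, \<open>H\<close>, \<open>B\<close> be the positive part, the torus and the negative part of U. Everything rests on the
  triangular decomposition: the products \<open>E\<^sub>u h F\<^sub>w\<close>, for words \<open>u\<close>, \<open>w\<close> and torus monomials \<open>h\<close>, form a basis. They
  span because the relations move every letter to its place (\<open>pbw_span\<close>). They are independent because U acts
  on a space with basis \<open>(u, a, b, w)\<close> in such a way that \<open>E\<^sub>u h F\<^sub>w\<close> sends one vector to the basis vector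
  \<open>(u, deg h, w)\<close> (\<open>coords_pbw\<close>); the relation between \<open>E\<^sub>j\<close> and \<open>F\<^sub>i\<close> serves as the recursive definition of
  the action of \<open>F\<^sub>i\<close>. From the coordinates one gets linear maps \<open>coef a b\<close> from U to \<open>A\<close> which extract the part of
  torus degree \<open>(a, b)\<close> without letters \<open>F\<close>. In particular the skew derivations exist and are unique: they are
  read off from the coefficients of \<open>[x, F\<^sub>i]\<close> at \<open>K\<^sub>i\<close> and \<open>L\<^sub>i\<close>.

  Call \<open>P\<close> stable if conjugation by torus monomials and both families of skew derivations preserve it.
  The space \<open>P H B\<close> equals \<open>P U\<close>, so it is a right ideal, and for stable \<open>P\<close> it is two-sided (\<open>PUU_ideal\<close>).
  Conversely, suppose \<open>U P U \<subseteq> P H B + A H M\<close>. For \<open>p \<in> P\<close> the elements \<open>h p h\<^sup>-\<^sup>1\<close> and \<open>[p, F\<^sub>i]\<close> lie in this sum. Every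
  coefficient of an element of the sum lies in \<open>P\<close>, because the counit kills \<open>M\<close>; hence \<open>P\<close> is stable
  (\<open>stable_if_gen_ideal\<close>). The antiautomorphism \<open>phi4\<close> exchanges \<open>A\<close> and \<open>B\<close> and carries both arguments over to \<open>M\<close>.
  Since \<open>H\<close> is spanned by group-like monomials, its adjoint action amounts to conjugation by them. Together
  this gives the equivalence of the last three conditions.

  For the first condition, the kernel of \<open>A \<otimes> H \<otimes> B \<rightarrow> A/P \<otimes> H \<otimes> B/M\<close> is \<open>P H B + A H M\<close>, so the induced map is
  injective if and only if the ideal generated by \<open>P + M\<close> is contained in this sum (\<open>mult_induces_iso_iff\<close>).

  The comultiplication, counit, antipode and antiautomorphism are given by descriptions, so their
  existence is part of the proof. All of them are obtained from the universal property of the presentation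
  (\<open>U_lift\<close>), applied to a tensor square, to the ground field and to the opposite algebra.
\<close>

section \<open>Vector spaces and algebras\<close>

text \<open>
  The ground field is a type, so vector spaces are not modules over a ring record. The axioms leave the
  multiplication of the record unconstrained, so that the quotient by a subspace that is not an ideal is
  a vector space, too.
\<close>

locale kspace = abelian_group A for A :: "('k::field, 'a) module" (structure) +
  assumes smult_closed [simp, intro]: "x \<in> carrier A \<Longrightarrow> c \<odot> x \<in> carrier A"
    and smult_l_distr: "x \<in> carrier A \<Longrightarrow> (c + d) \<odot> x = c \<odot> x \<oplus> d \<odot> x"
    and smult_r_distr: "x \<in> carrier A \<Longrightarrow> y \<in> carrier A \<Longrightarrow> c \<odot> (x \<oplus> y) = c \<odot> x \<oplus> c \<odot> y"
    and smult_assoc: "x \<in> carrier A \<Longrightarrow> (c * d) \<odot> x = c \<odot> (d \<odot> x)"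
    and smult_one [simp]: "x \<in> carrier A \<Longrightarrow> 1 \<odot> x = x"

locale kalgebra = kspace A + ring A for A :: "('k::field, 'a) module" (structure) +
  assumes smult_mult_l: "x \<in> carrier A \<Longrightarrow> y \<in> carrier A \<Longrightarrow> (c \<odot> x) \<otimes> y = c \<odot> (x \<otimes> y)"
    and smult_mult_r: "x \<in> carrier A \<Longrightarrow> y \<in> carrier A \<Longrightarrow> x \<otimes> (c \<odot> y) = c \<odot> (x \<otimes> y)"

context kspace begin

lemma smult_zero_l [simp]: "x \<in> carrier A \<Longrightarrow> 0 \<odot> x = \<zero>"
  using smult_l_distr[of x 0 0] by simp

lemma smult_zero_r [simp]: "c \<odot> \<zero> = \<zero>"
  using smult_r_distr[of \<zero> \<zero> c] by simp

lemma smult_minus_one: "x \<in> carrier A \<Longrightarrow> (- 1) \<odot> x = \<ominus> x"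
  using smult_l_distr[of x "-1" 1] by (simp add: minus_equality)

lemma smult_a_inv: "x \<in> carrier A \<Longrightarrow> c \<odot> (\<ominus> x) = \<ominus> (c \<odot> x)"
  using smult_r_distr[of "\<ominus> x" x c] by (simp add: minus_equality l_neg)

lemma smult_minus: "x \<in> carrier A \<Longrightarrow> y \<in> carrier A \<Longrightarrow> c \<odot> (x \<ominus> y) = c \<odot> x \<ominus> c \<odot> y"
  by (simp add: a_minus_def smult_r_distr smult_a_inv)

lemma smult_cancel: "x \<in> carrier A \<Longrightarrow> c \<noteq> 0 \<Longrightarrow> inverse c \<odot> (c \<odot> x) = x"
  "x \<in> carrier A \<Longrightarrow> c \<noteq> 0 \<Longrightarrow> c \<odot> (inverse c \<odot> x) = x"
  by (simp_all flip: smult_assoc)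

lemma minus_eq_zero_iff: "x \<in> carrier A \<Longrightarrow> y \<in> carrier A \<Longrightarrow> x \<ominus> y = \<zero> \<longleftrightarrow> x = y"
  by (metis a_minus_def add.inv_closed add.inv_inv minus_equality r_neg)

lemma add_minus_minus: "x \<in> carrier A \<Longrightarrow> y \<in> carrier A \<Longrightarrow> x \<oplus> y \<ominus> x \<ominus> y = \<zero>"
proof -
  assume "x \<in> carrier A" "y \<in> carrier A"
  then have "x \<oplus> y \<ominus> x \<ominus> y = (x \<oplus> y) \<ominus> (x \<oplus> y)" by (simp add: a_minus_def minus_add a_assoc)
  then show ?thesis using \<open>x \<in> carrier A\<close> \<open>y \<in> carrier A\<close> by (simp add: minus_eq_zero_iff)
qed

end

section \<open>Subspaces, spans and linear maps\<close>

definition lin_subspace :: "('k, 'a) module \<Rightarrow> 'a set \<Rightarrow> bool" where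
  "lin_subspace A S \<longleftrightarrow> S \<subseteq> carrier A \<and> \<zero>\<^bsub>A\<^esub> \<in> S \<and> (\<forall>x\<in>S. \<forall>y\<in>S. x \<oplus>\<^bsub>A\<^esub> y \<in> S) \<and>
     (\<forall>c. \<forall>x\<in>S. c \<odot>\<^bsub>A\<^esub> x \<in> S)"

lemma lin_subspaceI:
  assumes "S \<subseteq> carrier A" "\<zero>\<^bsub>A\<^esub> \<in> S" "\<And>x y. x \<in> S \<Longrightarrow> y \<in> S \<Longrightarrow> x \<oplus>\<^bsub>A\<^esub> y \<in> S"
    "\<And>c x. x \<in> S \<Longrightarrow> c \<odot>\<^bsub>A\<^esub> x \<in> S"
  shows "lin_subspace A S"
  using assms by (auto simp: lin_subspace_def)

lemma lin_subspaceD: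
  assumes "lin_subspace A S"
  shows "S \<subseteq> carrier A" "\<zero>\<^bsub>A\<^esub> \<in> S" "\<And>x y. x \<in> S \<Longrightarrow> y \<in> S \<Longrightarrow> x \<oplus>\<^bsub>A\<^esub> y \<in> S"
    "\<And>c x. x \<in> S \<Longrightarrow> c \<odot>\<^bsub>A\<^esub> x \<in> S" "\<And>x. x \<in> S \<Longrightarrow> x \<in> carrier A"
  using assms by (auto simp: lin_subspace_def)

lemma lin_span_least: "lin_subspace A W \<Longrightarrow> S \<subseteq> W \<Longrightarrow> lin_span A S \<subseteq> W"
proof
  fix x assume W: "lin_subspace A W" "S \<subseteq> W" and "x \<in> lin_span A S"
  from this(3) show "x \<in> W" by induction (use W in \<open>auto simp: lin_subspace_def\<close>)
qed

lemma lin_span_mono: "S \<subseteq> T \<Longrightarrow> lin_span A S \<subseteq> lin_span A T"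
proof
  fix x assume S: "S \<subseteq> T" and "x \<in> lin_span A S"
  from this(2) show "x \<in> lin_span A T" by induction (use S in \<open>auto intro: lin_span.intros\<close>)
qed

lemma lin_span_superset: "S \<subseteq> lin_span A S"
  by (auto intro: lin_span.base)

context kspace begin

lemma lin_subspace_carrier: "lin_subspace A (carrier A)"
  by (auto intro!: lin_subspaceI)

lemma lin_span_closed: "S \<subseteq> carrier A \<Longrightarrow> lin_span A S \<subseteq> carrier A"
  by (rule lin_span_least[OF lin_subspace_carrier])

lemma lin_subspace_span: "S \<subseteq> carrier A \<Longrightarrow> lin_subspace A (lin_span A S)"
  by (auto intro!: lin_subspaceI intro: lin_span.intros dest: lin_span_closed)

lemma lin_subspace_a_inv: "lin_subspace A S \<Longrightarrow> x \<in> S \<Longrightarrow> \<ominus> x \<in> S"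
  using lin_subspaceD[of A S] smult_minus_one by metis

lemma lin_subspace_minus: "lin_subspace A S \<Longrightarrow> x \<in> S \<Longrightarrow> y \<in> S \<Longrightarrow> x \<ominus> y \<in> S"
  by (simp add: a_minus_def lin_subspaceD lin_subspace_a_inv)

lemma lin_subspace_abelian_subgroup:
  assumes "lin_subspace A S" shows "abelian_subgroup S A"
proof (rule abelian_subgroupI3[OF additive_subgroup.intro])
  show "subgroup S (add_monoid A)"
    by (rule subgroup.intro)
      (use assms in \<open>auto simp: lin_subspaceD lin_subspace_a_inv simp flip: a_inv_def\<close>)
qed (rule abelian_group_axioms)

lemma coset_eq_iff:
  assumes "lin_subspace A S" "x \<in> carrier A" "y \<in> carrier A"
  shows "S +> x = S +> y \<longleftrightarrow> x \<ominus> y \<in> S"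
proof -
  interpret abelian_subgroup S A by (rule lin_subspace_abelian_subgroup[OF assms(1)])
  have "S +> x = S +> y \<longleftrightarrow> x \<in> S +> y"
    using assms(2,3) a_repr_independence'[of x y] a_rcos_self[of x] by auto
  also have "\<dots> \<longleftrightarrow> x \<ominus> y \<in> S"
    using assms(2,3) a_rcos_module by (simp add: a_minus_def)
  finally show ?thesis .
qed

lemma quot_carrier: "carrier (quot_alg A S) = (\<lambda>x. S +> x) ` carrier A"
  by (auto simp: quot_alg_def FactRing_def A_RCOSETS_def RCOSETS_def a_r_coset_def r_coset_def)

lemma quot_ops:
  assumes S: "lin_subspace A S"
  shows "\<zero>\<^bsub>quot_alg A S\<^esub> = S +> \<zero>"
    "x \<in> carrier A \<Longrightarrow> y \<in> carrier A \<Longrightarrow> (S +> x) \<oplus>\<^bsub>quot_alg A S\<^esub> (S +> y) = S +> (x \<oplus> y)"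
    "x \<in> carrier A \<Longrightarrow> c \<odot>\<^bsub>quot_alg A S\<^esub> (S +> x) = S +> (c \<odot> x)"
proof -
  interpret abelian_subgroup S A by (rule lin_subspace_abelian_subgroup[OF S])
  show "\<zero>\<^bsub>quot_alg A S\<^esub> = S +> \<zero>" using a_subset by (simp add: quot_alg_def FactRing_def)
  show "x \<in> carrier A \<Longrightarrow> y \<in> carrier A \<Longrightarrow> (S +> x) \<oplus>\<^bsub>quot_alg A S\<^esub> (S +> y) = S +> (x \<oplus> y)"
    by (simp add: quot_alg_def FactRing_def a_rcos_sum)
  assume x: "x \<in> carrier A"
  have eq: "S +> (c \<odot> y) = S +> (c \<odot> x)" if "y \<in> S +> x" for y
  proof -
    have y: "y \<in> carrier A" using that x by (meson a_elemrcos_carrier)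
    have "S +> y = S +> x" using that x by (metis a_repr_independence')
    then show ?thesis using x y coset_eq_iff[OF S] S
      by (simp add: lin_subspaceD flip: smult_minus)
  qed
  have "(\<Union>y\<in>S +> x. S +> (c \<odot> y)) = S +> (c \<odot> x)" by (rule UN_constant_eq[OF a_rcos_self[OF x]]) (intro ballI eq)
  then show "c \<odot>\<^bsub>quot_alg A S\<^esub> (S +> x) = S +> (c \<odot> x)"
    by (simp add: quot_alg_def)
qed

lemma quot_kspace:
  assumes S: "lin_subspace A S" shows "kspace (quot_alg A S)"
proof -
  note [simp] = quot_ops[OF S]
  have "abelian_group (quot_alg A S)"
  proof (rule abelian_groupI)
    fix x assume "x \<in> carrier (quot_alg A S)"
    then obtain a where a: "a \<in> carrier A" "x = S +> a" by (auto simp: quot_carrier)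
    then have "S +> (\<ominus> a) \<in> carrier (quot_alg A S)"
      "(S +> (\<ominus> a)) \<oplus>\<^bsub>quot_alg A S\<^esub> x = \<zero>\<^bsub>quot_alg A S\<^esub>"
      by (auto simp: quot_carrier l_neg)
    then show "\<exists>y\<in>carrier (quot_alg A S). y \<oplus>\<^bsub>quot_alg A S\<^esub> x = \<zero>\<^bsub>quot_alg A S\<^esub>" by blast
  qed (auto simp: quot_carrier a_ac)
  then interpret Q: abelian_group "quot_alg A S" .
  show ?thesis
    by unfold_locales (auto simp: quot_carrier smult_l_distr smult_r_distr smult_assoc)
qed

lemma quot_zero_iff:
  assumes "lin_subspace A S" "x \<in> carrier A"
  shows "S +> x = \<zero>\<^bsub>quot_alg A S\<^esub> \<longleftrightarrow> x \<in> S"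
proof -
  have "x \<ominus> \<zero> = x" using assms(2) by (simp add: a_minus_def)
  then show ?thesis using coset_eq_iff[OF assms, of \<zero>] by (simp add: quot_ops(1)[OF assms(1)])
qed

end

lemma lin_homI:
  assumes "\<And>x. x \<in> carrier A \<Longrightarrow> f x \<in> carrier B"
    "\<And>x y. x \<in> carrier A \<Longrightarrow> y \<in> carrier A \<Longrightarrow> f (x \<oplus>\<^bsub>A\<^esub> y) = f x \<oplus>\<^bsub>B\<^esub> f y"
    "\<And>c x. x \<in> carrier A \<Longrightarrow> f (c \<odot>\<^bsub>A\<^esub> x) = c \<odot>\<^bsub>B\<^esub> f x"
  shows "f \<in> lin_hom A B"
  using assms by (auto simp: lin_hom_def)

lemma lin_homD:
  assumes "f \<in> lin_hom A B"
  shows "x \<in> carrier A \<Longrightarrow> f x \<in> carrier B"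
    "x \<in> carrier A \<Longrightarrow> y \<in> carrier A \<Longrightarrow> f (x \<oplus>\<^bsub>A\<^esub> y) = f x \<oplus>\<^bsub>B\<^esub> f y"
    "x \<in> carrier A \<Longrightarrow> f (c \<odot>\<^bsub>A\<^esub> x) = c \<odot>\<^bsub>B\<^esub> f x"
  using assms by (auto simp: lin_hom_def)

lemma lin_hom_zero:
  assumes "f \<in> lin_hom A B" "kspace A" "kspace B" shows "f \<zero>\<^bsub>A\<^esub> = \<zero>\<^bsub>B\<^esub>"
proof -
  interpret A: kspace A by fact
  interpret B: kspace B by fact
  have "f (0 \<odot>\<^bsub>A\<^esub> \<zero>\<^bsub>A\<^esub>) = 0 \<odot>\<^bsub>B\<^esub> f \<zero>\<^bsub>A\<^esub>" using lin_homD[OF assms(1)] by blast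
  then show ?thesis using lin_homD(1)[OF assms(1)] by simp
qed

lemma lin_hom_a_inv:
  assumes "f \<in> lin_hom A B" "kspace A" "kspace B" "x \<in> carrier A" shows "f (\<ominus>\<^bsub>A\<^esub> x) = \<ominus>\<^bsub>B\<^esub> f x"
  by (metis assms kspace.smult_minus_one lin_homD(1,3))

lemma lin_hom_minus:
  assumes "f \<in> lin_hom A B" "kspace A" "kspace B" "x \<in> carrier A" "y \<in> carrier A"
  shows "f (x \<ominus>\<^bsub>A\<^esub> y) = f x \<ominus>\<^bsub>B\<^esub> f y"
proof -
  interpret A: kspace A by fact
  show ?thesis using assms by (simp add: a_minus_def lin_homD lin_hom_a_inv)
qed

lemma lin_hom_comp: "f \<in> lin_hom A B \<Longrightarrow> g \<in> lin_hom B C \<Longrightarrow> (\<lambda>x. g (f x)) \<in> lin_hom A C"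
  by (intro lin_homI) (simp_all add: lin_homD)

lemma lin_hom_id: "(\<lambda>x. x) \<in> lin_hom A A"
  by (intro lin_homI) simp_all

lemma lin_hom_preimage:
  assumes "f \<in> lin_hom A B" "kspace A" "kspace B" "lin_subspace B W"
  shows "lin_subspace A {x \<in> carrier A. f x \<in> W}"
proof -
  interpret A: kspace A by fact
  show ?thesis
    by (rule lin_subspaceI) (use assms in \<open>auto simp: lin_homD lin_subspaceD lin_hom_zero\<close>)
qed

lemma lin_hom_span_into:
  assumes "f \<in> lin_hom A B" "kspace A" "kspace B" "lin_subspace B W" "S \<subseteq> carrier A"
    "\<And>x. x \<in> S \<Longrightarrow> f x \<in> W" "x \<in> lin_span A S"
  shows "f x \<in> W"
  using lin_span_least[OF lin_hom_preimage[OF assms(1-4)], of S] assms(5-7) by auto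

lemma lin_hom_eq_on_span:
  assumes "f \<in> lin_hom A B" "g \<in> lin_hom A B" "kspace A" "kspace B" "S \<subseteq> carrier A"
    "\<And>x. x \<in> S \<Longrightarrow> f x = g x" "x \<in> lin_span A S"
  shows "f x = g x"
proof -
  interpret A: kspace A by fact
  have "lin_subspace A {x \<in> carrier A. f x = g x}"
    by (rule lin_subspaceI) (use assms in \<open>auto simp: lin_homD lin_hom_zero\<close>)
  then show ?thesis using lin_span_least[of A _ S] assms(5-7) by blast
qed

lemma lin_hom_image_span:
  assumes "f \<in> lin_hom A B" "kspace A" "kspace B" "S \<subseteq> carrier A"
  shows "f ` lin_span A S = lin_span B (f ` S)"
proof -
  interpret A: kspace A by fact
  interpret B: kspace B by fact
  have fS: "f ` S \<subseteq> carrier B" using assms(4) lin_homD(1)[OF assms(1)] by auto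
  have carr: "a \<in> carrier A" if "a \<in> lin_span A S" for a
    using A.lin_span_closed[OF assms(4)] that by blast
  have "y \<in> f ` lin_span A S" if "y \<in> lin_span B (f ` S)" for y
    using that
  proof induction
    case zero
    show ?case by (rule image_eqI[of _ f "\<zero>\<^bsub>A\<^esub>"]) (simp_all add: lin_hom_zero[OF assms(1-3)] lin_span.zero)
  next
    case (base y)
    then show ?case by (auto intro: lin_span.base)
  next
    case (add x y)
    then obtain a b where ab: "a \<in> lin_span A S" "b \<in> lin_span A S" "x = f a" "y = f b" by blast
    then have "x \<oplus>\<^bsub>B\<^esub> y = f (a \<oplus>\<^bsub>A\<^esub> b)" by (simp add: lin_homD(2)[OF assms(1)] carr)
    then show ?case by (rule image_eqI) (intro lin_span.add ab)
  next
    case (smult x c)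
    then obtain a where ab: "a \<in> lin_span A S" "x = f a" by blast
    then have "c \<odot>\<^bsub>B\<^esub> x = f (c \<odot>\<^bsub>A\<^esub> a)" by (simp add: lin_homD(3)[OF assms(1)] carr)
    then show ?case by (rule image_eqI) (intro lin_span.smult ab)
  qed
  moreover have "f ` lin_span A S \<subseteq> lin_span B (f ` S)"
    using lin_hom_span_into[OF assms(1-3) B.lin_subspace_span[OF fS] assms(4)]
    by (auto intro: lin_span.base)
  ultimately show ?thesis by blast
qed

lemma (in kspace) quot_lin_hom: "lin_subspace A S \<Longrightarrow> (\<lambda>x. S +> x) \<in> lin_hom A (quot_alg A S)"
  by (intro lin_homI) (auto simp: quot_ops quot_carrier)

lemma (in kspace) quot_factor:
  assumes S: "lin_subspace A S" and f: "f \<in> lin_hom A C" and C: "kspace C"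
    and z: "\<And>x. x \<in> S \<Longrightarrow> f x = \<zero>\<^bsub>C\<^esub>"
  obtains h where "h \<in> lin_hom (quot_alg A S) C" "\<And>x. x \<in> carrier A \<Longrightarrow> h (S +> x) = f x"
proof -
  interpret C: kspace C by fact
  define h where "h X = f (SOME x. x \<in> carrier A \<and> X = S +> x)" for X
  have h: "h (S +> x) = f x" if x: "x \<in> carrier A" for x
  proof -
    define y where "y = (SOME y. y \<in> carrier A \<and> S +> x = S +> y)"
    have y: "y \<in> carrier A" "S +> x = S +> y"
      using someI[of "\<lambda>y. y \<in> carrier A \<and> S +> x = S +> y" x] x by (auto simp: y_def)
    then have "f (x \<ominus> y) = \<zero>\<^bsub>C\<^esub>" using coset_eq_iff[OF S x] z by simp
    then have "f x \<ominus>\<^bsub>C\<^esub> f y = \<zero>\<^bsub>C\<^esub>"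
      using lin_hom_minus[OF f kspace_axioms C] x y by simp
    then have "f x = f y" using x y lin_homD(1)[OF f] by (simp add: C.minus_eq_zero_iff)
    then show ?thesis by (simp add: h_def y_def)
  qed
  have "h \<in> lin_hom (quot_alg A S) C"
    by (intro lin_homI) (auto simp: quot_carrier h lin_homD[OF f] quot_ops[OF S])
  with h show ?thesis using that by blast
qed

section \<open>Algebras, ideals and quotients\<close>

context kalgebra begin

lemma ideal_lin_subspace:
  assumes "ideal I A" shows "lin_subspace A I"
proof -
  interpret I: ideal I A by fact
  show ?thesis
  proof (rule lin_subspaceI)
    fix c x assume x: "x \<in> I"
    then have "c \<odot> x = (c \<odot> \<one>) \<otimes> x" using I.a_subset by (auto simp: smult_mult_l)
    then show "c \<odot> x \<in> I" using x by (simp add: I.I_l_closed)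
  qed (use I.a_subset in auto)
qed

lemma idealI_subspace:
  assumes "lin_subspace A I" "\<And>a x. a \<in> carrier A \<Longrightarrow> x \<in> I \<Longrightarrow> a \<otimes> x \<in> I"
    "\<And>a x. a \<in> carrier A \<Longrightarrow> x \<in> I \<Longrightarrow> x \<otimes> a \<in> I"
  shows "ideal I A"
  by (rule idealI[OF ring_axioms])
    (use assms lin_subspace_abelian_subgroup in \<open>auto simp: abelian_subgroup_def additive_subgroup_def\<close>)

lemma quot_mult:
  assumes "ideal I A" "x \<in> carrier A" "y \<in> carrier A"
  shows "(I +> x) \<otimes>\<^bsub>quot_alg A I\<^esub> (I +> y) = I +> (x \<otimes> y)"
  using ideal.rcoset_mult_add[OF assms] by (simp add: quot_alg_def FactRing_def)

lemma quot_one: "\<one>\<^bsub>quot_alg A I\<^esub> = I +> \<one>"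
  by (simp add: quot_alg_def FactRing_def)

lemma quot_kalgebra:
  assumes I: "ideal I A" shows "kalgebra (quot_alg A I)"
proof -
  note S = ideal_lin_subspace[OF I]
  note [simp] = quot_ops[OF S] quot_mult[OF I] quot_one
  interpret Q: kspace "quot_alg A I" by (rule quot_kspace[OF S])
  have "ring (quot_alg A I)"
    by (rule ringI[OF Q.abelian_group_axioms monoidI])
      (auto simp: quot_carrier m_assoc l_distr r_distr)
  then interpret Q: ring "quot_alg A I" .
  show ?thesis by unfold_locales (auto simp: quot_carrier smult_mult_l smult_mult_r)
qed

end

lemma alg_homI:
  assumes "f \<in> lin_hom A B" "f \<one>\<^bsub>A\<^esub> = \<one>\<^bsub>B\<^esub>"
    "\<And>x y. x \<in> carrier A \<Longrightarrow> y \<in> carrier A \<Longrightarrow> f (x \<otimes>\<^bsub>A\<^esub> y) = f x \<otimes>\<^bsub>B\<^esub> f y"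
  shows "f \<in> alg_hom A B"
  using assms by (auto simp: alg_hom_def ring_hom_def lin_hom_def)

lemma alg_homD:
  assumes "f \<in> alg_hom A B"
  shows "f \<in> lin_hom A B" "f \<one>\<^bsub>A\<^esub> = \<one>\<^bsub>B\<^esub>"
    "x \<in> carrier A \<Longrightarrow> y \<in> carrier A \<Longrightarrow> f (x \<otimes>\<^bsub>A\<^esub> y) = f x \<otimes>\<^bsub>B\<^esub> f y"
  using assms by (auto simp: alg_hom_def ring_hom_def)

lemma (in kalgebra) quot_alg_hom: "ideal I A \<Longrightarrow> (\<lambda>x. I +> x) \<in> alg_hom A (quot_alg A I)"
  by (intro alg_homI quot_lin_hom ideal_lin_subspace) (simp_all add: quot_one quot_mult)

lemma (in kalgebra) quot_factor_alg:
  assumes I: "ideal I A" and f: "f \<in> alg_hom A C" and C: "kspace C"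
    and z: "\<And>x. x \<in> I \<Longrightarrow> f x = \<zero>\<^bsub>C\<^esub>"
  obtains h where "h \<in> alg_hom (quot_alg A I) C" "\<And>x. x \<in> carrier A \<Longrightarrow> h (I +> x) = f x"
proof -
  obtain h where h: "h \<in> lin_hom (quot_alg A I) C" "\<And>x. x \<in> carrier A \<Longrightarrow> h (I +> x) = f x"
    using quot_factor[OF ideal_lin_subspace[OF I] alg_homD(1)[OF f] C z] by blast
  have "h \<in> alg_hom (quot_alg A I) C"
    by (intro alg_homI h) (auto simp: quot_one quot_carrier quot_mult[OF I] h(2) alg_homD[OF f])
  then show ?thesis using h(2) that by blast
qed

text \<open>
  Antihomomorphisms are homomorphisms into the opposite algebra. In this way the antipode and the
  antiautomorphism also come from the universal property.
\<close>

definition op_alg :: "('k, 'a) module \<Rightarrow> ('k, 'a) module" where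
  "op_alg A = A\<lparr>mult := (\<lambda>x y. y \<otimes>\<^bsub>A\<^esub> x)\<rparr>"

lemma op_alg_simps [simp]:
  "carrier (op_alg A) = carrier A" "add (op_alg A) = add A" "zero (op_alg A) = zero A"
  "one (op_alg A) = one A" "smult (op_alg A) = smult A" "x \<otimes>\<^bsub>op_alg A\<^esub> y = y \<otimes>\<^bsub>A\<^esub> x"
  by (simp_all add: op_alg_def)

lemma (in kalgebra) op_kalgebra: "kalgebra (op_alg A)"
proof -
  have "abelian_group (op_alg A)"
    by (rule abelian_groupI) (auto simp: a_ac intro: bexI[of _ "\<ominus> _"] l_neg)
  then have "ring (op_alg A)"
    by (rule ringI[OF _ monoidI]) (auto simp: m_assoc l_distr r_distr)
  then interpret R: ring "op_alg A" .
  show ?thesis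
    by unfold_locales
      (auto simp: smult_l_distr smult_r_distr smult_assoc smult_mult_l smult_mult_r)
qed

lemma lin_hom_op: "lin_hom A (op_alg B) = lin_hom A B"
  by (auto simp: lin_hom_def)

text \<open>
  The target of a representation. Linear maps are compared as total functions, so this becomes
  an algebra when every element of the type is a vector.
\<close>

definition end_alg :: "('k, 'a) module \<Rightarrow> ('k, 'a \<Rightarrow> 'a) module" where
  "end_alg V = \<lparr>carrier = lin_hom V V, mult = (\<lambda>f g x. f (g x)), one = (\<lambda>x. x), zero = (\<lambda>x. \<zero>\<^bsub>V\<^esub>),
     add = (\<lambda>f g x. f x \<oplus>\<^bsub>V\<^esub> g x), smult = (\<lambda>c f x. c \<odot>\<^bsub>V\<^esub> f x)\<rparr>"

lemma (in kspace) end_kalgebra: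
  assumes [simp]: "carrier A = UNIV" shows "kalgebra (end_alg A)"
proof -
  have "abelian_group (end_alg A)"
  proof (rule abelian_groupI)
    fix f assume "f \<in> carrier (end_alg A)"
    then have "(\<lambda>x. \<ominus> f x) \<in> carrier (end_alg A) \<and>
      (\<lambda>x. \<ominus> f x) \<oplus>\<^bsub>end_alg A\<^esub> f = \<zero>\<^bsub>end_alg A\<^esub>"
      by (auto simp: end_alg_def lin_hom_def minus_add l_neg smult_a_inv fun_eq_iff)
    then show "\<exists>g\<in>carrier (end_alg A). g \<oplus>\<^bsub>end_alg A\<^esub> f = \<zero>\<^bsub>end_alg A\<^esub>" by blast
  qed (auto simp: end_alg_def lin_hom_def smult_r_distr a_ac fun_eq_iff)
  then have "ring (end_alg A)"
    by (rule ringI[OF _ monoidI])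
      (auto simp: end_alg_def lin_hom_def)
  then interpret R: ring "end_alg A" .
  show ?thesis
    by unfold_locales
      (auto simp: end_alg_def lin_hom_def smult_l_distr smult_r_distr fun_eq_iff mult.commute
        simp flip: smult_assoc)
qed

section \<open>Monoid algebras\<close>

lemma lookup_scale [simp]: "Poly_Mapping.lookup (Poly_Mapping.map ((*) (c::'k::field)) p) k = c * Poly_Mapping.lookup p k"
  by (cases "Poly_Mapping.lookup p k = 0") (auto simp: Poly_Mapping.map.rep_eq)

lemma scale_single [simp]:
  "Poly_Mapping.map ((*) (c::'k::field)) (Poly_Mapping.single a d) = Poly_Mapping.single a (c * d)"
  by (rule poly_mapping_eqI) (simp add: lookup_single when_def)

lemma scale_zero [simp]: "Poly_Mapping.map ((*) (c::'k::field)) 0 = 0"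
  by (rule poly_mapping_eqI) simp

lemma keys_scale: "Poly_Mapping.keys (Poly_Mapping.map ((*) (c::'k::field)) p) \<subseteq> Poly_Mapping.keys p"
  by (auto simp: in_keys_iff)

text \<open>
  Reduces additive statements about \<open>p\<close> to monomials without leaving the given support.
\<close>

lemma pm_induct [consumes 1, case_names zero single add]:
  fixes p :: "'a \<Rightarrow>\<^sub>0 'k::ab_group_add"
  assumes "Poly_Mapping.keys p \<subseteq> X" "P 0" "\<And>a c. a \<in> X \<Longrightarrow> P (Poly_Mapping.single a c)"
    "\<And>p q. Poly_Mapping.keys p \<subseteq> X \<Longrightarrow> Poly_Mapping.keys q \<subseteq> X \<Longrightarrow> P p \<Longrightarrow> P q \<Longrightarrow> P (p + q)"
  shows "P p"
proof -
  have "P p" if "finite S" "S \<subseteq> X" "Poly_Mapping.keys p \<subseteq> S" for S p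
    using that
  proof (induction arbitrary: p)
    case empty
    then have "p = 0" by (intro poly_mapping_eqI) (auto simp: in_keys_iff)
    then show ?case using assms(2) by simp
  next
    case (insert a S)
    define q where "q = p - Poly_Mapping.single a (Poly_Mapping.lookup p a)"
    have q: "Poly_Mapping.keys q \<subseteq> S"
      using insert.prems(2) by (auto simp: q_def in_keys_iff lookup_minus lookup_single when_def split: if_splits)
    have p: "p = q + Poly_Mapping.single a (Poly_Mapping.lookup p a)" by (simp add: q_def)
    show ?case
      by (subst p, rule assms(4)) (use insert q assms(3) in auto)
  qed
  from this[OF finite_keys _ subset_refl] assms(1) show ?thesis by blast
qed

lemma monoid_alg_simps [simp]:
  "carrier (monoid_alg M) = {p. Poly_Mapping.keys p \<subseteq> carrier M}"
  "add (monoid_alg M) = (+)" "zero (monoid_alg M) = 0"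
  "smult (monoid_alg M) = (\<lambda>c. Poly_Mapping.map ((*) c))"
  "one (monoid_alg M) = Poly_Mapping.single \<one>\<^bsub>M\<^esub> 1"
  by (simp_all add: monoid_alg_def)

lemma monoid_alg_kspace: "kspace (monoid_alg M :: ('k::field, 'm \<Rightarrow>\<^sub>0 'k) module)"
proof -
  have "abelian_group (monoid_alg M :: ('k, 'm \<Rightarrow>\<^sub>0 'k) module)"
  proof (rule abelian_groupI)
    fix x :: "'m \<Rightarrow>\<^sub>0 'k" assume "x \<in> carrier (monoid_alg M)"
    then show "\<exists>y\<in>carrier (monoid_alg M). y \<oplus>\<^bsub>monoid_alg M\<^esub> x = \<zero>\<^bsub>monoid_alg M\<^esub>"
      by (intro bexI[of _ "- x"]) (auto simp: in_keys_iff)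
  qed (auto simp: ac_simps dest!: subsetD[OF Poly_Mapping.keys_add])
  then interpret abelian_group "monoid_alg M :: ('k, 'm \<Rightarrow>\<^sub>0 'k) module" .
  show ?thesis
    by unfold_locales
      (auto intro!: poly_mapping_eqI simp: lookup_add algebra_simps dest!: subsetD[OF keys_scale])
qed

lemma monoid_alg_minus:
  assumes "p \<in> carrier (monoid_alg M)" "q \<in> carrier (monoid_alg M)"
  shows "p \<ominus>\<^bsub>monoid_alg M\<^esub> q = p - (q :: 'm \<Rightarrow>\<^sub>0 'k::field)"
proof -
  interpret kspace "monoid_alg M :: ('k, 'm \<Rightarrow>\<^sub>0 'k) module" by (rule monoid_alg_kspace)
  have "\<ominus>\<^bsub>monoid_alg M\<^esub> q = - q"
    using assms(2) by (intro minus_equality) (auto simp: in_keys_iff)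
  then show ?thesis by (simp add: a_minus_def)
qed

lemma monoid_alg_span:
  "carrier (monoid_alg M) = lin_span (monoid_alg M) ((\<lambda>a. Poly_Mapping.single a (1::'k::field)) ` carrier M)"
    (is "_ = lin_span ?A ?S")
proof
  interpret kspace ?A by (rule monoid_alg_kspace)
  show "lin_span ?A ?S \<subseteq> carrier ?A" by (rule lin_span_closed) auto
  show "carrier ?A \<subseteq> lin_span ?A ?S"
  proof
    fix p assume "p \<in> carrier ?A"
    then have "Poly_Mapping.keys p \<subseteq> carrier M" by simp
    then show "p \<in> lin_span ?A ?S"
    proof (induction rule: pm_induct)
      case zero show ?case using lin_span.zero[of ?A ?S] by simp
    next
      case (single a c)
      then have "c \<odot>\<^bsub>?A\<^esub> Poly_Mapping.single a 1 \<in> lin_span ?A ?S"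
        by (intro lin_span.smult lin_span.base) auto
      then show ?case by simp
    next
      case (add p q) then show ?case using lin_span.add[of p ?A ?S q] by simp
    qed
  qed
qed

definition lin_ext :: "('k::field, 'c) module \<Rightarrow> ('x \<Rightarrow> 'c) \<Rightarrow> ('x \<Rightarrow>\<^sub>0 'k) \<Rightarrow> 'c" where
  "lin_ext C f p = finsum C (\<lambda>x. Poly_Mapping.lookup p x \<odot>\<^bsub>C\<^esub> f x) (Poly_Mapping.keys p)"

context kspace begin

lemma lin_ext_superset:
  assumes "f \<in> X \<rightarrow> carrier A" "Poly_Mapping.keys p \<subseteq> Y" "finite Y" "Y \<subseteq> X"
  shows "lin_ext A f p = finsum A (\<lambda>x. Poly_Mapping.lookup p x \<odot> f x) Y"
  unfolding lin_ext_def
  by (rule add.finprod_mono_neutral_cong_left)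
    (use assms in \<open>auto simp: in_keys_iff Pi_iff subset_iff\<close>)

lemma lin_ext_closed:
  "f \<in> X \<rightarrow> carrier A \<Longrightarrow> Poly_Mapping.keys p \<subseteq> X \<Longrightarrow> lin_ext A f p \<in> carrier A"
  unfolding lin_ext_def by (rule finsum_closed) auto

lemma lin_ext_add:
  assumes f: "f \<in> X \<rightarrow> carrier A" and p: "Poly_Mapping.keys p \<subseteq> X" "Poly_Mapping.keys q \<subseteq> X"
  shows "lin_ext A f (p + q) = lin_ext A f p \<oplus> lin_ext A f q"
proof -
  let ?Y = "Poly_Mapping.keys p \<union> Poly_Mapping.keys q"
  have Y: "f x \<in> carrier A" if "x \<in> ?Y" for x using that assms by auto
  have "lin_ext A f (p + q) = finsum A (\<lambda>x. Poly_Mapping.lookup (p + q) x \<odot> f x) ?Y"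
    by (rule lin_ext_superset[OF f]) (use p in \<open>auto dest: subsetD[OF Poly_Mapping.keys_add]\<close>)
  also have "\<dots> = finsum A (\<lambda>x. Poly_Mapping.lookup p x \<odot> f x \<oplus> Poly_Mapping.lookup q x \<odot> f x) ?Y"
    by (rule finsum_cong') (use Y in \<open>auto simp: lookup_add smult_l_distr\<close>)
  also have "\<dots> = finsum A (\<lambda>x. Poly_Mapping.lookup p x \<odot> f x) ?Y \<oplus> finsum A (\<lambda>x. Poly_Mapping.lookup q x \<odot> f x) ?Y"
    by (rule finsum_addf) (use Y in auto)
  also have "\<dots> = lin_ext A f p \<oplus> lin_ext A f q"
    using lin_ext_superset[OF f, of p ?Y] lin_ext_superset[OF f, of q ?Y] p by simp
  finally show ?thesis .
qed

lemma lin_ext_single: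
  assumes f: "f a \<in> carrier A"
  shows "lin_ext A f (Poly_Mapping.single a c) = c \<odot> f a"
proof -
  have "lin_ext A f (Poly_Mapping.single a c) = finsum A (\<lambda>x. Poly_Mapping.lookup (Poly_Mapping.single a c) x \<odot> f x) {a}"
    by (rule lin_ext_superset[of _ "{a}"]) (use f in auto)
  also have "\<dots> = c \<odot> f a" using finsum_insert[of "{}" a] f by simp
  finally show ?thesis .
qed

lemma lin_ext_scale:
  assumes f: "f \<in> X \<rightarrow> carrier A" and p: "Poly_Mapping.keys p \<subseteq> X"
  shows "lin_ext A f (Poly_Mapping.map ((*) c) p) = c \<odot> lin_ext A f p"
  using p
proof (induction rule: pm_induct)
  case zero
  show ?case by (simp add: lin_ext_def)
next
  case (single a d)
  then have "f a \<in> carrier A" using f by auto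
  then show ?case by (simp add: lin_ext_single smult_assoc)
next
  case (add p q)
  have "Poly_Mapping.map ((*) c) (p + q) = Poly_Mapping.map ((*) c) p + Poly_Mapping.map ((*) c) q"
    by (rule poly_mapping_eqI) (simp add: lookup_add distrib_left)
  moreover have "Poly_Mapping.keys (Poly_Mapping.map ((*) c) p) \<subseteq> X" "Poly_Mapping.keys (Poly_Mapping.map ((*) c) q) \<subseteq> X"
    by (rule order_trans[OF keys_scale add.hyps(1)], rule order_trans[OF keys_scale add.hyps(2)])
  ultimately show ?case using lin_ext_closed[OF f add.hyps(1)] lin_ext_closed[OF f add.hyps(2)]
    by (simp only: lin_ext_add[OF f] add smult_r_distr)
qed

lemma lin_ext_hom:
  "f \<in> carrier M \<rightarrow> carrier A \<Longrightarrow> lin_ext A f \<in> lin_hom (monoid_alg M) A"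
  by (intro lin_homI) (auto simp: lin_ext_closed lin_ext_add lin_ext_scale)

end

text \<open>
  Allowing larger finite index sets lets the sums for \<open>p\<close>, \<open>q\<close> and \<open>p + q\<close> be compared termwise.
\<close>

lemma monoid_alg_mult_superset:
  fixes p q :: "'m \<Rightarrow>\<^sub>0 'k::field"
  assumes "finite S" "finite T" "Poly_Mapping.keys p \<subseteq> S" "Poly_Mapping.keys q \<subseteq> T"
  shows "p \<otimes>\<^bsub>monoid_alg M\<^esub> q = (\<Sum>a\<in>S. \<Sum>b\<in>T.
       Poly_Mapping.single (a \<otimes>\<^bsub>M\<^esub> b) (Poly_Mapping.lookup p a * Poly_Mapping.lookup q b))"
proof -
  have "(\<Sum>b\<in>Poly_Mapping.keys q. Poly_Mapping.single (a \<otimes>\<^bsub>M\<^esub> b) (Poly_Mapping.lookup p a * Poly_Mapping.lookup q b))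
     = (\<Sum>b\<in>T. Poly_Mapping.single (a \<otimes>\<^bsub>M\<^esub> b) (Poly_Mapping.lookup p a * Poly_Mapping.lookup q b))" for a
    by (rule sum.mono_neutral_left) (use assms in \<open>auto simp: in_keys_iff\<close>)
  then have "p \<otimes>\<^bsub>monoid_alg M\<^esub> q = (\<Sum>a\<in>Poly_Mapping.keys p. \<Sum>b\<in>T.
       Poly_Mapping.single (a \<otimes>\<^bsub>M\<^esub> b) (Poly_Mapping.lookup p a * Poly_Mapping.lookup q b))"
    by (simp add: monoid_alg_def)
  also have "\<dots> = (\<Sum>a\<in>S. \<Sum>b\<in>T.
       Poly_Mapping.single (a \<otimes>\<^bsub>M\<^esub> b) (Poly_Mapping.lookup p a * Poly_Mapping.lookup q b))"
    by (rule sum.mono_neutral_left) (use assms in \<open>auto simp: in_keys_iff\<close>)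
  finally show ?thesis .
qed

lemma monoid_alg_mult_single [simp]:
  "Poly_Mapping.single a c \<otimes>\<^bsub>monoid_alg M\<^esub> Poly_Mapping.single b d = Poly_Mapping.single (a \<otimes>\<^bsub>M\<^esub> b) (c * (d::'k::field))"
  by (subst monoid_alg_mult_superset[of "{a}" "{b}"]) auto

lemma monoid_alg_mult_add:
  fixes p q r :: "'m \<Rightarrow>\<^sub>0 'k::field"
  shows "(p + q) \<otimes>\<^bsub>monoid_alg M\<^esub> r = p \<otimes>\<^bsub>monoid_alg M\<^esub> r + q \<otimes>\<^bsub>monoid_alg M\<^esub> r"
    "r \<otimes>\<^bsub>monoid_alg M\<^esub> (p + q) = r \<otimes>\<^bsub>monoid_alg M\<^esub> p + r \<otimes>\<^bsub>monoid_alg M\<^esub> q"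
proof -
  let ?S = "Poly_Mapping.keys p \<union> Poly_Mapping.keys q" and ?T = "Poly_Mapping.keys r"
  have S: "finite ?S" "Poly_Mapping.keys (p + q) \<subseteq> ?S" "Poly_Mapping.keys p \<subseteq> ?S" "Poly_Mapping.keys q \<subseteq> ?S"
    by (auto dest!: subsetD[OF Poly_Mapping.keys_add])
  show "(p + q) \<otimes>\<^bsub>monoid_alg M\<^esub> r = p \<otimes>\<^bsub>monoid_alg M\<^esub> r + q \<otimes>\<^bsub>monoid_alg M\<^esub> r"
    by (simp add: S monoid_alg_mult_superset[of ?S ?T] lookup_add distrib_right single_add sum.distrib)
  show "r \<otimes>\<^bsub>monoid_alg M\<^esub> (p + q) = r \<otimes>\<^bsub>monoid_alg M\<^esub> p + r \<otimes>\<^bsub>monoid_alg M\<^esub> q"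
    by (simp add: S monoid_alg_mult_superset[of ?T ?S] lookup_add distrib_left single_add sum.distrib)
qed

lemma monoid_alg_mult_zero:
  "0 \<otimes>\<^bsub>monoid_alg M\<^esub> (p :: 'm \<Rightarrow>\<^sub>0 'k::field) = 0" "(p :: 'm \<Rightarrow>\<^sub>0 'k::field) \<otimes>\<^bsub>monoid_alg M\<^esub> 0 = 0"
  by (simp_all add: monoid_alg_def)

lemma scale_add: "Poly_Mapping.map ((*) (c::'k::field)) (p + q) = Poly_Mapping.map ((*) c) p + Poly_Mapping.map ((*) c) q"
  by (rule poly_mapping_eqI) (simp add: lookup_add distrib_left)

lemma monoid_alg_mult_scale:
  fixes p q :: "'m \<Rightarrow>\<^sub>0 'k::field"
  shows "Poly_Mapping.map ((*) c) p \<otimes>\<^bsub>monoid_alg M\<^esub> q = Poly_Mapping.map ((*) c) (p \<otimes>\<^bsub>monoid_alg M\<^esub> q)"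
    "p \<otimes>\<^bsub>monoid_alg M\<^esub> Poly_Mapping.map ((*) c) q = Poly_Mapping.map ((*) c) (p \<otimes>\<^bsub>monoid_alg M\<^esub> q)"
proof -
  have p: "Poly_Mapping.keys p \<subseteq> UNIV" and q: "Poly_Mapping.keys q \<subseteq> UNIV" by auto
  have 1: "Poly_Mapping.map ((*) c) (Poly_Mapping.single a d) \<otimes>\<^bsub>monoid_alg M\<^esub> q = Poly_Mapping.map ((*) c) (Poly_Mapping.single a d \<otimes>\<^bsub>monoid_alg M\<^esub> q)" for a d
    using q by (induction rule: pm_induct) (simp_all add: monoid_alg_mult_zero monoid_alg_mult_add scale_add mult.assoc)
  show "Poly_Mapping.map ((*) c) p \<otimes>\<^bsub>monoid_alg M\<^esub> q = Poly_Mapping.map ((*) c) (p \<otimes>\<^bsub>monoid_alg M\<^esub> q)"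
    using p by (induction rule: pm_induct) (use 1 in \<open>simp_all add: monoid_alg_mult_zero monoid_alg_mult_add scale_add\<close>)
  have 2: "Poly_Mapping.single a d \<otimes>\<^bsub>monoid_alg M\<^esub> Poly_Mapping.map ((*) c) q = Poly_Mapping.map ((*) c) (Poly_Mapping.single a d \<otimes>\<^bsub>monoid_alg M\<^esub> q)" for a d
    using q by (induction rule: pm_induct) (simp_all add: monoid_alg_mult_zero monoid_alg_mult_add scale_add mult.left_commute)
  show "p \<otimes>\<^bsub>monoid_alg M\<^esub> Poly_Mapping.map ((*) c) q = Poly_Mapping.map ((*) c) (p \<otimes>\<^bsub>monoid_alg M\<^esub> q)"
    using p by (induction rule: pm_induct) (use 2 in \<open>simp_all add: monoid_alg_mult_zero monoid_alg_mult_add scale_add\<close>)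
qed

lemma monoid_alg_kalgebra:
  assumes "Group.monoid M"
  shows "kalgebra (monoid_alg M :: ('k::field, 'm \<Rightarrow>\<^sub>0 'k) module)" (is "kalgebra ?A")
proof -
  interpret M: Group.monoid M by fact
  interpret A: kspace ?A by (rule monoid_alg_kspace)
  let ?m = "\<lambda>p q. p \<otimes>\<^bsub>?A\<^esub> q"
  note bilin = monoid_alg_mult_zero monoid_alg_mult_add
  have closed: "?m p q \<in> carrier ?A" if "p \<in> carrier ?A" "q \<in> carrier ?A" for p q
  proof -
    have *: "Poly_Mapping.keys p \<subseteq> carrier M" "Poly_Mapping.keys q \<subseteq> carrier M" using that by auto
    have 1: "?m (Poly_Mapping.single a c) q \<in> carrier ?A" if "a \<in> carrier M" for a c
      using *(2) by (induction rule: pm_induct) (use that A.a_closed in \<open>auto simp: bilin\<close>)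
    show ?thesis
      using *(1) by (induction rule: pm_induct) (use 1 A.a_closed in \<open>auto simp: bilin\<close>)
  qed
  have assoc: "?m (?m p q) r = ?m p (?m q r)" if "p \<in> carrier ?A" "q \<in> carrier ?A" "r \<in> carrier ?A" for p q r
  proof -
    have *: "Poly_Mapping.keys p \<subseteq> carrier M" "Poly_Mapping.keys q \<subseteq> carrier M" "Poly_Mapping.keys r \<subseteq> carrier M"
      using that by auto
    have 1: "?m (?m (Poly_Mapping.single a c) (Poly_Mapping.single b d)) r
       = ?m (Poly_Mapping.single a c) (?m (Poly_Mapping.single b d) r)"
      if "a \<in> carrier M" "b \<in> carrier M" for a b c d
      using *(3) by (induction rule: pm_induct) (use that in \<open>auto simp: bilin M.m_assoc mult_ac\<close>)
    have 2: "?m (?m (Poly_Mapping.single a c) q) r = ?m (Poly_Mapping.single a c) (?m q r)"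
      if "a \<in> carrier M" for a c
      using *(2) by (induction rule: pm_induct) (use that 1 in \<open>auto simp: bilin\<close>)
    show ?thesis
      using *(1) by (induction rule: pm_induct) (use 2 in \<open>auto simp: bilin\<close>)
  qed
  have unit: "?m \<one>\<^bsub>?A\<^esub> p = p" "?m p \<one>\<^bsub>?A\<^esub> = p" if "p \<in> carrier ?A" for p
  proof -
    have *: "Poly_Mapping.keys p \<subseteq> carrier M" using that by auto
    show "?m \<one>\<^bsub>?A\<^esub> p = p" using * by (induction rule: pm_induct) (auto simp: bilin)
    show "?m p \<one>\<^bsub>?A\<^esub> = p" using * by (induction rule: pm_induct) (auto simp: bilin)
  qed
  have "Group.monoid ?A"
    by (rule monoidI) (use closed assoc unit in auto)
  then have "ring ?A"
    by (rule ringI[OF A.abelian_group_axioms]) (auto simp: bilin)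
  then interpret R: ring ?A .
  show ?thesis
    by unfold_locales (auto simp: monoid_alg_mult_scale)
qed

lemma bilin_closed_span:
  assumes "kalgebra A" "lin_subspace A W" "S \<subseteq> carrier A" "T \<subseteq> carrier A"
    "\<And>x y. x \<in> S \<Longrightarrow> y \<in> T \<Longrightarrow> x \<otimes>\<^bsub>A\<^esub> y \<in> W" "x \<in> lin_span A S" "y \<in> lin_span A T"
  shows "x \<otimes>\<^bsub>A\<^esub> y \<in> W"
proof -
  interpret kalgebra A by fact
  have *: "(\<lambda>z. z \<otimes>\<^bsub>A\<^esub> y) \<in> lin_hom A A" if "y \<in> carrier A" for y
    using that by (intro lin_homI) (auto simp: l_distr smult_mult_l)
  have **: "(\<lambda>z. x \<otimes>\<^bsub>A\<^esub> z) \<in> lin_hom A A" if "x \<in> carrier A" for x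
    using that by (intro lin_homI) (auto simp: r_distr smult_mult_r)
  have yc: "y \<in> carrier A" using lin_span_closed[OF assms(4)] assms(7) by blast
  have "x' \<otimes>\<^bsub>A\<^esub> y \<in> W" if "x' \<in> S" for x'
    using lin_hom_span_into[OF **[of x'] kspace_axioms kspace_axioms assms(2,4) _ assms(7)] that assms(3,5)
    by blast
  then show ?thesis
    using lin_hom_span_into[OF *[OF yc] kspace_axioms kspace_axioms assms(2,3) _ assms(6)] by blast
qed

lemma (in kalgebra) lin_ext_alg_hom:
  assumes M: "Group.monoid M" and f: "f \<in> carrier M \<rightarrow> carrier A" and one: "f \<one>\<^bsub>M\<^esub> = \<one>"
    and mult: "\<And>a b. a \<in> carrier M \<Longrightarrow> b \<in> carrier M \<Longrightarrow> f (a \<otimes>\<^bsub>M\<^esub> b) = f a \<otimes> f b"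
  shows "lin_ext A f \<in> alg_hom (monoid_alg M) A"
proof (rule alg_homI[OF lin_ext_hom[OF f]])
  interpret M: Group.monoid M by fact
  have fc: "f a \<in> carrier A" if "a \<in> carrier M" for a using f that by auto
  interpret MA: kalgebra "monoid_alg M :: ('k, _) module" by (rule monoid_alg_kalgebra[OF M])
  show "lin_ext A f \<one>\<^bsub>monoid_alg M\<^esub> = \<one>" using fc[of "\<one>\<^bsub>M\<^esub>"] by (simp add: lin_ext_single one)
  fix p q :: "_ \<Rightarrow>\<^sub>0 'k" assume pq: "p \<in> carrier (monoid_alg M)" "q \<in> carrier (monoid_alg M)"
  then have *: "Poly_Mapping.keys p \<subseteq> carrier M" "Poly_Mapping.keys q \<subseteq> carrier M" by auto
  note hom = lin_ext_add[OF f] monoid_alg_mult_add monoid_alg_mult_zero l_distr r_distr lin_ext_closed[OF f]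
  have z: "lin_ext A f 0 = \<zero>" by (simp add: lin_ext_def)
  have mc: "Poly_Mapping.keys (x \<otimes>\<^bsub>monoid_alg M\<^esub> y) \<subseteq> carrier M"
    if "Poly_Mapping.keys x \<subseteq> carrier M" "Poly_Mapping.keys y \<subseteq> carrier M" for x y :: "_ \<Rightarrow>\<^sub>0 'k"
    using MA.m_closed[of x y] that by simp
  have ks: "Poly_Mapping.keys (Poly_Mapping.single a (c::'k)) \<subseteq> carrier M" if "a \<in> carrier M" for a c
    using that by auto
  have 1: "lin_ext A f (Poly_Mapping.single a c \<otimes>\<^bsub>monoid_alg M\<^esub> q) = lin_ext A f (Poly_Mapping.single a c) \<otimes> lin_ext A f q"
    if "a \<in> carrier M" for a c
    using *(2)
  proof (induction rule: pm_induct)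
    case (single b d)
    then show ?case using that
      by (simp add: lin_ext_single fc mult smult_mult_l smult_mult_r mult.commute flip: smult_assoc)
  qed (use that in \<open>simp_all add: hom z mc ks\<close>)
  show "lin_ext A f (p \<otimes>\<^bsub>monoid_alg M\<^esub> q) = lin_ext A f p \<otimes> lin_ext A f q"
    using *(1)
    by (induction rule: pm_induct) (use 1 *(2) in \<open>simp_all add: hom z mc\<close>)
qed

section \<open>Free algebras\<close>

abbreviation word_monoid :: "'g list Group.monoid" where
  "word_monoid \<equiv> \<lparr>carrier = UNIV, mult = (@), one = []\<rparr>"

lemma word_monoid: "Group.monoid word_monoid"
  by (rule monoidI) auto

lemma free_kalgebra: "kalgebra (free_alg :: ('k::field, 'g list \<Rightarrow>\<^sub>0 'k) module)"
  unfolding free_alg_def by (rule monoid_alg_kalgebra[OF word_monoid])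

lemma free_alg_simps [simp]:
  "carrier free_alg = UNIV" "add free_alg = (+)" "zero free_alg = 0"
  "smult free_alg = (\<lambda>c. Poly_Mapping.map ((*) c))" "one free_alg = Poly_Mapping.single [] 1"
  "Poly_Mapping.single u c \<otimes>\<^bsub>free_alg\<^esub> Poly_Mapping.single v d = Poly_Mapping.single (u @ v) (c * (d::'k::field))"
  by (simp_all add: free_alg_def)

lemma free_alg_minus [simp]: "p \<ominus>\<^bsub>free_alg\<^esub> q = p - (q :: _ \<Rightarrow>\<^sub>0 'k::field)"
  unfolding free_alg_def by (rule monoid_alg_minus) auto

lemma free_alg_span: "UNIV = lin_span free_alg (range (\<lambda>w. Poly_Mapping.single w (1::'k::field)))"
  using monoid_alg_span[of word_monoid] by (simp add: free_alg_def)

definition wprod :: "('k, 'a) module \<Rightarrow> ('g \<Rightarrow> 'a) \<Rightarrow> 'g list \<Rightarrow> 'a" where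
  "wprod A f w = foldr (\<lambda>g x. f g \<otimes>\<^bsub>A\<^esub> x) w \<one>\<^bsub>A\<^esub>"

lemma wprod_simps [simp]: "wprod A f [] = \<one>\<^bsub>A\<^esub>" "wprod A f (g # w) = f g \<otimes>\<^bsub>A\<^esub> wprod A f w"
  by (simp_all add: wprod_def)

context kalgebra begin

lemma wprod_closed: "(\<And>g. g \<in> set w \<Longrightarrow> f g \<in> carrier A) \<Longrightarrow> wprod A f w \<in> carrier A"
  by (induction w) auto

lemma wprod_append:
  "(\<And>g. g \<in> set u \<union> set v \<Longrightarrow> f g \<in> carrier A) \<Longrightarrow> wprod A f (u @ v) = wprod A f u \<otimes> wprod A f v"
  by (induction u) (auto simp: m_assoc wprod_closed)

lemma free_lift:
  assumes "\<And>g. f g \<in> carrier A"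
  shows "lin_ext A (wprod A f) \<in> alg_hom free_alg A" "lin_ext A (wprod A f) (Poly_Mapping.single w c) = c \<odot> wprod A f w"
  unfolding free_alg_def
  by (rule lin_ext_alg_hom[OF word_monoid]) (auto simp: assms wprod_closed wprod_append lin_ext_single)

end

section \<open>Tensor products\<close>

definition bilinear_map :: "('k::field, 'a) module \<Rightarrow> ('k, 'b) module \<Rightarrow> ('k, 'c) module \<Rightarrow> ('a \<Rightarrow> 'b \<Rightarrow> 'c) \<Rightarrow> bool" where
  "bilinear_map A B C f \<longleftrightarrow> (\<forall>b\<in>carrier B. (\<lambda>a. f a b) \<in> lin_hom A C) \<and> (\<forall>a\<in>carrier A. f a \<in> lin_hom B C)"

lemma bilinear_mapI:
  assumes "\<And>a b. a \<in> carrier A \<Longrightarrow> b \<in> carrier B \<Longrightarrow> f a b \<in> carrier C"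
    "\<And>a a' b. a \<in> carrier A \<Longrightarrow> a' \<in> carrier A \<Longrightarrow> b \<in> carrier B \<Longrightarrow> f (a \<oplus>\<^bsub>A\<^esub> a') b = f a b \<oplus>\<^bsub>C\<^esub> f a' b"
    "\<And>a b b'. a \<in> carrier A \<Longrightarrow> b \<in> carrier B \<Longrightarrow> b' \<in> carrier B \<Longrightarrow> f a (b \<oplus>\<^bsub>B\<^esub> b') = f a b \<oplus>\<^bsub>C\<^esub> f a b'"
    "\<And>c a b. a \<in> carrier A \<Longrightarrow> b \<in> carrier B \<Longrightarrow> f (c \<odot>\<^bsub>A\<^esub> a) b = c \<odot>\<^bsub>C\<^esub> f a b"
    "\<And>c a b. a \<in> carrier A \<Longrightarrow> b \<in> carrier B \<Longrightarrow> f a (c \<odot>\<^bsub>B\<^esub> b) = c \<odot>\<^bsub>C\<^esub> f a b"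
  shows "bilinear_map A B C f"
  using assms by (auto simp: bilinear_map_def intro!: lin_homI)

lemma bilinear_mapD:
  assumes "bilinear_map A B C f"
  shows "a \<in> carrier A \<Longrightarrow> b \<in> carrier B \<Longrightarrow> f a b \<in> carrier C"
    "a \<in> carrier A \<Longrightarrow> a' \<in> carrier A \<Longrightarrow> b \<in> carrier B \<Longrightarrow> f (a \<oplus>\<^bsub>A\<^esub> a') b = f a b \<oplus>\<^bsub>C\<^esub> f a' b"
    "a \<in> carrier A \<Longrightarrow> b \<in> carrier B \<Longrightarrow> b' \<in> carrier B \<Longrightarrow> f a (b \<oplus>\<^bsub>B\<^esub> b') = f a b \<oplus>\<^bsub>C\<^esub> f a b'"
    "a \<in> carrier A \<Longrightarrow> b \<in> carrier B \<Longrightarrow> f (c \<odot>\<^bsub>A\<^esub> a) b = c \<odot>\<^bsub>C\<^esub> f a b"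
    "a \<in> carrier A \<Longrightarrow> b \<in> carrier B \<Longrightarrow> f a (c \<odot>\<^bsub>B\<^esub> b) = c \<odot>\<^bsub>C\<^esub> f a b"
  using assms by (auto simp: bilinear_map_def lin_hom_def)

text \<open>
  The tensor product is studied first for vector spaces: the factors of the triangular decomposition
  of a quotient enter only as such.
\<close>

locale tensor_spaces = A: kspace A + B: kspace B
  for A :: "('k::field, 'a) module" and B :: "('k, 'b) module"
begin

abbreviation MA :: "('k, 'a \<times> 'b \<Rightarrow>\<^sub>0 'k) module" where "MA \<equiv> monoid_alg (A \<times>\<times> B)"

sublocale MA: kspace MA by (rule monoid_alg_kspace)

definition rels where
  "rels = {Poly_Mapping.single (a \<oplus>\<^bsub>A\<^esub> a', b) 1
        - Poly_Mapping.single (a, b) 1 - Poly_Mapping.single (a', b) (1::'k) | a a' b.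
        a \<in> carrier A \<and> a' \<in> carrier A \<and> b \<in> carrier B} \<union>
     {Poly_Mapping.single (a, b \<oplus>\<^bsub>B\<^esub> b') 1
        - Poly_Mapping.single (a, b) 1 - Poly_Mapping.single (a, b') 1 | a b b'.
        a \<in> carrier A \<and> b \<in> carrier B \<and> b' \<in> carrier B} \<union>
     {Poly_Mapping.single (c \<odot>\<^bsub>A\<^esub> a, b) 1 - Poly_Mapping.single (a, b) c | c a b.
        a \<in> carrier A \<and> b \<in> carrier B} \<union>
     {Poly_Mapping.single (a, c \<odot>\<^bsub>B\<^esub> b) 1 - Poly_Mapping.single (a, b) c | c a b.
        a \<in> carrier A \<and> b \<in> carrier B}"

lemma relsI:
  "a \<in> carrier A \<Longrightarrow> a' \<in> carrier A \<Longrightarrow> b \<in> carrier B \<Longrightarrow> Poly_Mapping.single (a \<oplus>\<^bsub>A\<^esub> a', b) 1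
        - Poly_Mapping.single (a, b) 1 - Poly_Mapping.single (a', b) 1 \<in> rels"
  "a \<in> carrier A \<Longrightarrow> b \<in> carrier B \<Longrightarrow> b' \<in> carrier B \<Longrightarrow> Poly_Mapping.single (a, b \<oplus>\<^bsub>B\<^esub> b') 1
        - Poly_Mapping.single (a, b) 1 - Poly_Mapping.single (a, b') 1 \<in> rels"
  "a \<in> carrier A \<Longrightarrow> b \<in> carrier B \<Longrightarrow> Poly_Mapping.single (c \<odot>\<^bsub>A\<^esub> a, b) 1 - Poly_Mapping.single (a, b) c \<in> rels"
  "a \<in> carrier A \<Longrightarrow> b \<in> carrier B \<Longrightarrow> Poly_Mapping.single (a, c \<odot>\<^bsub>B\<^esub> b) 1 - Poly_Mapping.single (a, b) c \<in> rels"
  unfolding rels_def by blast+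

lemma tensor_rels_span: "tensor_rels A B = lin_span MA rels"
  unfolding tensor_rels_def rels_def ..

lemma single_carrier: "a \<in> carrier A \<Longrightarrow> b \<in> carrier B \<Longrightarrow> Poly_Mapping.single (a, b) c \<in> carrier MA"
  by (auto simp: DirProd_def)

lemma diff_carrier: "p \<in> carrier MA \<Longrightarrow> q \<in> carrier MA \<Longrightarrow> p - q \<in> carrier MA"
  using MA.minus_closed[of p q] monoid_alg_minus[of p "A \<times>\<times> B" q] by simp

lemma rels_carrier: "rels \<subseteq> carrier MA"
  unfolding rels_def by (auto simp del: monoid_alg_simps intro!: diff_carrier single_carrier)

lemma rels_subspace: "lin_subspace MA (tensor_rels A B)"
  unfolding tensor_rels_span by (rule MA.lin_subspace_span[OF rels_carrier])

lemma tensor_kspace: "kspace (tensor A B)"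
  unfolding tensor_def by (rule MA.quot_kspace[OF rels_subspace])

sublocale T: kspace "tensor A B" by (rule tensor_kspace)

abbreviation pt where "pt \<equiv> pure_tensor A B"

lemma pt_closed [simp, intro]: "a \<in> carrier A \<Longrightarrow> b \<in> carrier B \<Longrightarrow> pt a b \<in> carrier (tensor A B)"
  by (simp add: tensor_def pure_tensor_def MA.quot_carrier single_carrier del: monoid_alg_simps)

lemma coset_eqI: "p - q \<in> rels \<Longrightarrow> p \<in> carrier MA \<Longrightarrow> q \<in> carrier MA \<Longrightarrow>
    tensor_rels A B +>\<^bsub>MA\<^esub> p = tensor_rels A B +>\<^bsub>MA\<^esub> q"
  by (subst MA.coset_eq_iff[OF rels_subspace])
    (auto simp del: monoid_alg_simps simp: monoid_alg_minus tensor_rels_span intro: lin_span.base)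

lemma pt_smult_eq: "a \<in> carrier A \<Longrightarrow> b \<in> carrier B \<Longrightarrow>
    c \<odot>\<^bsub>tensor A B\<^esub> pt a b = tensor_rels A B +>\<^bsub>MA\<^esub> Poly_Mapping.single (a, b) c"
  unfolding tensor_def pure_tensor_def using MA.quot_ops(3)[OF rels_subspace single_carrier, of a b c 1]
  by simp

lemma pt_add_eq: "a \<in> carrier A \<Longrightarrow> b \<in> carrier B \<Longrightarrow> a' \<in> carrier A \<Longrightarrow> b' \<in> carrier B \<Longrightarrow>
    pt a b \<oplus>\<^bsub>tensor A B\<^esub> pt a' b' = tensor_rels A B +>\<^bsub>MA\<^esub> (Poly_Mapping.single (a, b) 1 + Poly_Mapping.single (a', b') 1)"
  unfolding tensor_def pure_tensor_def
  using MA.quot_ops(2)[OF rels_subspace single_carrier single_carrier, of a b a' b' 1 1] by simp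

lemma pt_bilinear: "bilinear_map A B (tensor A B) pt"
proof (rule bilinear_mapI)
  have add: "pt x y = pt a b \<oplus>\<^bsub>tensor A B\<^esub> pt a' b'"
    if "Poly_Mapping.single (x, y) 1 - Poly_Mapping.single (a, b) 1 - Poly_Mapping.single (a', b') 1 \<in> rels"
      "x \<in> carrier A" "y \<in> carrier B" "a \<in> carrier A" "b \<in> carrier B" "a' \<in> carrier A" "b' \<in> carrier B"
    for x y a b a' b'
  proof -
    have "Poly_Mapping.single (a, b) 1 + Poly_Mapping.single (a', b') 1 \<in> carrier MA"
      using MA.a_closed[OF single_carrier single_carrier, of a b a' b' 1 1] that by simp
    then show ?thesis
      using coset_eqI[of "Poly_Mapping.single (x, y) 1" "Poly_Mapping.single (a, b) 1 + Poly_Mapping.single (a', b') 1"]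
        that single_carrier[of x y 1] pt_add_eq[of a b a' b'] by (simp add: diff_diff_eq pure_tensor_def del: monoid_alg_simps)
  qed
  show "pt (a \<oplus>\<^bsub>A\<^esub> a') b = pt a b \<oplus>\<^bsub>tensor A B\<^esub> pt a' b"
    if "a \<in> carrier A" "a' \<in> carrier A" "b \<in> carrier B" for a a' b
    by (rule add) (use that in \<open>auto simp: rels_def\<close>)
  show "pt a (b \<oplus>\<^bsub>B\<^esub> b') = pt a b \<oplus>\<^bsub>tensor A B\<^esub> pt a b'"
    if "a \<in> carrier A" "b \<in> carrier B" "b' \<in> carrier B" for a b b'
    by (rule add) (use that in \<open>auto simp: rels_def\<close>)
next
  fix c a b assume "a \<in> carrier A" "b \<in> carrier B"
  then show "pt (c \<odot>\<^bsub>A\<^esub> a) b = c \<odot>\<^bsub>tensor A B\<^esub> pt a b"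
    by (subst pt_smult_eq, simp_all only: pure_tensor_def, intro coset_eqI)
      (auto simp: rels_def single_carrier simp del: monoid_alg_simps)
next
  fix c a b assume "a \<in> carrier A" "b \<in> carrier B"
  then show "pt a (c \<odot>\<^bsub>B\<^esub> b) = c \<odot>\<^bsub>tensor A B\<^esub> pt a b"
    by (subst pt_smult_eq, simp_all only: pure_tensor_def, intro coset_eqI)
      (auto simp: rels_def single_carrier simp del: monoid_alg_simps)
qed (rule pt_closed)

lemmas pt_simps = bilinear_mapD(2-5)[OF pt_bilinear]

lemma tensor_span: "carrier (tensor A B) = lin_span (tensor A B) {pt a b | a b. a \<in> carrier A \<and> b \<in> carrier B}"
proof -
  let ?S = "(\<lambda>x. Poly_Mapping.single x (1::'k)) ` carrier (A \<times>\<times> B)"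
  have "carrier (tensor A B) = (\<lambda>x. tensor_rels A B +>\<^bsub>MA\<^esub> x) ` lin_span MA ?S"
    unfolding tensor_def by (subst MA.quot_carrier) (subst monoid_alg_span, rule refl)
  also have "\<dots> = lin_span (tensor A B) ((\<lambda>x. tensor_rels A B +>\<^bsub>MA\<^esub> x) ` ?S)"
    unfolding tensor_def
    by (rule lin_hom_image_span[OF MA.quot_lin_hom[OF rels_subspace] MA.kspace_axioms MA.quot_kspace[OF rels_subspace]])
      auto
  also have "(\<lambda>x. tensor_rels A B +>\<^bsub>MA\<^esub> x) ` ?S = {pt a b | a b. a \<in> carrier A \<and> b \<in> carrier B}"
    by (auto simp: pure_tensor_def DirProd_def)
  finally show ?thesis .
qed

lemma tensor_hom_eqI:
  assumes "f \<in> lin_hom (tensor A B) C" "g \<in> lin_hom (tensor A B) C" "kspace C"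
    "\<And>a b. a \<in> carrier A \<Longrightarrow> b \<in> carrier B \<Longrightarrow> f (pt a b) = g (pt a b)" "x \<in> carrier (tensor A B)"
  shows "f x = g x"
  by (rule lin_hom_eq_on_span[OF assms(1,2) T.kspace_axioms assms(3)])
    (use assms(4,5) tensor_span in auto)

text \<open>
  The linear extension of a bilinear map kills each of the four families of bilinearity relations,
  hence their span, and factors through the quotient.
\<close>

lemma tensor_ex_lift:
  assumes f: "bilinear_map A B C f" and C: "kspace C"
  obtains h where "h \<in> lin_hom (tensor A B) C" "\<And>a b. a \<in> carrier A \<Longrightarrow> b \<in> carrier B \<Longrightarrow> h (pt a b) = f a b"
proof -
  interpret C: kspace C by fact
  let ?f = "\<lambda>(a, b). f a b"
  note [simp] = bilinear_mapD[OF f] C.lin_ext_single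
  have f': "?f \<in> carrier (A \<times>\<times> B) \<rightarrow> carrier C" by (auto simp: DirProd_def)
  let ?h = "lin_ext C ?f"
  have h: "?h \<in> lin_hom MA C" by (rule C.lin_ext_hom[OF f'])
  have d: "?h (p - q) = ?h p \<ominus>\<^bsub>C\<^esub> ?h q" if "p \<in> carrier MA" "q \<in> carrier MA" for p q
    using lin_hom_minus[OF h MA.kspace_axioms C that] monoid_alg_minus[OF that] by simp
  have z: "?h x = \<zero>\<^bsub>C\<^esub>" if "x \<in> rels" for x
    using that unfolding rels_def
    by (auto simp: d single_carrier diff_carrier C.minus_eq_zero_iff C.add_minus_minus simp del: monoid_alg_simps)
  have "lin_subspace C {\<zero>\<^bsub>C\<^esub>}" by (rule lin_subspaceI) auto
  from lin_hom_span_into[OF h MA.kspace_axioms C this rels_carrier]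
  have z': "?h x = \<zero>\<^bsub>C\<^esub>" if "x \<in> tensor_rels A B" for x
    using that z by (auto simp: tensor_rels_span)
  obtain g where g: "g \<in> lin_hom (tensor A B) C" "\<And>x. x \<in> carrier MA \<Longrightarrow> g (tensor_rels A B +>\<^bsub>MA\<^esub> x) = ?h x"
    unfolding tensor_def using MA.quot_factor[OF rels_subspace h C z'] by blast
  have "g (pt a b) = f a b" if "a \<in> carrier A" "b \<in> carrier B" for a b
    using g(2)[OF single_carrier[OF that]] that by (simp add: pure_tensor_def)
  with g(1) show ?thesis using that by blast
qed

lemma tensor_lift:
  assumes f: "bilinear_map A B C f" and C: "kspace C"
  shows "tensor_lift A B C f \<in> lin_hom (tensor A B) C"
    "\<And>a b. a \<in> carrier A \<Longrightarrow> b \<in> carrier B \<Longrightarrow> tensor_lift A B C f (pt a b) = f a b"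
proof -
  obtain h where h: "h \<in> lin_hom (tensor A B) C" "\<And>a b. a \<in> carrier A \<Longrightarrow> b \<in> carrier B \<Longrightarrow> h (pt a b) = f a b"
    using tensor_ex_lift[OF f C] by blast
  let ?h = "restrict h (carrier (tensor A B))"
  let ?P = "\<lambda>h. h \<in> lin_hom (tensor A B) C \<and> h \<in> extensional (carrier (tensor A B)) \<and>
     (\<forall>a\<in>carrier A. \<forall>b\<in>carrier B. h (pt a b) = f a b)"
  have P: "?P ?h" using h by (auto simp: lin_hom_def)
  have "k = ?h" if "?P k" for k
    by (rule extensionalityI[of _ "carrier (tensor A B)"]) (use that P tensor_hom_eqI[OF _ _ C, of k ?h] in auto)
  with P have "?P (tensor_lift A B C f)" unfolding tensor_lift_def by (rule theI)
  then show "tensor_lift A B C f \<in> lin_hom (tensor A B) C"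
    "\<And>a b. a \<in> carrier A \<Longrightarrow> b \<in> carrier B \<Longrightarrow> tensor_lift A B C f (pt a b) = f a b" by auto
qed

end

locale tensor_algebras = A: kalgebra A + B: kalgebra B
  for A :: "('k::field, 'a) module" and B :: "('k, 'b) module"
begin

sublocale tensor_spaces A B ..

sublocale MA: kalgebra MA
  by (rule monoid_alg_kalgebra) (rule DirProd_monoid, unfold_locales)

text \<open>
  A bilinearity relation multiplied by a pair \<open>(c, d)\<close> is a relation of the same family. So the relations
  span an ideal, and the tensor product of two algebras is an algebra.
\<close>

lemma rels_ideal: "ideal (tensor_rels A B) MA"
proof (rule MA.idealI_subspace[OF rels_subspace])
  let ?S = "(\<lambda>x. Poly_Mapping.single x (1::'k)) ` carrier (A \<times>\<times> B)"
  have S: "?S \<subseteq> carrier MA" by auto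
  have dist: "u \<otimes>\<^bsub>MA\<^esub> (p - q) = u \<otimes>\<^bsub>MA\<^esub> p - u \<otimes>\<^bsub>MA\<^esub> q" "(p - q) \<otimes>\<^bsub>MA\<^esub> u = p \<otimes>\<^bsub>MA\<^esub> u - q \<otimes>\<^bsub>MA\<^esub> u"
    for p q u :: "'a \<times> 'b \<Rightarrow>\<^sub>0 'k"
    using monoid_alg_mult_add[where p = "p - q" and q = q and r = u and M = "A \<times>\<times> B"]
    by simp_all
  have l: "a \<otimes>\<^bsub>MA\<^esub> x \<in> tensor_rels A B" if "a \<in> ?S" "x \<in> rels" for a x
  proof -
    have "a \<otimes>\<^bsub>MA\<^esub> x \<in> rels"
      using that(2) unfolding rels_def[THEN eqset_imp_iff, of x]
      by (elim UnE CollectE exE conjE)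
        (use that(1) in \<open>auto simp: dist A.r_distr B.r_distr A.smult_mult_r B.smult_mult_r intro!: relsI\<close>)
    then show ?thesis unfolding tensor_rels_span by (rule lin_span.base)
  qed
  have r: "x \<otimes>\<^bsub>MA\<^esub> a \<in> tensor_rels A B" if "a \<in> ?S" "x \<in> rels" for a x
  proof -
    have "x \<otimes>\<^bsub>MA\<^esub> a \<in> rels"
      using that(2) unfolding rels_def[THEN eqset_imp_iff, of x]
      by (elim UnE CollectE exE conjE)
        (use that(1) in \<open>auto simp: dist A.l_distr B.l_distr A.smult_mult_l B.smult_mult_l intro!: relsI\<close>)
    then show ?thesis unfolding tensor_rels_span by (rule lin_span.base)
  qed
  fix a x assume a: "a \<in> carrier MA" and x: "x \<in> tensor_rels A B"
  from a have a: "a \<in> lin_span MA ?S" unfolding monoid_alg_span .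
  show "a \<otimes>\<^bsub>MA\<^esub> x \<in> tensor_rels A B"
    using bilin_closed_span[OF MA.kalgebra_axioms rels_subspace S rels_carrier l] a x
    unfolding tensor_rels_span by blast
  show "x \<otimes>\<^bsub>MA\<^esub> a \<in> tensor_rels A B"
    using bilin_closed_span[OF MA.kalgebra_axioms rels_subspace rels_carrier S r] a x
    unfolding tensor_rels_span by blast
qed

lemma tensor_kalgebra: "kalgebra (tensor A B)"
  unfolding tensor_def by (rule MA.quot_kalgebra[OF rels_ideal])

sublocale T: kalgebra "tensor A B" by (rule tensor_kalgebra)

lemma pt_mult: "a \<in> carrier A \<Longrightarrow> b \<in> carrier B \<Longrightarrow> a' \<in> carrier A \<Longrightarrow> b' \<in> carrier B \<Longrightarrow>
    pt a b \<otimes>\<^bsub>tensor A B\<^esub> pt a' b' = pt (a \<otimes>\<^bsub>A\<^esub> a') (b \<otimes>\<^bsub>B\<^esub> b')"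
  unfolding tensor_def pure_tensor_def
  using MA.quot_mult[OF rels_ideal single_carrier single_carrier, of a b a' b' 1 1]
  by (simp add: DirProd_def)

lemma pt_one: "\<one>\<^bsub>tensor A B\<^esub> = pt \<one>\<^bsub>A\<^esub> \<one>\<^bsub>B\<^esub>"
  unfolding tensor_def pure_tensor_def by (subst MA.quot_one) (simp add: DirProd_def)

end

section \<open>Presentation and universal property\<close>

text \<open>
  The reason is \<open>x b = b (a x) b\<close>. This supplies the relations for \<open>K\<^sub>i\<^sup>-\<^sup>1\<close> and \<open>L\<^sub>i\<^sup>-\<^sup>1\<close>, which the
  presentation does not list.
\<close>

lemma (in kalgebra) skew_commute_inverse:
  assumes [simp]: "a \<in> carrier A" "b \<in> carrier A" "x \<in> carrier A" "a \<otimes> b = \<one>" "b \<otimes> a = \<one>" "c \<noteq> 0"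
    and ax: "a \<otimes> x = c \<odot> (x \<otimes> a)"
  shows "b \<otimes> x = inverse c \<odot> (x \<otimes> b)"
proof -
  have "x \<otimes> b = (b \<otimes> a) \<otimes> x \<otimes> b" by (subst assms(5)) simp
  also have "\<dots> = b \<otimes> (a \<otimes> x) \<otimes> b" by (simp add: m_assoc del: assms(5))
  also have "\<dots> = c \<odot> (b \<otimes> x \<otimes> (a \<otimes> b))" by (simp only: ax) (simp add: m_assoc smult_mult_l smult_mult_r del: assms(4))
  also have "\<dots> = c \<odot> (b \<otimes> x)" by simp
  finally show ?thesis by (simp add: smult_cancel)
qed

lemma (in kalgebra) conj_iff_skew_commute:
  assumes [simp]: "a \<in> carrier A" "b \<in> carrier A" "x \<in> carrier A" "a \<otimes> b = \<one>" "b \<otimes> a = \<one>"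
  shows "a \<otimes> x \<otimes> b = c \<odot> x \<longleftrightarrow> a \<otimes> x = c \<odot> (x \<otimes> a)"
proof
  assume *: "a \<otimes> x \<otimes> b = c \<odot> x"
  have "a \<otimes> x = (a \<otimes> x) \<otimes> (b \<otimes> a)" by simp
  also have "\<dots> = (a \<otimes> x \<otimes> b) \<otimes> a" by (simp add: m_assoc del: assms(5))
  finally show "a \<otimes> x = c \<odot> (x \<otimes> a)" by (simp add: * smult_mult_l)
next
  assume "a \<otimes> x = c \<odot> (x \<otimes> a)"
  then show "a \<otimes> x \<otimes> b = c \<odot> x" by (simp add: smult_mult_l m_assoc)
qed

lemma torus_gens_simps [simp]: "GK i \<in> torus_gens" "GKi i \<in> torus_gens" "GL i \<in> torus_gens" "GLi i \<in> torus_gens"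
  "GE i \<notin> torus_gens" "GF i \<notin> torus_gens"
  by (auto simp: torus_gens_def)

lemma torus_gens_cases [consumes 1, case_names K Ki L Li]:
  assumes "g \<in> torus_gens"
  obtains i where "g = GK i" | i where "g = GKi i" | i where "g = GL i" | i where "g = GLi i"
  using assms by (auto simp: torus_gens_def)

fun ginv :: "'i gen \<Rightarrow> 'i gen" where
  "ginv (GK i) = GKi i" | "ginv (GKi i) = GK i" | "ginv (GL i) = GLi i" | "ginv (GLi i) = GL i" | "ginv g = g"

lemma ginv_torus [simp]: "ginv g \<in> torus_gens \<longleftrightarrow> g \<in> torus_gens" "ginv (ginv g) = g"
  by (cases g; simp)+

text \<open>
  A torus monomial has a degree in \<open>\<int>\<^sup>I \<times> \<int>\<^sup>I\<close>, which records the exponents of the \<open>K\<^sub>i\<close> and of the \<open>L\<^sub>i\<close>;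
  \<open>kdeg\<close> and \<open>ldeg\<close> are its two components for single letters.
\<close>

fun kdeg :: "'i gen \<Rightarrow> int ^ 'i" where
  "kdeg (GK i) = axis i 1" | "kdeg (GKi i) = - axis i 1" | "kdeg g = 0"

fun ldeg :: "'i gen \<Rightarrow> int ^ 'i" where
  "ldeg (GL i) = axis i 1" | "ldeg (GLi i) = - axis i 1" | "ldeg g = 0"

lemma deg_ginv: "g \<in> torus_gens \<Longrightarrow> kdeg (ginv g) = - kdeg g" "g \<in> torus_gens \<Longrightarrow> ldeg (ginv g) = - ldeg g"
  by (auto elim: torus_gens_cases)

locale bichar =
  fixes chi :: "int ^ 'i \<Rightarrow> int ^ 'i \<Rightarrow> 'k::field"
  assumes bichar: "bicharacter chi"
begin

lemma chi_nz [simp]: "chi a b \<noteq> 0"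
  and chi_add_l: "chi (a + b) c = chi a c * chi b c"
  and chi_add_r: "chi c (a + b) = chi c a * chi c b"
  using bichar by (auto simp: bicharacter_def)

lemma chi_zero [simp]: "chi 0 a = 1" "chi a 0 = 1"
  using chi_add_l[of 0 0 a] chi_add_r[of a 0 0] by simp_all

lemma chi_minus: "chi (- a) b = inverse (chi a b)" "chi b (- a) = inverse (chi b a)"
  using chi_add_l[of a "- a" b] chi_add_r[of b a "- a"] by (simp_all add: inverse_unique)

text \<open>
  The scalar by which a torus monomial of degree \<open>(a, b)\<close> is commuted past a product of letters \<open>E\<^sub>j\<close> of total
  degree \<open>c\<close>; past letters \<open>F\<^sub>j\<close> it is the inverse.
\<close>

definition weight :: "int ^ 'i \<Rightarrow> int ^ 'i \<Rightarrow> int ^ 'i \<Rightarrow> 'k" where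
  "weight a b c = chi a c * inverse (chi c b)"

lemma weight_nz [simp]: "weight a b c \<noteq> 0"
  by (simp add: weight_def)

lemma weight_add: "weight (a + a') (b + b') c = weight a b c * weight a' b' c"
  "weight a b (c + c') = weight a b c * weight a b c'"
  by (simp_all add: weight_def chi_add_l chi_add_r)

lemma weight_minus: "weight (- a) (- b) c = inverse (weight a b c)"
  by (simp add: weight_def chi_minus)

lemma weight_zero [simp]: "weight 0 0 c = 1" "weight a b 0 = 1"
  by (simp_all add: weight_def)

abbreviation gweight :: "'i gen \<Rightarrow> 'i \<Rightarrow> 'k" where
  "gweight g j \<equiv> weight (kdeg g) (ldeg g) (axis j 1)"

lemma gweight_simps:
  "weight (axis i 1) 0 (axis j 1) = qcoef chi i j" "weight 0 (axis i 1) (axis j 1) = inverse (qcoef chi j i)"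
  by (simp_all add: weight_def qcoef_def)

lemma gweight_ginv: "g \<in> torus_gens \<Longrightarrow> gweight (ginv g) j = inverse (gweight g j)"
  by (simp add: deg_ginv weight_minus)

text \<open>
  The defining relations for a choice of images of the generators, with all torus letters treated
  alike.
\<close>

definition family :: "('k, 'c) module \<Rightarrow> ('i gen \<Rightarrow> 'c) \<Rightarrow> bool" where
  "family C G \<longleftrightarrow> (\<forall>g. G g \<in> carrier C) \<and>
     (\<forall>g\<in>torus_gens. \<forall>h\<in>torus_gens. G g \<otimes>\<^bsub>C\<^esub> G h = G h \<otimes>\<^bsub>C\<^esub> G g) \<and>
     (\<forall>g\<in>torus_gens. G g \<otimes>\<^bsub>C\<^esub> G (ginv g) = \<one>\<^bsub>C\<^esub>) \<and>
     (\<forall>g\<in>torus_gens. \<forall>j. G g \<otimes>\<^bsub>C\<^esub> G (GE j) = gweight g j \<odot>\<^bsub>C\<^esub> (G (GE j) \<otimes>\<^bsub>C\<^esub> G g)) \<and>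
     (\<forall>g\<in>torus_gens. \<forall>j. G g \<otimes>\<^bsub>C\<^esub> G (GF j) = inverse (gweight g j) \<odot>\<^bsub>C\<^esub> (G (GF j) \<otimes>\<^bsub>C\<^esub> G g)) \<and>
     (\<forall>i j. G (GE i) \<otimes>\<^bsub>C\<^esub> G (GF j) \<ominus>\<^bsub>C\<^esub> G (GF j) \<otimes>\<^bsub>C\<^esub> G (GE i) =
        (if i = j then G (GK i) \<ominus>\<^bsub>C\<^esub> G (GL i) else \<zero>\<^bsub>C\<^esub>))"

lemma familyD:
  assumes "family C G"
  shows "G g \<in> carrier C"
    "g \<in> torus_gens \<Longrightarrow> h \<in> torus_gens \<Longrightarrow> G g \<otimes>\<^bsub>C\<^esub> G h = G h \<otimes>\<^bsub>C\<^esub> G g"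
    "g \<in> torus_gens \<Longrightarrow> G g \<otimes>\<^bsub>C\<^esub> G (ginv g) = \<one>\<^bsub>C\<^esub>"
    "g \<in> torus_gens \<Longrightarrow> G (ginv g) \<otimes>\<^bsub>C\<^esub> G g = \<one>\<^bsub>C\<^esub>"
    "g \<in> torus_gens \<Longrightarrow> G g \<otimes>\<^bsub>C\<^esub> G (GE j) = gweight g j \<odot>\<^bsub>C\<^esub> (G (GE j) \<otimes>\<^bsub>C\<^esub> G g)"
    "g \<in> torus_gens \<Longrightarrow> G g \<otimes>\<^bsub>C\<^esub> G (GF j) = inverse (gweight g j) \<odot>\<^bsub>C\<^esub> (G (GF j) \<otimes>\<^bsub>C\<^esub> G g)"
    "G (GE i) \<otimes>\<^bsub>C\<^esub> G (GF j) \<ominus>\<^bsub>C\<^esub> G (GF j) \<otimes>\<^bsub>C\<^esub> G (GE i) =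
        (if i = j then G (GK i) \<ominus>\<^bsub>C\<^esub> G (GL i) else \<zero>\<^bsub>C\<^esub>)"
  using assms unfolding family_def by (auto dest: bspec[of _ _ "ginv g"])

text \<open>
  It suffices to check the relations of the presentation; those for \<open>K\<^sub>i\<^sup>-\<^sup>1\<close> and \<open>L\<^sub>i\<^sup>-\<^sup>1\<close> follow.
\<close>

lemma familyI:
  assumes "kalgebra C" and G: "\<And>g. G g \<in> carrier C"
    and tt: "\<And>g h. g \<in> torus_gens \<Longrightarrow> h \<in> torus_gens \<Longrightarrow> G g \<otimes>\<^bsub>C\<^esub> G h = G h \<otimes>\<^bsub>C\<^esub> G g"
    and inv: "\<And>i. G (GK i) \<otimes>\<^bsub>C\<^esub> G (GKi i) = \<one>\<^bsub>C\<^esub>" "\<And>i. G (GL i) \<otimes>\<^bsub>C\<^esub> G (GLi i) = \<one>\<^bsub>C\<^esub>"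
    and E: "\<And>i j. G (GK i) \<otimes>\<^bsub>C\<^esub> G (GE j) = qcoef chi i j \<odot>\<^bsub>C\<^esub> (G (GE j) \<otimes>\<^bsub>C\<^esub> G (GK i))"
      "\<And>i j. G (GL i) \<otimes>\<^bsub>C\<^esub> G (GE j) = inverse (qcoef chi j i) \<odot>\<^bsub>C\<^esub> (G (GE j) \<otimes>\<^bsub>C\<^esub> G (GL i))"
    and F: "\<And>i j. G (GK i) \<otimes>\<^bsub>C\<^esub> G (GF j) = inverse (qcoef chi i j) \<odot>\<^bsub>C\<^esub> (G (GF j) \<otimes>\<^bsub>C\<^esub> G (GK i))"
      "\<And>i j. G (GL i) \<otimes>\<^bsub>C\<^esub> G (GF j) = qcoef chi j i \<odot>\<^bsub>C\<^esub> (G (GF j) \<otimes>\<^bsub>C\<^esub> G (GL i))"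
    and EF: "\<And>i j. G (GE i) \<otimes>\<^bsub>C\<^esub> G (GF j) \<ominus>\<^bsub>C\<^esub> G (GF j) \<otimes>\<^bsub>C\<^esub> G (GE i) =
        (if i = j then G (GK i) \<ominus>\<^bsub>C\<^esub> G (GL i) else \<zero>\<^bsub>C\<^esub>)"
  shows "family C G"
proof -
  interpret C: kalgebra C by fact
  note [simp] = G
  have inv': "G g \<otimes>\<^bsub>C\<^esub> G (ginv g) = \<one>\<^bsub>C\<^esub>" if "g \<in> torus_gens" for g
    using that by (cases rule: torus_gens_cases) (simp_all add: inv tt[of "GKi _" "GK _"] tt[of "GLi _" "GL _"])
  have E0: "G g \<otimes>\<^bsub>C\<^esub> G (GE j) = gweight g j \<odot>\<^bsub>C\<^esub> (G (GE j) \<otimes>\<^bsub>C\<^esub> G g)" if "g \<in> range GK \<union> range GL" for g j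
    using that E by (auto simp: gweight_simps)
  have F0: "G g \<otimes>\<^bsub>C\<^esub> G (GF j) = inverse (gweight g j) \<odot>\<^bsub>C\<^esub> (G (GF j) \<otimes>\<^bsub>C\<^esub> G g)" if "g \<in> range GK \<union> range GL" for g j
    using that F by (auto simp: gweight_simps)
  have E': "G g \<otimes>\<^bsub>C\<^esub> G (GE j) = gweight g j \<odot>\<^bsub>C\<^esub> (G (GE j) \<otimes>\<^bsub>C\<^esub> G g)" if "g \<in> torus_gens" for g j
  proof (cases "g \<in> range GK \<union> range GL")
    case False
    then have "ginv g \<in> range GK \<union> range GL" using that by (cases g) (auto simp: torus_gens_def)
    from C.skew_commute_inverse[OF _ _ _ _ _ _ E0[OF this]] show ?thesis
      using inv'[of g] inv'[of "ginv g"] that by (simp add: gweight_ginv)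
  qed (rule E0)
  have F': "G g \<otimes>\<^bsub>C\<^esub> G (GF j) = inverse (gweight g j) \<odot>\<^bsub>C\<^esub> (G (GF j) \<otimes>\<^bsub>C\<^esub> G g)" if "g \<in> torus_gens" for g j
  proof (cases "g \<in> range GK \<union> range GL")
    case False
    then have "ginv g \<in> range GK \<union> range GL" using that by (cases g) (auto simp: torus_gens_def)
    from C.skew_commute_inverse[OF _ _ _ _ _ _ F0[OF this]] show ?thesis
      using inv'[of g] inv'[of "ginv g"] that by (simp add: gweight_ginv)
  qed (rule F0)
  show ?thesis unfolding family_def using G tt inv' E' F' EF by blast
qed

subsection \<open>The algebra U\<close>

abbreviation FA :: "('k, 'i gen list \<Rightarrow>\<^sub>0 'k) module" where "FA \<equiv> free_alg"

sublocale FA: kalgebra FA by (rule free_kalgebra)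

lemma U_ideal: "ideal (U_ideal chi) FA" "U_rels chi \<subseteq> U_ideal chi"
  unfolding U_ideal_def by (rule FA.genideal_ideal, simp) (rule FA.genideal_self, simp)

abbreviation gen :: "'i gen \<Rightarrow> ('i gen list \<Rightarrow>\<^sub>0 'k) set" where "gen \<equiv> ugen chi"

lemma U_kalgebra: "kalgebra (U chi)"
  unfolding U_def by (rule FA.quot_kalgebra[OF U_ideal(1)])

sublocale U: kalgebra "U chi" by (rule U_kalgebra)

abbreviation U_mult (infixl "\<cdot>" 70) where "x \<cdot> y \<equiv> x \<otimes>\<^bsub>U chi\<^esub> y"
abbreviation U_add (infixl "\<oplus>\<^sub>U" 65) where "x \<oplus>\<^sub>U y \<equiv> x \<oplus>\<^bsub>U chi\<^esub> y"
abbreviation U_minus (infixl "\<ominus>\<^sub>U" 65) where "x \<ominus>\<^sub>U y \<equiv> x \<ominus>\<^bsub>U chi\<^esub> y"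
abbreviation U_smult (infixl "\<odot>\<^sub>U" 70) where "c \<odot>\<^sub>U x \<equiv> c \<odot>\<^bsub>U chi\<^esub> x"
abbreviation U_zero ("\<zero>\<^sub>U") where "\<zero>\<^sub>U \<equiv> \<zero>\<^bsub>U chi\<^esub>"
abbreviation U_one ("\<one>\<^sub>U") where "\<one>\<^sub>U \<equiv> \<one>\<^bsub>U chi\<^esub>"

abbreviation proj :: "('i gen list \<Rightarrow>\<^sub>0 'k) \<Rightarrow> ('i gen list \<Rightarrow>\<^sub>0 'k) set" where
  "proj p \<equiv> U_ideal chi +>\<^bsub>FA\<^esub> p"

lemma proj_hom: "proj \<in> alg_hom FA (U chi)"
  unfolding U_def by (rule FA.quot_alg_hom[OF U_ideal(1)])

lemmas proj_lin = alg_homD(1)[OF proj_hom]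

lemma gen_closed [simp, intro]: "gen g \<in> carrier (U chi)"
  unfolding ugen_def by (rule lin_homD(1)[OF proj_lin]) simp

abbreviation word :: "'i gen list \<Rightarrow> ('i gen list \<Rightarrow>\<^sub>0 'k) set" where "word \<equiv> wprod (U chi) gen"

lemma word_closed [simp, intro]: "word w \<in> carrier (U chi)"
  by (rule U.wprod_closed) simp

lemma word_append: "word (u @ v) = word u \<cdot> word v"
  by (rule U.wprod_append) simp

lemma proj_mon: "proj (mon w) = word w"
proof (induction w)
  case Nil then show ?case using alg_homD(2)[OF proj_hom] by simp
next
  case (Cons g w)
  have "proj (mon (g # w)) = proj (mon [g] \<otimes>\<^bsub>FA\<^esub> mon w)" by simp
  also have "\<dots> = gen g \<cdot> word w"
    by (subst alg_homD(3)[OF proj_hom]) (simp_all add: Cons flip: ugen_def)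
  finally show ?case by simp
qed

lemma proj_single: "proj (Poly_Mapping.single w c) = c \<odot>\<^sub>U word w"
  using lin_homD(3)[OF proj_lin, of "mon w" c] by (simp add: proj_mon)

lemma proj_minus: "proj (p - q) = proj p \<ominus>\<^sub>U proj q"
  using lin_hom_minus[OF proj_lin FA.kspace_axioms U.kspace_axioms, of p q] by simp

lemma proj_closed [simp]: "proj p \<in> carrier (U chi)"
  by (rule lin_homD(1)[OF proj_lin]) simp

lemma proj_zero: "proj 0 = \<zero>\<^sub>U"
  using lin_hom_zero[OF proj_lin FA.kspace_axioms U.kspace_axioms] by simp

lemma proj_rel: "r \<in> U_rels chi \<Longrightarrow> proj r = \<zero>\<^sub>U"
  unfolding U_def using FA.quot_zero_iff[OF FA.ideal_lin_subspace[OF U_ideal(1)], of r] U_ideal(2) by auto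

lemma U_span: "carrier (U chi) = lin_span (U chi) (range word)"
proof -
  have "carrier (U chi) = proj ` lin_span FA (range (\<lambda>w. mon w))"
    unfolding free_alg_span[symmetric] unfolding U_def by (subst FA.quot_carrier) simp
  also have "\<dots> = lin_span (U chi) (proj ` range (\<lambda>w. mon w))"
    by (rule lin_hom_image_span[OF proj_lin FA.kspace_axioms U.kspace_axioms]) simp
  finally show ?thesis by (simp add: image_image proj_mon)
qed

lemma U_rels_proj:
  "a \<in> torus_gens \<Longrightarrow> b \<in> torus_gens \<Longrightarrow> proj (mon [a, b] - mon [b, a]) = \<zero>\<^sub>U"
  "proj (mon [GK i, GKi i] - mon []) = \<zero>\<^sub>U"
  "proj (mon [GL i, GLi i] - mon []) = \<zero>\<^sub>U"
  "proj (mon [GK i, GE j, GKi i] - Poly_Mapping.single [GE j] (qcoef chi i j)) = \<zero>\<^sub>U"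
  "proj (mon [GL i, GE j, GLi i] - Poly_Mapping.single [GE j] (inverse (qcoef chi j i))) = \<zero>\<^sub>U"
  "proj (mon [GK i, GF j, GKi i] - Poly_Mapping.single [GF j] (inverse (qcoef chi i j))) = \<zero>\<^sub>U"
  "proj (mon [GL i, GF j, GLi i] - Poly_Mapping.single [GF j] (qcoef chi j i)) = \<zero>\<^sub>U"
  "proj (mon [GE i, GF j] - mon [GF j, GE i] - (if i = j then mon [GK i] - mon [GL i] else 0)) = \<zero>\<^sub>U"
  by (rule proj_rel; unfold U_rels_def; blast)+

lemma gen_family: "family (U chi) gen"
proof -
  note [simp] = proj_minus proj_mon proj_single proj_zero U.minus_eq_zero_iff
  have tt: "gen g \<cdot> gen h = gen h \<cdot> gen g" if "g \<in> torus_gens" "h \<in> torus_gens" for g h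
    using U_rels_proj(1)[OF that] by simp
  have inv: "gen (GK i) \<cdot> gen (GKi i) = \<one>\<^sub>U" "gen (GL i) \<cdot> gen (GLi i) = \<one>\<^sub>U" for i
    using U_rels_proj(2,3)[of i] by simp_all
  have inv': "gen (GKi i) \<cdot> gen (GK i) = \<one>\<^sub>U" "gen (GLi i) \<cdot> gen (GL i) = \<one>\<^sub>U" for i
    using inv tt[of "GK i" "GKi i"] tt[of "GL i" "GLi i"] by simp_all
  note K = U.conj_iff_skew_commute[OF gen_closed gen_closed gen_closed inv(1) inv'(1)]
  note L = U.conj_iff_skew_commute[OF gen_closed gen_closed gen_closed inv(2) inv'(2)]
  show ?thesis
  proof (rule familyI[OF U_kalgebra gen_closed tt inv])
    fix i j
    show "gen (GK i) \<cdot> gen (GE j) = qcoef chi i j \<odot>\<^sub>U (gen (GE j) \<cdot> gen (GK i))"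
      using U_rels_proj(4)[of i j] by (simp add: U.m_assoc flip: K)
    show "gen (GL i) \<cdot> gen (GE j) = inverse (qcoef chi j i) \<odot>\<^sub>U (gen (GE j) \<cdot> gen (GL i))"
      using U_rels_proj(5)[of i j] by (simp add: U.m_assoc flip: L)
    show "gen (GK i) \<cdot> gen (GF j) = inverse (qcoef chi i j) \<odot>\<^sub>U (gen (GF j) \<cdot> gen (GK i))"
      using U_rels_proj(6)[of i j] by (simp add: U.m_assoc flip: K)
    show "gen (GL i) \<cdot> gen (GF j) = qcoef chi j i \<odot>\<^sub>U (gen (GF j) \<cdot> gen (GL i))"
      using U_rels_proj(7)[of i j] by (simp add: U.m_assoc flip: L)
    show "gen (GE i) \<cdot> gen (GF j) \<ominus>\<^sub>U gen (GF j) \<cdot> gen (GE i) =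
        (if i = j then gen (GK i) \<ominus>\<^sub>U gen (GL i) else \<zero>\<^sub>U)"
      using U_rels_proj(8)[of i j] by (auto split: if_splits)
  qed
qed

lemmas gen_rels = familyD(2-)[OF gen_family]

text \<open>
  U is spanned by words, and words are built by multiplication with letters from the left.
\<close>

lemma U_induct [consumes 1, case_names zero one gen add smult]:
  assumes "x \<in> carrier (U chi)" "P \<zero>\<^sub>U" "P \<one>\<^sub>U"
    "\<And>g x. x \<in> carrier (U chi) \<Longrightarrow> P x \<Longrightarrow> P (gen g \<cdot> x)"
    "\<And>x y. x \<in> carrier (U chi) \<Longrightarrow> y \<in> carrier (U chi) \<Longrightarrow> P x \<Longrightarrow> P y \<Longrightarrow> P (x \<oplus>\<^sub>U y)"
    "\<And>c x. x \<in> carrier (U chi) \<Longrightarrow> P x \<Longrightarrow> P (c \<odot>\<^sub>U x)"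
  shows "P x"
proof -
  have w: "P (word w)" for w by (induction w) (use assms in auto)
  have "lin_subspace (U chi) {x \<in> carrier (U chi). P x}"
    by (rule lin_subspaceI) (use assms in auto)
  from lin_span_least[OF this, of "range word"] show ?thesis
    using assms(1) w unfolding U_span[symmetric] by auto
qed

text \<open>
  Evaluation of words at \<open>G\<close> kills the relations, so its kernel contains the ideal that they generate.
\<close>

lemma U_lift:
  assumes C: "kalgebra C" and fam: "family C G"
  obtains h where "h \<in> alg_hom (U chi) C" "\<And>g. h (gen g) = G g"
proof -
  interpret C: kalgebra C by fact
  note G [simp] = familyD(1)[OF fam]
  note rel = familyD(2-)[OF fam]
  let ?e = "lin_ext C (wprod C G)"
  have e: "?e \<in> alg_hom FA C" and es [simp]: "?e (Poly_Mapping.single w c) = c \<odot>\<^bsub>C\<^esub> wprod C G w" for w c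
    by (rule C.free_lift, simp)+
  note el = alg_homD(1)[OF e]
  have em [simp]: "?e (p - q) = ?e p \<ominus>\<^bsub>C\<^esub> ?e q" for p q
    using lin_hom_minus[OF el FA.kspace_axioms C.kspace_axioms, of p q] by simp
  have e0 [simp]: "?e 0 = \<zero>\<^bsub>C\<^esub>"
    using lin_hom_zero[OF el FA.kspace_axioms C.kspace_axioms] by simp
  have ec [simp]: "?e p \<in> carrier C" for p by (rule lin_homD(1)[OF el]) simp
  have wc [simp]: "wprod C G w \<in> carrier C" for w by (rule C.wprod_closed) simp
  note conj = C.conj_iff_skew_commute[OF G G G rel(2) rel(3)]
  have cj: "G g \<otimes>\<^bsub>C\<^esub> (G x \<otimes>\<^bsub>C\<^esub> G h) = c \<odot>\<^bsub>C\<^esub> G x"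
    if "G g \<otimes>\<^bsub>C\<^esub> G x = c \<odot>\<^bsub>C\<^esub> (G x \<otimes>\<^bsub>C\<^esub> G g)" "g \<in> torus_gens" "h = ginv g" for g h x c
    using iffD2[OF conj[OF that(2,2)] that(1)] that(3) by (simp only: C.m_assoc G C.m_closed)
  have cjs: "G (GK i) \<otimes>\<^bsub>C\<^esub> (G (GE j) \<otimes>\<^bsub>C\<^esub> G (GKi i)) = qcoef chi i j \<odot>\<^bsub>C\<^esub> G (GE j)"
    "G (GL i) \<otimes>\<^bsub>C\<^esub> (G (GE j) \<otimes>\<^bsub>C\<^esub> G (GLi i)) = inverse (qcoef chi j i) \<odot>\<^bsub>C\<^esub> G (GE j)"
    "G (GK i) \<otimes>\<^bsub>C\<^esub> (G (GF j) \<otimes>\<^bsub>C\<^esub> G (GKi i)) = inverse (qcoef chi i j) \<odot>\<^bsub>C\<^esub> G (GF j)"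
    "G (GL i) \<otimes>\<^bsub>C\<^esub> (G (GF j) \<otimes>\<^bsub>C\<^esub> G (GLi i)) = qcoef chi j i \<odot>\<^bsub>C\<^esub> G (GF j)" for i j
    by (rule cj; simp add: rel gweight_simps)+
  have "?e r = \<zero>\<^bsub>C\<^esub>" if "r \<in> U_rels chi" for r
    using that unfolding U_rels_def[THEN eqset_imp_iff, of r]
    by (elim UnE CollectE exE conjE)
      (use rel(1) rel(2)[of "GK _"] rel(2)[of "GL _"] rel(6) in
        \<open>auto simp: C.minus_eq_zero_iff cjs split: if_splits\<close>)
  then have rz: "U_rels chi \<subseteq> {x. ?e x = \<zero>\<^bsub>C\<^esub>}" by auto
  have sub: "lin_subspace FA {x \<in> carrier FA. ?e x \<in> {\<zero>\<^bsub>C\<^esub>}}"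
    by (rule lin_hom_preimage[OF el FA.kspace_axioms C.kspace_axioms]) (auto intro!: lin_subspaceI)
  have "ideal {x. ?e x = \<zero>\<^bsub>C\<^esub>} FA"
    by (rule FA.idealI_subspace) (use sub in \<open>auto simp: alg_homD(3)[OF e]\<close>)
  from FA.genideal_minimal[OF this rz] have z: "?e x = \<zero>\<^bsub>C\<^esub>" if "x \<in> U_ideal chi" for x
    using that by (auto simp: U_ideal_def)
  obtain h where h: "h \<in> alg_hom (U chi) C" "\<And>x. x \<in> carrier FA \<Longrightarrow> h (proj x) = ?e x"
    unfolding U_def using FA.quot_factor_alg[OF U_ideal(1) e C.kspace_axioms z] by blast
  have "h (gen g) = G g" for g unfolding ugen_def by (subst h(2)) simp_all
  with h(1) show ?thesis using that by blast
qed

text \<open>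
  Inverses are preserved automatically, so the letters \<open>K\<^sub>i\<close>, \<open>L\<^sub>i\<close>, \<open>E\<^sub>i\<close>, \<open>F\<^sub>i\<close> suffice.
\<close>

lemma U_hom_eqI:
  assumes C: "kalgebra C" and f: "f \<in> alg_hom (U chi) C" and g: "g \<in> alg_hom (U chi) C"
    and eq: "\<And>i. f (gen (GK i)) = g (gen (GK i))" "\<And>i. f (gen (GL i)) = g (gen (GL i))"
      "\<And>i. f (gen (GE i)) = g (gen (GE i))" "\<And>i. f (gen (GF i)) = g (gen (GF i))"
    and x: "x \<in> carrier (U chi)"
  shows "f x = g x"
proof -
  interpret C: kalgebra C by fact
  note fh = alg_homD[OF f] lin_homD[OF alg_homD(1)[OF f]] and gh = alg_homD[OF g] lin_homD[OF alg_homD(1)[OF g]]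
  have inv: "f (gen h) = g (gen h)" if "h \<in> torus_gens" "f (gen (ginv h)) = g (gen (ginv h))" for h
  proof -
    have "f (gen h) \<otimes>\<^bsub>C\<^esub> f (gen (ginv h)) = \<one>\<^bsub>C\<^esub>" "f (gen (ginv h)) \<otimes>\<^bsub>C\<^esub> f (gen h) = \<one>\<^bsub>C\<^esub>"
      "g (gen h) \<otimes>\<^bsub>C\<^esub> g (gen (ginv h)) = \<one>\<^bsub>C\<^esub>" "g (gen (ginv h)) \<otimes>\<^bsub>C\<^esub> g (gen h) = \<one>\<^bsub>C\<^esub>"
      using that(1) by (simp_all flip: fh(3) gh(3) add: gen_rels fh(2) gh(2))
    then show ?thesis using that(2) fh(4) gh(4) gen_closed C.inv_unique[of "g (gen h)" "f (gen (ginv h))" "f (gen h)"] by metis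
  qed
  have gens: "f (gen h) = g (gen h)" for h
    by (cases h) (use eq inv in auto)
  show ?thesis using x
    by (induction rule: U_induct)
      (use gens in \<open>simp_all add: fh gh lin_hom_zero[OF alg_homD(1)[OF f] U.kspace_axioms C.kspace_axioms]
        lin_hom_zero[OF alg_homD(1)[OF g] U.kspace_axioms C.kspace_axioms]\<close>)
qed

end

section \<open>The Hopf algebra structure and the antiautomorphism\<close>

lemma alg_hom_restrict: "h \<in> alg_hom A B \<Longrightarrow> kalgebra A \<Longrightarrow> restrict h (carrier A) \<in> alg_hom A B"
proof -
  assume h: "h \<in> alg_hom A B" and "kalgebra A"
  then interpret kalgebra A by simp
  note [simp] = alg_homD[OF h] lin_homD[OF alg_homD(1)[OF h]]
  show ?thesis by (intro alg_homI lin_homI) auto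
qed

lemma ground_kalgebra: "kalgebra (ground_alg :: ('k::field, 'k) module)"
proof -
  have "abelian_group (ground_alg :: ('k, 'k) module)"
    by (rule abelian_groupI) (auto simp: ground_alg_def intro: exI[of _ "- _"])
  then have "ring (ground_alg :: ('k, 'k) module)"
    by (rule ringI[OF _ monoidI]) (auto simp: ground_alg_def algebra_simps)
  then interpret ring "ground_alg :: ('k, 'k) module" .
  show ?thesis by unfold_locales (auto simp: ground_alg_def algebra_simps)
qed

lemma ground_alg_simps [simp]: "carrier ground_alg = UNIV" "mult ground_alg = (*)" "one ground_alg = 1"
  "zero ground_alg = 0" "add ground_alg = (+)" "smult ground_alg = (*)"
  by (simp_all add: ground_alg_def)

lemma ground_alg_minus [simp]: "a \<ominus>\<^bsub>ground_alg\<^esub> b = a - (b::'k::field)"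
proof -
  interpret kalgebra "ground_alg :: ('k, 'k) module" by (rule ground_kalgebra)
  have "\<ominus>\<^bsub>ground_alg\<^esub> b = - b" by (rule minus_equality) auto
  then show ?thesis by (simp add: a_minus_def)
qed

context bichar begin

text \<open>
  The counit, the comultiplication and the antiautomorphism are descriptions of a homomorphism by its
  values on \<open>K\<^sub>i\<close>, \<open>L\<^sub>i\<close>, \<open>E\<^sub>i\<close>, \<open>F\<^sub>i\<close>. Existence comes from the universal property, and the same lemma
  yields the values on the inverse letters.
\<close>

lemma U_hom_the:
  assumes C: "kalgebra C" and fam: "family C G"
    and P: "\<And>D. P D \<longleftrightarrow> D \<in> alg_hom (U chi) C \<and> D \<in> extensional (carrier (U chi)) \<and>
      (\<forall>i. D (gen (GK i)) = G (GK i) \<and> D (gen (GL i)) = G (GL i) \<and>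
         D (gen (GE i)) = G (GE i) \<and> D (gen (GF i)) = G (GF i))"
  shows "P (THE D. P D)" "(THE D. P D) \<in> alg_hom (U chi) C" "(THE D. P D) (gen g) = G g"
proof -
  obtain h where h: "h \<in> alg_hom (U chi) C" "\<And>g. h (gen g) = G g"
    using U_lift[OF C fam] by blast
  let ?h = "restrict h (carrier (U chi))"
  have Ph: "P ?h" unfolding P using alg_hom_restrict[OF h(1) U_kalgebra] h(2) by simp
  have eq: "D x = h x" if "P D" "x \<in> carrier (U chi)" for D x
    by (rule U_hom_eqI[OF C _ h(1) _ _ _ _ that(2)]) (use that(1) h(2) in \<open>simp_all add: P\<close>)
  have uniq: "D = ?h" if "P D" for D
  proof (rule extensionalityI)
    show "D \<in> extensional (carrier (U chi))" using iffD1[OF P that] by blast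
    show "D x = ?h x" if "x \<in> carrier (U chi)" for x using eq[OF \<open>P D\<close> that] that by simp
  qed simp
  have "(THE D. P D) = ?h" by (rule the_equality[of P, OF Ph uniq])
  then show "P (THE D. P D)" "(THE D. P D) \<in> alg_hom (U chi) C" "(THE D. P D) (gen g) = G g"
    using Ph h(2) by (simp_all add: P)
qed

lemma gen_gen_lcomm:
  "g \<in> torus_gens \<Longrightarrow> h \<in> torus_gens \<Longrightarrow> x \<in> carrier (U chi) \<Longrightarrow>
     gen g \<cdot> (gen h \<cdot> x) = gen h \<cdot> (gen g \<cdot> x)"
  by (simp add: gen_rels(1) flip: U.m_assoc)

lemma gen_cancel:
  "g \<in> torus_gens \<Longrightarrow> x \<in> carrier (U chi) \<Longrightarrow> gen g \<cdot> (gen (ginv g) \<cdot> x) = x"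
  "g \<in> torus_gens \<Longrightarrow> x \<in> carrier (U chi) \<Longrightarrow> gen (ginv g) \<cdot> (gen g \<cdot> x) = x"
  by (simp_all add: gen_rels flip: U.m_assoc)

lemma EF_rel:
  "gen (GE i) \<cdot> gen (GF j) = gen (GF j) \<cdot> gen (GE i) \<oplus>\<^sub>U
     (if i = j then gen (GK i) \<ominus>\<^sub>U gen (GL i) else \<zero>\<^sub>U)"
proof -
  have "x = y \<oplus>\<^sub>U (x \<ominus>\<^sub>U y)" if "x \<in> carrier (U chi)" "y \<in> carrier (U chi)" for x y
    using that by (simp add: a_minus_def U.a_lcomm U.r_neg)
  from this[of "gen (GE i) \<cdot> gen (GF j)" "gen (GF j) \<cdot> gen (GE i)"] show ?thesis
    by (simp only: gen_rels(6) U.m_closed gen_closed simp_thms)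
qed

subsection \<open>Counit\<close>

lemma counit_family: "family ground_alg (\<lambda>g. if g \<in> torus_gens then 1 else (0::'k))"
  by (rule familyI[OF ground_kalgebra]) auto

lemma counit: "counit chi \<in> alg_hom (U chi) ground_alg"
  "counit chi (gen g) = (if g \<in> torus_gens then 1 else 0)"
proof -
  let ?G = "\<lambda>g. if g \<in> torus_gens then 1 else (0::'k)"
  let ?P = "\<lambda>e. e \<in> alg_hom (U chi) ground_alg \<and> e \<in> extensional (carrier (U chi)) \<and>
     (\<forall>i. e (gen (GE i)) = 0 \<and> e (gen (GF i)) = 0 \<and> e (gen (GK i)) = 1 \<and> e (gen (GL i)) = 1)"
  have P: "?P D \<longleftrightarrow> D \<in> alg_hom (U chi) ground_alg \<and> D \<in> extensional (carrier (U chi)) \<and>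
      (\<forall>i. D (gen (GK i)) = ?G (GK i) \<and> D (gen (GL i)) = ?G (GL i) \<and>
         D (gen (GE i)) = ?G (GE i) \<and> D (gen (GF i)) = ?G (GF i))" for D
    by (simp only: torus_gens_simps if_True if_False) blast
  show "counit chi \<in> alg_hom (U chi) ground_alg" "counit chi (gen g) = (if g \<in> torus_gens then 1 else 0)"
    unfolding counit_def by (fact U_hom_the(2,3)[where P = ?P and G = ?G, OF ground_kalgebra counit_family P])+
qed

subsection \<open>Comultiplication\<close>

sublocale UU: tensor_algebras "U chi" "U chi" ..

abbreviation U2 where "U2 \<equiv> tensor (U chi) (U chi)"

fun cogen :: "'i gen \<Rightarrow> (('i gen list \<Rightarrow>\<^sub>0 'k) set \<times> ('i gen list \<Rightarrow>\<^sub>0 'k) set \<Rightarrow>\<^sub>0 'k) set" where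
  "cogen (GE i) = UU.pt (gen (GE i)) \<one>\<^sub>U \<oplus>\<^bsub>U2\<^esub> UU.pt (gen (GK i)) (gen (GE i))"
| "cogen (GF i) = UU.pt \<one>\<^sub>U (gen (GF i)) \<oplus>\<^bsub>U2\<^esub> UU.pt (gen (GF i)) (gen (GL i))"
| "cogen g = UU.pt (gen g) (gen g)"

lemma cogen_torus: "g \<in> torus_gens \<Longrightarrow> cogen g = UU.pt (gen g) (gen g)"
  by (auto elim: torus_gens_cases)

lemma cogen_closed [simp]: "cogen g \<in> carrier U2"
  by (cases g) auto

text \<open>
  Only the relation between \<open>E\<^sub>i\<close> and \<open>F\<^sub>j\<close> needs an idea. The mixed terms \<open>K\<^sub>i F\<^sub>j \<otimes> E\<^sub>i L\<^sub>j\<close> and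
  \<open>F\<^sub>j K\<^sub>i \<otimes> L\<^sub>j E\<^sub>i\<close> agree, because moving \<open>K\<^sub>i\<close> past \<open>F\<^sub>j\<close> costs the same scalar as moving \<open>L\<^sub>j\<close> past \<open>E\<^sub>i\<close>.
  For \<open>i = j\<close> the remainder \<open>(K\<^sub>i - L\<^sub>i) \<otimes> L\<^sub>i + K\<^sub>i \<otimes> (K\<^sub>i - L\<^sub>i)\<close> telescopes to \<open>K\<^sub>i \<otimes> K\<^sub>i - L\<^sub>i \<otimes> L\<^sub>i\<close>.
\<close>

lemma cogen_family: "family U2 cogen"
proof -
  note [simp] = UU.T.l_distr UU.T.r_distr UU.pt_mult UU.pt_simps UU.T.smult_r_distr
  have E: "cogen g \<otimes>\<^bsub>U2\<^esub> cogen (GE j) = gweight g j \<odot>\<^bsub>U2\<^esub> (cogen (GE j) \<otimes>\<^bsub>U2\<^esub> cogen g)" if "g \<in> torus_gens" for g j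
    using that by (simp add: cogen_torus gen_rels(4) gen_rels(1)[of g "GK j"])
  have F: "cogen g \<otimes>\<^bsub>U2\<^esub> cogen (GF j) = inverse (gweight g j) \<odot>\<^bsub>U2\<^esub> (cogen (GF j) \<otimes>\<^bsub>U2\<^esub> cogen g)" if "g \<in> torus_gens" for g j
    using that by (simp add: cogen_torus gen_rels(5) gen_rels(1)[of g "GL j"])
  have TT: "cogen g \<otimes>\<^bsub>U2\<^esub> cogen h = cogen h \<otimes>\<^bsub>U2\<^esub> cogen g" if "g \<in> torus_gens" "h \<in> torus_gens" for g h
    using that by (simp add: cogen_torus gen_rels(1)[of g h])
  have inv: "cogen g \<otimes>\<^bsub>U2\<^esub> cogen (ginv g) = \<one>\<^bsub>U2\<^esub>" if "g \<in> torus_gens" for g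
    using that by (simp add: cogen_torus gen_rels(2) UU.pt_one)
  have EF: "cogen (GE i) \<otimes>\<^bsub>U2\<^esub> cogen (GF j) \<ominus>\<^bsub>U2\<^esub> cogen (GF j) \<otimes>\<^bsub>U2\<^esub> cogen (GE i) =
        (if i = j then cogen (GK i) \<ominus>\<^bsub>U2\<^esub> cogen (GL i) else \<zero>\<^bsub>U2\<^esub>)" for i j
  proof -
    let ?d = "if i = j then gen (GK i) \<ominus>\<^sub>U gen (GL i) else \<zero>\<^sub>U"
    have d: "?d \<in> carrier (U chi)" by simp
    let ?e = "gen (GE i)" and ?f = "gen (GF j)" and ?k = "gen (GK i)" and ?l = "gen (GL j)"
    have kf: "?k \<cdot> ?f = inverse (qcoef chi i j) \<odot>\<^sub>U (?f \<cdot> ?k)"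
      and le: "?l \<cdot> ?e = inverse (qcoef chi i j) \<odot>\<^sub>U (?e \<cdot> ?l)"
      using gen_rels(5)[of "GK i" j] gen_rels(4)[of "GL j" i]
      by (simp_all only: torus_gens_simps kdeg.simps ldeg.simps gweight_simps)
    have sum: "cogen (GE i) \<otimes>\<^bsub>U2\<^esub> cogen (GF j) =
       cogen (GF j) \<otimes>\<^bsub>U2\<^esub> cogen (GE i) \<oplus>\<^bsub>U2\<^esub> (UU.pt ?d ?l \<oplus>\<^bsub>U2\<^esub> UU.pt ?k ?d)"
      using d by (simp add: EF_rel[of i j] kf le UU.T.a_ac del: if_split)
    have dd: "UU.pt ?d ?l \<oplus>\<^bsub>U2\<^esub> UU.pt ?k ?d = (if i = j then cogen (GK i) \<ominus>\<^bsub>U2\<^esub> cogen (GL i) else \<zero>\<^bsub>U2\<^esub>)"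
    proof (cases "i = j")
      case True
      have m: "UU.pt (a \<ominus>\<^sub>U b) c = UU.pt a c \<ominus>\<^bsub>U2\<^esub> UU.pt b c" "UU.pt c (a \<ominus>\<^sub>U b) = UU.pt c a \<ominus>\<^bsub>U2\<^esub> UU.pt c b"
        if "a \<in> carrier (U chi)" "b \<in> carrier (U chi)" "c \<in> carrier (U chi)" for a b c
        using that lin_hom_minus[of "\<lambda>a. UU.pt a c" "U chi" U2 a b] lin_hom_minus[of "UU.pt c" "U chi" U2 a b] UU.pt_bilinear
          U.kspace_axioms UU.T.kspace_axioms
        by (simp_all add: bilinear_map_def)
      have "(x \<ominus>\<^bsub>U2\<^esub> y) \<oplus>\<^bsub>U2\<^esub> (z \<ominus>\<^bsub>U2\<^esub> x) = z \<ominus>\<^bsub>U2\<^esub> y"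
        if "x \<in> carrier U2" "y \<in> carrier U2" "z \<in> carrier U2" for x y z
      proof -
        have "(x \<ominus>\<^bsub>U2\<^esub> y) \<oplus>\<^bsub>U2\<^esub> (z \<ominus>\<^bsub>U2\<^esub> x) = (z \<ominus>\<^bsub>U2\<^esub> y) \<oplus>\<^bsub>U2\<^esub> (x \<oplus>\<^bsub>U2\<^esub> \<ominus>\<^bsub>U2\<^esub> x)"
          using that unfolding a_minus_def by (simp only: UU.T.a_ac UU.T.a_inv_closed UU.T.a_closed)
        then show ?thesis using that by (simp add: UU.T.r_neg)
      qed
      then show ?thesis using True by (simp add: m)
    next
      case False
      have pt_zero: "UU.pt \<zero>\<^sub>U c = \<zero>\<^bsub>U2\<^esub>" "UU.pt c \<zero>\<^sub>U = \<zero>\<^bsub>U2\<^esub>"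
        if "c \<in> carrier (U chi)" for c
        using that lin_hom_zero[of "\<lambda>a. UU.pt a c" "U chi" U2] lin_hom_zero[of "UU.pt c" "U chi" U2] UU.pt_bilinear
          U.kspace_axioms UU.T.kspace_axioms
        by (simp_all add: bilinear_map_def)
      then show ?thesis using False by (simp add: pt_zero)
    qed
    have cancel: "y \<oplus>\<^bsub>U2\<^esub> x \<ominus>\<^bsub>U2\<^esub> y = x" if "x \<in> carrier U2" "y \<in> carrier U2" for x y
      using that by (simp add: a_minus_def UU.T.a_comm[of y x] UU.T.a_assoc UU.T.r_neg)
    show "cogen (GE i) \<otimes>\<^bsub>U2\<^esub> cogen (GF j) \<ominus>\<^bsub>U2\<^esub> cogen (GF j) \<otimes>\<^bsub>U2\<^esub> cogen (GE i) =
        (if i = j then cogen (GK i) \<ominus>\<^bsub>U2\<^esub> cogen (GL i) else \<zero>\<^bsub>U2\<^esub>)"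
      unfolding sum dd
      by (rule cancel) (simp_all del: cogen.simps)
  qed
  show ?thesis unfolding family_def using TT inv E F EF by (intro conjI allI ballI cogen_closed)
qed

lemma comult: "comult chi \<in> alg_hom (U chi) U2" "comult chi (gen g) = cogen g"
proof -
  let ?P = "\<lambda>D. D \<in> alg_hom (U chi) U2 \<and> D \<in> extensional (carrier (U chi)) \<and>
     (\<forall>i. D (gen (GK i)) = UU.pt (gen (GK i)) (gen (GK i)) \<and> D (gen (GL i)) = UU.pt (gen (GL i)) (gen (GL i)) \<and>
        D (gen (GE i)) = UU.pt (gen (GE i)) \<one>\<^sub>U \<oplus>\<^bsub>U2\<^esub> UU.pt (gen (GK i)) (gen (GE i)) \<and>
        D (gen (GF i)) = UU.pt \<one>\<^sub>U (gen (GF i)) \<oplus>\<^bsub>U2\<^esub> UU.pt (gen (GF i)) (gen (GL i)))"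
  have P: "?P D \<longleftrightarrow> D \<in> alg_hom (U chi) U2 \<and> D \<in> extensional (carrier (U chi)) \<and>
      (\<forall>i. D (gen (GK i)) = cogen (GK i) \<and> D (gen (GL i)) = cogen (GL i) \<and>
         D (gen (GE i)) = cogen (GE i) \<and> D (gen (GF i)) = cogen (GF i))" for D
    by (simp only: cogen.simps)
  show "comult chi \<in> alg_hom (U chi) U2" "comult chi (gen g) = cogen g"
    unfolding comult_def by (fact U_hom_the(2,3)[where P = ?P and G = cogen, OF UU.tensor_kalgebra cogen_family P])+
qed

subsection \<open>Antipode\<close>

text \<open>
  On the generators these values are forced by the antipode axioms.
\<close>

fun antigen :: "'i gen \<Rightarrow> ('i gen list \<Rightarrow>\<^sub>0 'k) set" where
  "antigen (GE i) = (- 1) \<odot>\<^sub>U (gen (GKi i) \<cdot> gen (GE i))"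
| "antigen (GF i) = (- 1) \<odot>\<^sub>U (gen (GF i) \<cdot> gen (GLi i))"
| "antigen g = gen (ginv g)"

lemma antigen_torus: "g \<in> torus_gens \<Longrightarrow> antigen g = gen (ginv g)"
  by (auto elim: torus_gens_cases)

lemma antigen_closed [simp]: "antigen g \<in> carrier (U chi)"
  by (cases g) auto

lemma op_minus [simp]: "x \<ominus>\<^bsub>op_alg A\<^esub> y = x \<ominus>\<^bsub>A\<^esub> y"
  by (simp add: a_minus_def a_inv_def op_alg_def)

text \<open>
  For the relation between \<open>E\<^sub>i\<close> and \<open>F\<^sub>j\<close>, both products of the images can be brought to the form
  \<open>K\<^sub>i\<^sup>-\<^sup>1 \<dots> L\<^sub>j\<^sup>-\<^sup>1\<close>, with \<open>F\<^sub>j E\<^sub>i\<close> and \<open>E\<^sub>i F\<^sub>j\<close> in the middle; the scalars arising on the way cancel.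
\<close>

lemma antigen_family: "family (op_alg (U chi)) antigen"
proof -
  note [simp] = U.smult_mult_l U.smult_mult_r U.m_assoc
  note scal = U.smult_assoc[symmetric]
  have E: "antigen g \<otimes>\<^bsub>op_alg (U chi)\<^esub> antigen (GE j) = gweight g j \<odot>\<^bsub>op_alg (U chi)\<^esub> (antigen (GE j) \<otimes>\<^bsub>op_alg (U chi)\<^esub> antigen g)"
    if g: "g \<in> torus_gens" for g j
  proof -
    have "gen (ginv g) \<cdot> gen (GE j) = inverse (gweight g j) \<odot>\<^sub>U (gen (GE j) \<cdot> gen (ginv g))"
      using gen_rels(4)[of "ginv g" j] gweight_ginv[OF g, of j] g by simp
    then show ?thesis using g
      by (simp add: antigen_torus gen_gen_lcomm[of "ginv g" "GKi j"] scal)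
  qed
  have F: "antigen g \<otimes>\<^bsub>op_alg (U chi)\<^esub> antigen (GF j) = inverse (gweight g j) \<odot>\<^bsub>op_alg (U chi)\<^esub> (antigen (GF j) \<otimes>\<^bsub>op_alg (U chi)\<^esub> antigen g)"
    if g: "g \<in> torus_gens" for g j
  proof -
    have gf: "gen (ginv g) \<cdot> (gen (GF j) \<cdot> x) = gweight g j \<odot>\<^sub>U (gen (GF j) \<cdot> (gen (ginv g) \<cdot> x))"
      if "x \<in> carrier (U chi)" for x
    proof -
      have "gen (ginv g) \<cdot> gen (GF j) = gweight g j \<odot>\<^sub>U (gen (GF j) \<cdot> gen (ginv g))"
        using gen_rels(5)[of "ginv g" j] gweight_ginv[OF g, of j] g by simp
      then show ?thesis using that by (simp del: U.m_assoc flip: U.m_assoc)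
    qed
    show ?thesis using g
      by (simp add: antigen_torus gf gen_rels(1)[of "ginv g" "GLi j"] scal)
  qed
  have TT: "antigen g \<otimes>\<^bsub>op_alg (U chi)\<^esub> antigen h = antigen h \<otimes>\<^bsub>op_alg (U chi)\<^esub> antigen g" if "g \<in> torus_gens" "h \<in> torus_gens" for g h
    using that by (simp add: antigen_torus gen_rels(1)[of "ginv g" "ginv h"])
  have inv: "antigen g \<otimes>\<^bsub>op_alg (U chi)\<^esub> antigen (ginv g) = \<one>\<^bsub>op_alg (U chi)\<^esub>" if "g \<in> torus_gens" for g
    using that by (simp add: antigen_torus gen_rels(2))
  have EF: "antigen (GE i) \<otimes>\<^bsub>op_alg (U chi)\<^esub> antigen (GF j) \<ominus>\<^bsub>op_alg (U chi)\<^esub> antigen (GF j) \<otimes>\<^bsub>op_alg (U chi)\<^esub> antigen (GE i)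
       = (if i = j then antigen (GK i) \<ominus>\<^bsub>op_alg (U chi)\<^esub> antigen (GL i) else \<zero>\<^bsub>op_alg (U chi)\<^esub>)" for i j
  proof -
    let ?e = "gen (GE i)" and ?f = "gen (GF j)" and ?k = "gen (GKi i)" and ?l = "gen (GLi j)"
    let ?d = "if i = j then gen (GK i) \<ominus>\<^sub>U gen (GL i) else \<zero>\<^sub>U"
    have d: "?d \<in> carrier (U chi)" by simp
    have le: "?l \<cdot> ?e = qcoef chi i j \<odot>\<^sub>U (?e \<cdot> ?l)"
      using gen_rels(4)[of "GLi j" i] gweight_ginv[of "GL j" i] by (simp add: gweight_simps)
    have kf: "?k \<cdot> ?f = qcoef chi i j \<odot>\<^sub>U (?f \<cdot> ?k)"
      using gen_rels(5)[of "GKi i" j] gweight_ginv[of "GK i" j] by (simp add: gweight_simps)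
    have "?f \<cdot> (?l \<cdot> (?k \<cdot> ?e)) = ?f \<cdot> (?k \<cdot> (?l \<cdot> ?e))"
      by (simp add: gen_gen_lcomm[of "GLi j" "GKi i"])
    also have "\<dots> = (?k \<cdot> ?f) \<cdot> (?e \<cdot> ?l)"
      by (simp only: le kf) simp
    finally have 1: "?f \<cdot> (?l \<cdot> (?k \<cdot> ?e)) = ?k \<cdot> (?f \<cdot> ?e) \<cdot> ?l"
      by simp
    have 2: "?k \<cdot> (?e \<cdot> ?f) \<cdot> ?l
       = ?k \<cdot> (?f \<cdot> ?e) \<cdot> ?l \<oplus>\<^sub>U ?k \<cdot> ?d \<cdot> ?l"
      using d by (simp add: EF_rel[of i j] U.l_distr U.r_distr del: U.m_assoc if_split)
    have 3: "x \<ominus>\<^sub>U (x \<oplus>\<^sub>U y) = \<ominus>\<^bsub>U chi\<^esub> y" if "x \<in> carrier (U chi)" "y \<in> carrier (U chi)" for x y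
      using that by (simp add: a_minus_def U.minus_add U.r_neg2)
    have "antigen (GE i) \<otimes>\<^bsub>op_alg (U chi)\<^esub> antigen (GF j) \<ominus>\<^bsub>op_alg (U chi)\<^esub> antigen (GF j) \<otimes>\<^bsub>op_alg (U chi)\<^esub> antigen (GE i)
      = ?f \<cdot> (?l \<cdot> (?k \<cdot> ?e)) \<ominus>\<^sub>U ?k \<cdot> (?e \<cdot> ?f) \<cdot> ?l"
      by (simp add: scal)
    also have "\<dots> = \<ominus>\<^bsub>U chi\<^esub> (?k \<cdot> ?d \<cdot> ?l)"
      unfolding 1 2 by (rule 3) (use d in simp_all)
    also have "\<dots> = (if i = j then gen (GKi i) \<ominus>\<^sub>U gen (GLi i) else \<zero>\<^sub>U)"
    proof (cases "i = j")
      case True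
      have "?k \<cdot> (gen (GK i) \<ominus>\<^sub>U gen (GL i)) \<cdot> ?l
        = (?k \<cdot> gen (GK i)) \<cdot> ?l \<ominus>\<^sub>U ?k \<cdot> (gen (GL i) \<cdot> ?l)"
        by (simp add: U.r_distr U.l_distr U.r_minus U.l_minus a_minus_def)
      also have "\<dots> = ?l \<ominus>\<^sub>U ?k"
        using True gen_rels(2)[of "GKi i"] gen_rels(2)[of "GL i"] by (simp del: U.m_assoc)
      finally show ?thesis using True by (simp add: a_minus_def U.minus_add U.a_comm)
    qed simp
    finally show "antigen (GE i) \<otimes>\<^bsub>op_alg (U chi)\<^esub> antigen (GF j) \<ominus>\<^bsub>op_alg (U chi)\<^esub> antigen (GF j) \<otimes>\<^bsub>op_alg (U chi)\<^esub> antigen (GE i)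
       = (if i = j then antigen (GK i) \<ominus>\<^bsub>op_alg (U chi)\<^esub> antigen (GL i) else \<zero>\<^bsub>op_alg (U chi)\<^esub>)" by simp
  qed
  show ?thesis unfolding family_def using TT inv E F EF by (intro conjI allI ballI) simp_all
qed

lemma conv_bilinear:
  assumes S: "S \<in> lin_hom (U chi) (U chi)"
  shows "bilinear_map (U chi) (U chi) (U chi) (\<lambda>a b. S a \<cdot> b)"
    "Y \<in> carrier (U chi) \<Longrightarrow> bilinear_map (U chi) (U chi) (U chi) (\<lambda>a b. a \<cdot> Y \<cdot> S b)"
    "bilinear_map (U chi) (U chi) (U chi) (\<lambda>a b. a \<cdot> S b)"
  by (rule bilinear_mapI; simp add: lin_homD[OF S] U.l_distr U.r_distr U.smult_mult_l U.smult_mult_r)+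

text \<open>
  The antipode axioms are inherited by products. If the convolution of \<open>w\<close> is a scalar \<open>e\<close>, then
  multiplying \<open>z\<close> by \<open>w\<close> from the left multiplies the left convolution of \<open>z\<close> by \<open>e\<close>, because on pure tensors
  \<open>S(w\<^sub>1 c) w\<^sub>2 d = S(c) S(w\<^sub>1) w\<^sub>2 d\<close>; the right convolution behaves symmetrically. So they need to be
  verified on the generators only.
\<close>

lemma antipode_exists:
  obtains S where "S \<in> lin_hom (U chi) (U chi)" "S \<in> extensional (carrier (U chi))"
    "\<And>x. x \<in> carrier (U chi) \<Longrightarrow> tensor_lift (U chi) (U chi) (U chi) (\<lambda>a b. S a \<cdot> b) (comult chi x)
          = counit chi x \<odot>\<^sub>U \<one>\<^sub>U"
    "\<And>x. x \<in> carrier (U chi) \<Longrightarrow> tensor_lift (U chi) (U chi) (U chi) (\<lambda>a b. a \<cdot> S b) (comult chi x)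
          = counit chi x \<odot>\<^sub>U \<one>\<^sub>U"
proof -
  obtain h where h: "h \<in> alg_hom (U chi) (op_alg (U chi))" "\<And>g. h (gen g) = antigen g"
    using U_lift[OF U.op_kalgebra antigen_family] by blast
  define S where "S = restrict h (carrier (U chi))"
  have S: "S \<in> alg_hom (U chi) (op_alg (U chi))" unfolding S_def by (rule alg_hom_restrict[OF h(1) U_kalgebra])
  have ext: "S \<in> extensional (carrier (U chi))" by (simp add: S_def)
  have Sg [simp]: "S (gen g) = antigen g" for g by (simp add: S_def h)
  have Sl: "S \<in> lin_hom (U chi) (U chi)" using alg_homD(1)[OF S] by (simp add: lin_hom_op)
  note Sm [simp] = alg_homD(2,3)[OF S, simplified] lin_homD[OF Sl]
  define L where "L = tensor_lift (U chi) (U chi) (U chi) (\<lambda>a b. S a \<cdot> b)"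
  define R where "R = tensor_lift (U chi) (U chi) (U chi) (\<lambda>a b. a \<cdot> S b)"
  have L: "L \<in> lin_hom U2 (U chi)" "\<And>a b. a \<in> carrier (U chi) \<Longrightarrow> b \<in> carrier (U chi) \<Longrightarrow> L (UU.pt a b) = S a \<cdot> b"
    unfolding L_def using UU.tensor_lift[OF conv_bilinear(1)[OF Sl] U.kspace_axioms] by auto
  have R: "R \<in> lin_hom U2 (U chi)" "\<And>a b. a \<in> carrier (U chi) \<Longrightarrow> b \<in> carrier (U chi) \<Longrightarrow> R (UU.pt a b) = a \<cdot> S b"
    unfolding R_def using UU.tensor_lift[OF conv_bilinear(3)[OF Sl] U.kspace_axioms] by auto
  note Lh [simp] = L(2) lin_homD[OF L(1)] and Rh [simp] = R(2) lin_homD[OF R(1)]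
  have Ll: "L (w \<otimes>\<^bsub>U2\<^esub> z) = e \<odot>\<^sub>U L z" if w: "w \<in> carrier U2" "L w = e \<odot>\<^sub>U \<one>\<^sub>U" and z: "z \<in> carrier U2" for w z e
  proof (rule UU.tensor_hom_eqI[OF _ _ U.kspace_axioms _ z])
    show "(\<lambda>z. L (w \<otimes>\<^bsub>U2\<^esub> z)) \<in> lin_hom U2 (U chi)" "(\<lambda>z. e \<odot>\<^sub>U L z) \<in> lin_hom U2 (U chi)"
      by (rule lin_homI; use w in \<open>simp add: UU.T.r_distr UU.T.smult_mult_r U.smult_r_distr mult.commute flip: U.smult_assoc\<close>)+
    fix c d assume cd: "c \<in> carrier (U chi)" "d \<in> carrier (U chi)"
    have "L (w \<otimes>\<^bsub>U2\<^esub> UU.pt c d) = S c \<cdot> L w \<cdot> d"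
    proof (rule UU.tensor_hom_eqI[OF _ _ U.kspace_axioms _ w(1)])
      show "(\<lambda>w. L (w \<otimes>\<^bsub>U2\<^esub> UU.pt c d)) \<in> lin_hom U2 (U chi)" "(\<lambda>w. S c \<cdot> L w \<cdot> d) \<in> lin_hom U2 (U chi)"
        by (rule lin_homI; use cd in \<open>simp add: UU.T.l_distr UU.T.smult_mult_l U.l_distr U.r_distr U.smult_mult_l U.smult_mult_r\<close>)+
    qed (use cd in \<open>simp add: UU.pt_mult U.m_assoc\<close>)
    then show "L (w \<otimes>\<^bsub>U2\<^esub> UU.pt c d) = e \<odot>\<^sub>U L (UU.pt c d)"
      using cd w(2) by (simp add: U.smult_mult_l U.smult_mult_r)
  qed
  have Rr: "R (w \<otimes>\<^bsub>U2\<^esub> z) = e \<odot>\<^sub>U R w" if z: "z \<in> carrier U2" "R z = e \<odot>\<^sub>U \<one>\<^sub>U" and w: "w \<in> carrier U2" for w z e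
  proof (rule UU.tensor_hom_eqI[OF _ _ U.kspace_axioms _ w])
    show "(\<lambda>w. R (w \<otimes>\<^bsub>U2\<^esub> z)) \<in> lin_hom U2 (U chi)" "(\<lambda>w. e \<odot>\<^sub>U R w) \<in> lin_hom U2 (U chi)"
      by (rule lin_homI; use z in \<open>simp add: UU.T.l_distr UU.T.smult_mult_l U.smult_r_distr mult.commute flip: U.smult_assoc\<close>)+
    fix c d assume cd: "c \<in> carrier (U chi)" "d \<in> carrier (U chi)"
    have "R (UU.pt c d \<otimes>\<^bsub>U2\<^esub> z) = c \<cdot> R z \<cdot> S d"
    proof (rule UU.tensor_hom_eqI[OF _ _ U.kspace_axioms _ z(1)])
      show "(\<lambda>z. R (UU.pt c d \<otimes>\<^bsub>U2\<^esub> z)) \<in> lin_hom U2 (U chi)" "(\<lambda>z. c \<cdot> R z \<cdot> S d) \<in> lin_hom U2 (U chi)"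
        by (rule lin_homI; use cd in \<open>simp add: UU.T.r_distr UU.T.smult_mult_r U.l_distr U.r_distr U.smult_mult_l U.smult_mult_r\<close>)+
    qed (use cd in \<open>simp add: UU.pt_mult U.m_assoc\<close>)
    then show "R (UU.pt c d \<otimes>\<^bsub>U2\<^esub> z) = e \<odot>\<^sub>U R (UU.pt c d)"
      using cd z(2) by (simp add: U.smult_mult_l U.smult_mult_r)
  qed
  note cm = alg_homD[OF comult(1)] lin_homD[OF alg_homD(1)[OF comult(1)]] comult(2)
  note cu = alg_homD[OF counit(1)] lin_homD[OF alg_homD(1)[OF counit(1)]] counit(2)
  have cz: "comult chi \<zero>\<^sub>U = \<zero>\<^bsub>U2\<^esub>" "counit chi \<zero>\<^sub>U = 0"
    using lin_hom_zero[OF cm(1) U.kspace_axioms UU.T.kspace_axioms]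
      lin_hom_zero[OF cu(1) U.kspace_axioms kalgebra.axioms(1)[OF ground_kalgebra]] by simp_all
  have LRz: "L \<zero>\<^bsub>U2\<^esub> = \<zero>\<^sub>U" "R \<zero>\<^bsub>U2\<^esub> = \<zero>\<^sub>U"
    using lin_hom_zero[OF L(1) UU.T.kspace_axioms U.kspace_axioms] lin_hom_zero[OF R(1) UU.T.kspace_axioms U.kspace_axioms] by auto
  have neg: "(- 1) \<odot>\<^sub>U x \<oplus>\<^sub>U x = \<zero>\<^sub>U" "x \<oplus>\<^sub>U (- 1) \<odot>\<^sub>U x = \<zero>\<^sub>U" if "x \<in> carrier (U chi)" for x
    using that by (simp_all add: U.smult_minus_one U.l_neg U.r_neg)
  have can: "gen (GKi i) \<cdot> gen (GK i) = \<one>\<^sub>U" "gen (GLi i) \<cdot> gen (GL i) = \<one>\<^sub>U"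
    "gen (GK i) \<cdot> (gen (GKi i) \<cdot> gen (GE i)) = gen (GE i)" for i
    using gen_rels(2)[of "GKi i"] gen_rels(2)[of "GLi i"] gen_cancel(1)[of "GK i" "gen (GE i)"] by simp_all
  have gens: "L (cogen g) = counit chi (gen g) \<odot>\<^sub>U \<one>\<^sub>U" "R (cogen g) = counit chi (gen g) \<odot>\<^sub>U \<one>\<^sub>U" for g
  proof -
    show "L (cogen g) = counit chi (gen g) \<odot>\<^sub>U \<one>\<^sub>U"
    proof (cases "g \<in> torus_gens")
      case True then show ?thesis by (simp add: cogen_torus antigen_torus gen_rels cu)
    next
      case False then show ?thesis
        by (cases g) (simp_all add: cu neg U.m_assoc U.smult_mult_l can)
    qed
    show "R (cogen g) = counit chi (gen g) \<odot>\<^sub>U \<one>\<^sub>U"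
    proof (cases "g \<in> torus_gens")
      case True then show ?thesis by (simp add: cogen_torus antigen_torus gen_rels cu)
    next
      case False then show ?thesis
        by (cases g) (simp_all add: cu neg U.smult_mult_r can)
    qed
  qed
  have LR: "L (comult chi x) = counit chi x \<odot>\<^sub>U \<one>\<^sub>U \<and> R (comult chi x) = counit chi x \<odot>\<^sub>U \<one>\<^sub>U"
    if "x \<in> carrier (U chi)" for x
    using that
  proof (induction rule: U_induct)
    case zero then show ?case by (simp add: cz LRz)
  next
    case one then show ?case by (simp add: cm cu UU.pt_one)
  next
    case (gen g x)
    have "comult chi (gen g \<cdot> x) = cogen g \<otimes>\<^bsub>U2\<^esub> comult chi x" using gen by (simp add: cm)
    then show ?case using gen Ll[OF cogen_closed gens(1)] Rr[of "comult chi x" _ "cogen g"]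
      by (simp add: gens cm cu U.smult_assoc[symmetric] mult.commute)
  next
    case (add x y) then show ?case by (simp add: cm cu U.smult_l_distr)
  next
    case (smult c x) then show ?case by (simp add: cm cu U.smult_assoc)
  qed
  show ?thesis by (rule that[OF Sl ext]) (use LR in \<open>auto simp: L_def R_def\<close>)
qed

lemma antipode:
  "antipode chi \<in> lin_hom (U chi) (U chi)"
  "x \<in> carrier (U chi) \<Longrightarrow> tensor_lift (U chi) (U chi) (U chi) (\<lambda>a b. antipode chi a \<cdot> b) (comult chi x)
          = counit chi x \<odot>\<^sub>U \<one>\<^sub>U"
proof -
  let ?P = "\<lambda>S. S \<in> lin_hom (U chi) (U chi) \<and> S \<in> extensional (carrier (U chi)) \<and>
     (\<forall>x\<in>carrier (U chi).
        tensor_lift (U chi) (U chi) (U chi) (\<lambda>a b. S a \<cdot> b) (comult chi x)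
          = counit chi x \<odot>\<^sub>U \<one>\<^sub>U \<and>
        tensor_lift (U chi) (U chi) (U chi) (\<lambda>a b. a \<cdot> S b) (comult chi x)
          = counit chi x \<odot>\<^sub>U \<one>\<^sub>U)"
  have "\<exists>S. ?P S" using antipode_exists by metis
  from someI_ex[OF this] have P: "?P (antipode chi)" unfolding antipode_def .
  from P show "antipode chi \<in> lin_hom (U chi) (U chi)" by blast
  from P show "x \<in> carrier (U chi) \<Longrightarrow> tensor_lift (U chi) (U chi) (U chi) (\<lambda>a b. antipode chi a \<cdot> b) (comult chi x)
          = counit chi x \<odot>\<^sub>U \<one>\<^sub>U" by blast
qed

definition tinv :: "'i gen list \<Rightarrow> 'i gen list" where
  "tinv w = rev (map ginv w)"

lemma tinv_torus: "set w \<subseteq> torus_gens \<Longrightarrow> set (tinv w) \<subseteq> torus_gens"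
  by (auto simp: tinv_def)

lemma tinv_tinv [simp]: "tinv (tinv w) = w"
  by (simp add: tinv_def rev_map comp_def)

lemma word_tinv: "set w \<subseteq> torus_gens \<Longrightarrow> word w \<cdot> word (tinv w) = \<one>\<^sub>U"
proof (induction w)
  case (Cons g w)
  have "word (g # w) \<cdot> word (tinv (g # w))
     = gen g \<cdot> ((word w \<cdot> word (tinv w)) \<cdot> gen (ginv g))"
    by (simp add: tinv_def word_append U.m_assoc)
  then show ?case using Cons by (simp add: gen_rels)
qed (simp add: tinv_def)

lemma word_tinv': "set w \<subseteq> torus_gens \<Longrightarrow> word (tinv w) \<cdot> word w = \<one>\<^sub>U"
  using word_tinv[of "tinv w"] tinv_torus by simp

lemma comult_torus: "set w \<subseteq> torus_gens \<Longrightarrow> comult chi (word w) = UU.pt (word w) (word w)"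
proof (induction w)
  case Nil then show ?case using alg_homD(2)[OF comult(1)] by (simp add: UU.pt_one)
next
  case (Cons g w) then show ?case
    by (simp add: alg_homD(3)[OF comult(1)] comult(2) cogen_torus UU.pt_mult)
qed

lemma counit_torus: "set w \<subseteq> torus_gens \<Longrightarrow> counit chi (word w) = 1"
  by (induction w) (use alg_homD(2,3)[OF counit(1)] in \<open>simp_all add: counit(2)\<close>)

text \<open>
  Torus monomials are group-like, so the antipode axiom makes their images left inverses.
\<close>

lemma antipode_torus: "set w \<subseteq> torus_gens \<Longrightarrow> antipode chi (word w) = word (tinv w)"
proof -
  assume w: "set w \<subseteq> torus_gens"
  have "antipode chi (word w) \<cdot> word w = \<one>\<^sub>U"
    using antipode(2)[of "word w"] UU.tensor_lift(2)[OF conv_bilinear(1)[OF antipode(1)] U.kspace_axioms, of "word w" "word w"]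
    by (simp add: comult_torus[OF w] counit_torus[OF w])
  then show ?thesis
    using U.inv_unique[of "antipode chi (word w)" "word w" "word (tinv w)"] word_tinv[OF w] lin_homD(1)[OF antipode(1)] by simp
qed

lemma adj_lin: "Y \<in> carrier (U chi) \<Longrightarrow> (\<lambda>X. adj_action chi X Y) \<in> lin_hom (U chi) (U chi)"
  unfolding adj_action_def
  by (rule lin_hom_comp[OF alg_homD(1)[OF comult(1)]]) (rule UU.tensor_lift(1)[OF conv_bilinear(2)[OF antipode(1)] U.kspace_axioms])

lemma adj_torus: "set w \<subseteq> torus_gens \<Longrightarrow> Y \<in> carrier (U chi) \<Longrightarrow>
    adj_action chi (word w) Y = word w \<cdot> Y \<cdot> word (tinv w)"
  unfolding adj_action_def
  by (simp add: comult_torus antipode_torus UU.tensor_lift(2)[OF conv_bilinear(2)[OF antipode(1)] U.kspace_axioms])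

subsection \<open>The antiautomorphism\<close>

fun swap :: "'i gen \<Rightarrow> 'i gen" where
  "swap (GE i) = GF i" | "swap (GF i) = GE i" | "swap g = g"

lemma swap_torus [simp]: "swap g \<in> torus_gens \<longleftrightarrow> g \<in> torus_gens" "g \<in> torus_gens \<Longrightarrow> swap g = g" "swap (swap g) = g"
  by (cases g; simp)+

lemma swap_family: "family (op_alg (U chi)) (\<lambda>g. gen (swap g))"
proof (rule familyI[OF U.op_kalgebra])
  have inv: "gen (GKi i) \<cdot> gen (GK i) = \<one>\<^sub>U" "gen (GLi i) \<cdot> gen (GL i) = \<one>\<^sub>U" for i
    using gen_rels(3)[of "GK i"] gen_rels(3)[of "GL i"] by simp_all
  have c: "c \<odot>\<^sub>U (inverse c \<odot>\<^sub>U x) = x" "inverse c \<odot>\<^sub>U (c \<odot>\<^sub>U x) = x"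
    if "x \<in> carrier (U chi)" "c \<noteq> 0" for c x
    using that by (simp_all add: U.smult_cancel)
  have q: "qcoef chi i j \<noteq> 0" for i j by (simp add: qcoef_def)
  fix i j
  show "gen (swap (GK i)) \<otimes>\<^bsub>op_alg (U chi)\<^esub> gen (swap (GKi i)) = \<one>\<^bsub>op_alg (U chi)\<^esub>"
    "gen (swap (GL i)) \<otimes>\<^bsub>op_alg (U chi)\<^esub> gen (swap (GLi i)) = \<one>\<^bsub>op_alg (U chi)\<^esub>" by (simp_all add: inv)
  show "gen (swap (GK i)) \<otimes>\<^bsub>op_alg (U chi)\<^esub> gen (swap (GE j)) = qcoef chi i j \<odot>\<^bsub>op_alg (U chi)\<^esub> (gen (swap (GE j)) \<otimes>\<^bsub>op_alg (U chi)\<^esub> gen (swap (GK i)))"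
    "gen (swap (GL i)) \<otimes>\<^bsub>op_alg (U chi)\<^esub> gen (swap (GE j)) = inverse (qcoef chi j i) \<odot>\<^bsub>op_alg (U chi)\<^esub> (gen (swap (GE j)) \<otimes>\<^bsub>op_alg (U chi)\<^esub> gen (swap (GL i)))"
    "gen (swap (GK i)) \<otimes>\<^bsub>op_alg (U chi)\<^esub> gen (swap (GF j)) = inverse (qcoef chi i j) \<odot>\<^bsub>op_alg (U chi)\<^esub> (gen (swap (GF j)) \<otimes>\<^bsub>op_alg (U chi)\<^esub> gen (swap (GK i)))"
    "gen (swap (GL i)) \<otimes>\<^bsub>op_alg (U chi)\<^esub> gen (swap (GF j)) = qcoef chi j i \<odot>\<^bsub>op_alg (U chi)\<^esub> (gen (swap (GF j)) \<otimes>\<^bsub>op_alg (U chi)\<^esub> gen (swap (GL i)))"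
    using gen_rels(4,5)[of "GK i" j] gen_rels(4,5)[of "GL i" j] q by (simp_all add: gweight_simps c)
  show "gen (swap (GE i)) \<otimes>\<^bsub>op_alg (U chi)\<^esub> gen (swap (GF j)) \<ominus>\<^bsub>op_alg (U chi)\<^esub> gen (swap (GF j)) \<otimes>\<^bsub>op_alg (U chi)\<^esub> gen (swap (GE i)) =
       (if i = j then gen (swap (GK i)) \<ominus>\<^bsub>op_alg (U chi)\<^esub> gen (swap (GL i)) else \<zero>\<^bsub>op_alg (U chi)\<^esub>)"
    using gen_rels(6)[of j i] by auto
qed (simp_all add: gen_rels(1))

text \<open>
  Bijectivity comes for free: an antihomomorphism with these values squares to the identity on the
  generators.
\<close>

lemma phi4: "phi4 chi \<in> alg_hom (U chi) (op_alg (U chi))" "phi4 chi (gen g) = gen (swap g)"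
proof -
  let ?v = "\<lambda>f. f \<in> extensional (carrier (U chi)) \<and>
     (\<forall>i. f (gen (GK i)) = gen (GK i) \<and> f (gen (GL i)) = gen (GL i) \<and>
          f (gen (GE i)) = gen (GF i) \<and> f (gen (GF i)) = gen (GE i))"
  have eq: "f \<in> alg_antiaut (U chi) \<and> ?v f \<longleftrightarrow> f \<in> alg_hom (U chi) (op_alg (U chi)) \<and> ?v f" for f
  proof
    assume f: "f \<in> alg_antiaut (U chi) \<and> ?v f"
    then have "f \<in> alg_hom (U chi) (op_alg (U chi))"
      by (intro alg_homI) (auto simp: alg_antiaut_def lin_hom_op)
    then show "f \<in> alg_hom (U chi) (op_alg (U chi)) \<and> ?v f" using f by blast
  next
    assume f: "f \<in> alg_hom (U chi) (op_alg (U chi)) \<and> ?v f"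
    then have fh: "f \<in> alg_hom (U chi) (op_alg (U chi))" by blast
    have fl: "f \<in> lin_hom (U chi) (U chi)" using alg_homD(1)[OF fh] by (simp add: lin_hom_op)
    note fs = alg_homD(2,3)[OF fh, simplified] lin_homD[OF fl]
    have ff: "(\<lambda>x. f (f x)) \<in> alg_hom (U chi) (U chi)"
      by (intro alg_homI lin_hom_comp[OF fl fl]) (simp_all add: fs)
    have id: "(\<lambda>x. x) \<in> alg_hom (U chi) (U chi)" by (intro alg_homI lin_hom_id) auto
    have inv: "f (f x) = x" if "x \<in> carrier (U chi)" for x
      using U_hom_eqI[OF U_kalgebra ff id _ _ _ _ that] f by auto
    have "bij_betw f (carrier (U chi)) (carrier (U chi))"
      by (rule bij_betw_byWitness[where f' = f]) (auto simp: inv fs)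
    then show "f \<in> alg_antiaut (U chi) \<and> ?v f" using f fl fs by (auto simp: alg_antiaut_def)
  qed
  let ?P = "\<lambda>f. f \<in> alg_hom (U chi) (op_alg (U chi)) \<and> ?v f" and ?G = "\<lambda>g. gen (swap g)"
  have P: "?P D \<longleftrightarrow> D \<in> alg_hom (U chi) (op_alg (U chi)) \<and> D \<in> extensional (carrier (U chi)) \<and>
      (\<forall>i. D (gen (GK i)) = ?G (GK i) \<and> D (gen (GL i)) = ?G (GL i) \<and>
         D (gen (GE i)) = ?G (GE i) \<and> D (gen (GF i)) = ?G (GF i))" for D
    by (simp only: swap.simps)
  show "phi4 chi \<in> alg_hom (U chi) (op_alg (U chi))" "phi4 chi (gen g) = gen (swap g)"
    unfolding phi4_def eq by (fact U_hom_the(2,3)[where P = ?P and G = ?G, OF U.op_kalgebra swap_family P])+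
qed

lemma phi4_lin: "phi4 chi \<in> lin_hom (U chi) (U chi)"
  using alg_homD(1)[OF phi4(1)] by (simp add: lin_hom_op)

lemma phi4_simps [simp]:
  "x \<in> carrier (U chi) \<Longrightarrow> phi4 chi x \<in> carrier (U chi)"
  "phi4 chi \<one>\<^sub>U = \<one>\<^sub>U"
  "x \<in> carrier (U chi) \<Longrightarrow> y \<in> carrier (U chi) \<Longrightarrow> phi4 chi (x \<cdot> y) = phi4 chi y \<cdot> phi4 chi x"
  "phi4 chi (gen g) = gen (swap g)"
  using lin_homD(1)[OF phi4_lin] alg_homD(2,3)[OF phi4(1)] phi4(2) by simp_all

lemma phi4_phi4 [simp]: "x \<in> carrier (U chi) \<Longrightarrow> phi4 chi (phi4 chi x) = x"
proof -
  have "(\<lambda>x. phi4 chi (phi4 chi x)) \<in> alg_hom (U chi) (U chi)"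
    by (intro alg_homI lin_hom_comp[OF phi4_lin phi4_lin]) simp_all
  moreover have "(\<lambda>x. x) \<in> alg_hom (U chi) (U chi)" by (intro alg_homI lin_hom_id) auto
  ultimately show "x \<in> carrier (U chi) \<Longrightarrow> phi4 chi (phi4 chi x) = x"
    by (rule U_hom_eqI[OF U_kalgebra]) auto
qed

lemma counit_phi4: "x \<in> carrier (U chi) \<Longrightarrow> counit chi (phi4 chi x) = counit chi x"
proof -
  have "(\<lambda>x. counit chi (phi4 chi x)) \<in> alg_hom (U chi) ground_alg"
    by (intro alg_homI lin_hom_comp[OF phi4_lin alg_homD(1)[OF counit(1)]])
      (use alg_homD(2,3)[OF counit(1)] in \<open>simp_all add: mult.commute\<close>)
  from U_hom_eqI[OF ground_kalgebra this counit(1)] show "x \<in> carrier (U chi) \<Longrightarrow> counit chi (phi4 chi x) = counit chi x"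
    by (simp add: counit(2))
qed

end

section \<open>The triangular decomposition\<close>

context kalgebra begin

lemma subalg_gen_closed: "S \<subseteq> carrier A \<Longrightarrow> x \<in> subalg_gen A S \<Longrightarrow> x \<in> carrier A"
  by (rotate_tac, induction rule: subalg_gen.induct) auto

lemma subalg_gen_zero: "\<zero> \<in> subalg_gen A S"
  using subalg_gen.smult[OF subalg_gen.one, of A 0 S] by simp

lemma subalg_gen_subspace: "S \<subseteq> carrier A \<Longrightarrow> lin_subspace A (subalg_gen A S)"
  by (rule lin_subspaceI) (auto intro: subalg_gen.intros subalg_gen_zero subalg_gen_closed)

lemma subalg_kalgebra:
  assumes S: "S \<subseteq> carrier A"
  shows "kalgebra (A\<lparr>carrier := subalg_gen A S\<rparr>)" (is "kalgebra ?B")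
proof -
  note sub = lin_subspaceD[OF subalg_gen_subspace[OF S]]
  note [simp] = sub(2-5) and neg = lin_subspace_a_inv[OF subalg_gen_subspace[OF S]]
  have "abelian_group ?B"
  proof (rule abelian_groupI)
    fix x assume x: "x \<in> carrier ?B"
    then have "\<ominus> x \<oplus> x = \<zero>" by (simp add: l_neg)
    then show "\<exists>y\<in>carrier ?B. y \<oplus>\<^bsub>?B\<^esub> x = \<zero>\<^bsub>?B\<^esub>" using neg[of x] x by auto
  qed (auto simp: a_ac)
  then have "ring ?B"
    by (rule ringI[OF _ monoidI]) (auto simp: m_assoc l_distr r_distr intro: subalg_gen.intros)
  then interpret R: ring ?B .
  show ?thesis
    by unfold_locales (auto simp: smult_l_distr smult_r_distr smult_assoc smult_mult_l smult_mult_r)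
qed

text \<open>
  Linear statements about the positive part, the negative part and the torus thus need checking only on
  words.
\<close>

lemma subalg_gen_words:
  assumes f: "\<And>g. f g \<in> carrier A"
  shows "subalg_gen A (f ` X) = lin_span A {wprod A f w | w. set w \<subseteq> X}" (is "?L = lin_span A ?W")
proof
  have W: "?W \<subseteq> carrier A" by (auto intro: wprod_closed f)
  note sub = lin_subspaceD[OF lin_subspace_span[OF W]]
  show "?L \<subseteq> lin_span A ?W"
  proof
    fix x assume "x \<in> ?L"
    then show "x \<in> lin_span A ?W"
    proof induction
      case one show ?case by (rule lin_span.base) (auto intro: exI[of _ "[]"])
    next
      case (base x)
      then obtain g where g: "x = f g" "g \<in> X" by auto
      show ?case by (rule lin_span.base) (use g f in \<open>auto intro!: exI[of _ "[g]"]\<close>)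
    next
      case (mult x y)
      have "a \<otimes> b \<in> lin_span A ?W" if "a \<in> ?W" "b \<in> ?W" for a b
      proof -
        from that obtain u v where uv: "a = wprod A f u" "b = wprod A f v" "set u \<subseteq> X" "set v \<subseteq> X" by auto
        then have "a \<otimes> b = wprod A f (u @ v)" "set (u @ v) \<subseteq> X" using f by (simp_all add: wprod_append)
        then show ?thesis by (blast intro: lin_span.base)
      qed
      from bilin_closed_span[OF kalgebra_axioms lin_subspace_span[OF W] W W this mult.IH] show ?case .
    qed (auto intro: sub)
  qed
  have "wprod A f w \<in> ?L" if "set w \<subseteq> X" for w
    using that by (induction w) (auto intro: subalg_gen.intros)
  moreover have "f ` X \<subseteq> carrier A" using f by auto
  ultimately show "lin_span A ?W \<subseteq> ?L"
    by (intro lin_span_least subalg_gen_subspace) auto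
qed

end

context bichar begin

subsection \<open>A representation of U\<close>

text \<open>
  The basis vector \<open>(u, a, b, w)\<close> stands for \<open>E\<^sub>u K\<^sup>a L\<^sup>b F\<^sub>w\<close>. Only the vector space structure of the monoid algebra is
  used, so its monoid operations are left undefined.
\<close>

abbreviation V :: "('k, 'i list \<times> (int ^ 'i) \<times> (int ^ 'i) \<times> 'i list \<Rightarrow>\<^sub>0 'k) module" where
  "V \<equiv> monoid_alg \<lparr>carrier = UNIV, mult = undefined, one = undefined\<rparr>"

abbreviation sc :: "'k \<Rightarrow> ('i list \<times> (int ^ 'i) \<times> (int ^ 'i) \<times> 'i list \<Rightarrow>\<^sub>0 'k) \<Rightarrow> _" where
  "sc c \<equiv> Poly_Mapping.map ((*) c)"

sublocale V: kspace V by (rule monoid_alg_kspace)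

lemma V_UNIV: "carrier V = UNIV" by simp

sublocale EV: kalgebra "end_alg V" by (rule V.end_kalgebra[OF V_UNIV])

lemma sc_simps: "sc c (sc d v) = sc (c * d) v" "sc 1 v = v" "sc c (v + v') = sc c v + sc c v'"
  "sc c (v - v') = sc c v - sc c v'"
  by (rule poly_mapping_eqI; simp add: lookup_add lookup_minus algebra_simps)+

lemma V_hom:
  assumes "f \<in> lin_hom V V"
  shows "f (v + v') = f v + f v'" "f (v - v') = f v - f v'" "f (sc c v) = sc c (f v)" "f 0 = 0"
  using lin_homD(2,3)[OF assms] lin_hom_minus[OF assms V.kspace_axioms V.kspace_axioms, of v v']
    lin_hom_zero[OF assms V.kspace_axioms V.kspace_axioms] by (simp_all add: monoid_alg_minus)

lemma V_hom_eqI: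
  assumes f: "f \<in> lin_hom V V" and g: "g \<in> lin_hom V V"
    and eq: "\<And>u a b w. f (Poly_Mapping.single (u, a, b, w) 1) = g (Poly_Mapping.single (u, a, b, w) 1)"
  shows "f v = g v"
  by (rule lin_hom_eq_on_span[OF f g V.kspace_axioms V.kspace_axioms, of "range (\<lambda>x. Poly_Mapping.single x 1)"])
    (use eq monoid_alg_span[of "\<lparr>carrier = UNIV, mult = undefined, one = undefined\<rparr>"] in auto)

lemma V_ext: "lin_ext V f \<in> lin_hom V V" "lin_ext V f (Poly_Mapping.single x c) = sc c (f x)"
  by (rule V.lin_ext_hom, simp) (simp add: V.lin_ext_single)

definition wt :: "'i list \<Rightarrow> int ^ 'i" where "wt u = (\<Sum>j\<leftarrow>u. axis j 1)"

lemma wt_simps [simp]: "wt [] = 0" "wt (j # u) = axis j 1 + wt u"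
  by (simp_all add: wt_def)

definition tact :: "'i gen \<Rightarrow> _" where
  "tact g = lin_ext V (\<lambda>(u, a, b, w). Poly_Mapping.single (u, a + kdeg g, b + ldeg g, w) (weight (kdeg g) (ldeg g) (wt u)))"

definition eop :: "'i \<Rightarrow> _" where
  "eop j = lin_ext V (\<lambda>(u, a, b, w). Poly_Mapping.single (j # u, a, b, w) 1)"

text \<open>
  The recursion turns the relation \<open>E\<^sub>j F\<^sub>i - F\<^sub>i E\<^sub>j = \<delta>\<^sub>i\<^sub>j (K\<^sub>i - L\<^sub>i)\<close> into the definition of the action of
  \<open>F\<^sub>i\<close>. With no letter \<open>E\<close> left, \<open>F\<^sub>i\<close> moves past the torus monomial of degree \<open>(a, b)\<close>, which costs its
  weight.
\<close>

fun fbas where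
  "fbas i [] a b w = Poly_Mapping.single ([], a, b, i # w) (weight a b (axis i 1))"
| "fbas i (j # u) a b w = eop j (fbas i u a b w) -
     (if i = j then tact (GK i) (Poly_Mapping.single (u, a, b, w) 1) - tact (GL i) (Poly_Mapping.single (u, a, b, w) 1) else 0)"

definition fop :: "'i \<Rightarrow> _" where
  "fop i = lin_ext V (\<lambda>(u, a, b, w). fbas i u a b w)"

fun act :: "'i gen \<Rightarrow> _" where
  "act (GE j) = eop j" | "act (GF j) = fop j" | "act g = tact g"

lemma act_torus: "g \<in> torus_gens \<Longrightarrow> act g = tact g"
  by (auto elim: torus_gens_cases)

lemma ops_hom: "tact g \<in> lin_hom V V" "eop j \<in> lin_hom V V" "fop j \<in> lin_hom V V"
  unfolding tact_def eop_def fop_def by (rule V_ext)+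

lemmas op_hom = V_hom[OF ops_hom(1)] V_hom[OF ops_hom(2)] V_hom[OF ops_hom(3)]

lemma ops_single:
  "tact g (Poly_Mapping.single (u, a, b, w) c) = Poly_Mapping.single (u, a + kdeg g, b + ldeg g, w) (c * weight (kdeg g) (ldeg g) (wt u))"
  "eop j (Poly_Mapping.single (u, a, b, w) c) = Poly_Mapping.single (j # u, a, b, w) c"
  "fop j (Poly_Mapping.single (u, a, b, w) c) = sc c (fbas j u a b w)"
  unfolding tact_def eop_def fop_def V_ext by simp_all

lemma comp_hom: "f \<in> lin_hom V V \<Longrightarrow> g \<in> lin_hom V V \<Longrightarrow> (\<lambda>v. f (g v)) \<in> lin_hom V V"
  by (rule lin_hom_comp)

lemma sc_hom: "f \<in> lin_hom V V \<Longrightarrow> (\<lambda>v. sc c (f v)) \<in> lin_hom V V"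
  by (rule lin_homI) (simp_all add: V_hom sc_simps mult.commute)

lemma diff_hom: "f \<in> lin_hom V V \<Longrightarrow> g \<in> lin_hom V V \<Longrightarrow> (\<lambda>v. f v - g v) \<in> lin_hom V V"
  by (rule lin_homI) (simp_all add: V_hom sc_simps)

lemma zero_hom: "(\<lambda>v. 0) \<in> lin_hom V V"
  by (rule lin_homI) (simp_all add: V_hom)

lemma tact_tact: "tact g (tact h v) = tact h (tact g v)"
  by (rule V_hom_eqI[OF comp_hom[OF ops_hom(1) ops_hom(1)] comp_hom[OF ops_hom(1) ops_hom(1)]])
    (simp add: ops_single ac_simps)

lemma tact_eop: "tact g (eop j v) = sc (gweight g j) (eop j (tact g v))"
  by (rule V_hom_eqI[OF comp_hom[OF ops_hom(1) ops_hom(2)] sc_hom[OF comp_hom[OF ops_hom(2) ops_hom(1)]]])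
    (simp add: ops_single weight_add)

lemma fop_eop: "fop i (eop j v) = eop j (fop i v) - (if i = j then tact (GK i) v - tact (GL i) v else 0)"
proof (cases "i = j")
  case True
  have "fop i (eop j v) = eop j (fop i v) - (tact (GK i) v - tact (GL i) v)"
    by (rule V_hom_eqI[OF comp_hom[OF ops_hom(3) ops_hom(2)]
          diff_hom[OF comp_hom[OF ops_hom(2) ops_hom(3)] diff_hom[OF ops_hom(1) ops_hom(1)]]])
      (simp add: ops_single sc_simps True)
  then show ?thesis using True by simp
next
  case False
  have "fop i (eop j v) = eop j (fop i v)"
    by (rule V_hom_eqI[OF comp_hom[OF ops_hom(3) ops_hom(2)] comp_hom[OF ops_hom(2) ops_hom(3)]])
      (simp add: ops_single sc_simps False)
  then show ?thesis using False by simp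
qed

text \<open>
  The one relation that is not built into the action. In the induction step the terms with \<open>K\<^sub>i\<close> and \<open>L\<^sub>i\<close>
  occur only for \<open>i = j\<close>, and then the scalars for \<open>E\<^sub>j\<close> and \<open>F\<^sub>i\<close> cancel.
\<close>

lemma tact_fbas: "tact g (fbas i u a b w) = sc (inverse (gweight g i)) (fop i (tact g (Poly_Mapping.single (u, a, b, w) 1)))"
proof (induction u)
  case Nil
  then show ?case by (simp add: ops_single weight_add field_simps)
next
  case (Cons j u)
  let ?v = "Poly_Mapping.single (u, a, b, w) 1"
  have "tact g (fbas i (j # u) a b w)
     = sc (gweight g j * inverse (gweight g i)) (eop j (fop i (tact g ?v)))
       - (if i = j then tact (GK i) (tact g ?v) - tact (GL i) (tact g ?v) else 0)"
    by (simp only: fbas.simps op_hom tact_eop Cons sc_simps if_distrib[of "tact g"] tact_tact[of g])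
  also have "\<dots> = sc (inverse (gweight g i)) (fop i (sc (gweight g j) (eop j (tact g ?v))))"
    by (cases "i = j") (simp_all add: op_hom fop_eop sc_simps mult.commute)
  also have "sc (gweight g j) (eop j (tact g ?v)) = tact g (eop j ?v)" by (simp only: tact_eop)
  finally show ?case by (simp only: ops_single(2))
qed

lemma tact_fop: "tact g (fop i v) = sc (inverse (gweight g i)) (fop i (tact g v))"
  by (rule V_hom_eqI[OF comp_hom[OF ops_hom(1) ops_hom(3)] sc_hom[OF comp_hom[OF ops_hom(3) ops_hom(1)]]])
    (simp add: ops_single(3) sc_simps tact_fbas)

lemma tact_ginv: "g \<in> torus_gens \<Longrightarrow> tact g (tact (ginv g) v) = v"
  by (rule V_hom_eqI[OF comp_hom[OF ops_hom(1) ops_hom(1)] lin_hom_id])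
    (simp add: ops_single deg_ginv weight_minus)

lemma end_alg_simps: "carrier (end_alg V) = lin_hom V V" "f \<otimes>\<^bsub>end_alg V\<^esub> g = (\<lambda>x. f (g x))"
  "\<one>\<^bsub>end_alg V\<^esub> = (\<lambda>x. x)" "f \<oplus>\<^bsub>end_alg V\<^esub> g = (\<lambda>x. f x + g x)" "c \<odot>\<^bsub>end_alg V\<^esub> f = (\<lambda>x. sc c (f x))"
  "\<zero>\<^bsub>end_alg V\<^esub> = (\<lambda>x. 0)"
  by (simp_all add: end_alg_def)

lemma end_alg_minus:
  assumes "f \<in> lin_hom V V" "g \<in> lin_hom V V" shows "f \<ominus>\<^bsub>end_alg V\<^esub> g = (\<lambda>x. f x - g x)"
proof -
  have "\<ominus>\<^bsub>end_alg V\<^esub> g = (\<lambda>x. 0 - g x)"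
    by (rule EV.minus_equality) (use assms diff_hom[OF zero_hom assms(2)] in \<open>simp_all add: end_alg_simps\<close>)
  then show ?thesis using assms by (simp add: a_minus_def end_alg_simps)
qed

lemma act_hom: "act g \<in> lin_hom V V"
  by (cases g) (auto intro: ops_hom)

lemma act_family: "family (end_alg V) act"
proof -
  have EF: "act (GE i) \<otimes>\<^bsub>end_alg V\<^esub> act (GF j) \<ominus>\<^bsub>end_alg V\<^esub> act (GF j) \<otimes>\<^bsub>end_alg V\<^esub> act (GE i) =
        (if i = j then act (GK i) \<ominus>\<^bsub>end_alg V\<^esub> act (GL i) else \<zero>\<^bsub>end_alg V\<^esub>)" for i j
  proof -
    have "act (GE i) \<otimes>\<^bsub>end_alg V\<^esub> act (GF j) \<ominus>\<^bsub>end_alg V\<^esub> act (GF j) \<otimes>\<^bsub>end_alg V\<^esub> act (GE i)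
      = (\<lambda>v. eop i (fop j v) - fop j (eop i v))"
      unfolding act.simps end_alg_simps
      by (rule end_alg_minus[OF comp_hom[OF ops_hom(2) ops_hom(3)] comp_hom[OF ops_hom(3) ops_hom(2)]])
    then show ?thesis by (auto simp: fop_eop end_alg_simps end_alg_minus[OF ops_hom(1) ops_hom(1)])
  qed
  have "act g \<in> carrier (end_alg V)" for g unfolding end_alg_simps by (rule act_hom)
  moreover have "act g \<otimes>\<^bsub>end_alg V\<^esub> act h = act h \<otimes>\<^bsub>end_alg V\<^esub> act g" if "g \<in> torus_gens" "h \<in> torus_gens" for g h
    unfolding end_alg_simps act_torus[OF that(1)] act_torus[OF that(2)] by (rule ext) (rule tact_tact)
  moreover have "act g \<otimes>\<^bsub>end_alg V\<^esub> act (ginv g) = \<one>\<^bsub>end_alg V\<^esub>" if "g \<in> torus_gens" for g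
    using that unfolding end_alg_simps by (intro ext) (simp add: act_torus tact_ginv)
  moreover have "act g \<otimes>\<^bsub>end_alg V\<^esub> act (GE j) = gweight g j \<odot>\<^bsub>end_alg V\<^esub> (act (GE j) \<otimes>\<^bsub>end_alg V\<^esub> act g)"
    if "g \<in> torus_gens" for g j
    unfolding end_alg_simps act_torus[OF that] act.simps by (rule ext) (rule tact_eop)
  moreover have "act g \<otimes>\<^bsub>end_alg V\<^esub> act (GF j) = inverse (gweight g j) \<odot>\<^bsub>end_alg V\<^esub> (act (GF j) \<otimes>\<^bsub>end_alg V\<^esub> act g)"
    if "g \<in> torus_gens" for g j
    unfolding end_alg_simps act_torus[OF that] act.simps by (rule ext) (rule tact_fop)
  ultimately show ?thesis unfolding family_def using EF by (intro conjI allI ballI)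
qed

definition rho where "rho = (SOME h. h \<in> alg_hom (U chi) (end_alg V) \<and> (\<forall>g. h (gen g) = act g))"

lemma rho: "rho \<in> alg_hom (U chi) (end_alg V)" "rho (gen g) = act g"
proof -
  have "\<exists>h. h \<in> alg_hom (U chi) (end_alg V) \<and> (\<forall>g. h (gen g) = act g)"
    using U_lift[OF EV.kalgebra_axioms act_family] by metis
  from someI_ex[OF this] show "rho \<in> alg_hom (U chi) (end_alg V)" "rho (gen g) = act g"
    by (auto simp: rho_def)
qed

text \<open>
  The image of the vacuum vector, which belongs to empty words and degree zero.
\<close>

definition coords where "coords x = rho x (Poly_Mapping.single ([], 0, 0, []) 1)"

lemma coords_hom: "coords \<in> lin_hom (U chi) V"
  by (rule lin_homI) (simp_all add: coords_def lin_homD[OF alg_homD(1)[OF rho(1)]] end_alg_simps)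

lemma coords_gen: "x \<in> carrier (U chi) \<Longrightarrow> coords (gen g \<cdot> x) = act g (coords x)"
  by (simp add: coords_def alg_homD(3)[OF rho(1)] rho(2) end_alg_simps)

lemma coords_one: "coords \<one>\<^sub>U = Poly_Mapping.single ([], 0, 0, []) 1"
  by (simp add: coords_def alg_homD(2)[OF rho(1)] end_alg_simps)

definition kdegs :: "'i gen list \<Rightarrow> int ^ 'i" where "kdegs h = (\<Sum>g\<leftarrow>h. kdeg g)"
definition ldegs :: "'i gen list \<Rightarrow> int ^ 'i" where "ldegs h = (\<Sum>g\<leftarrow>h. ldeg g)"

lemma degs_simps [simp]: "kdegs [] = 0" "kdegs (g # h) = kdeg g + kdegs h" "ldegs [] = 0" "ldegs (g # h) = ldeg g + ldegs h"
  "kdegs (h @ h') = kdegs h + kdegs h'" "ldegs (h @ h') = ldegs h + ldegs h'"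
  by (simp_all add: kdegs_def ldegs_def)

abbreviation ew :: "'i list \<Rightarrow> _" where "ew u \<equiv> word (map GE u)"
abbreviation fw :: "'i list \<Rightarrow> _" where "fw w \<equiv> word (map GF w)"

text \<open>
  Distinct words in triangular form have distinct basis vectors as coordinates. This is the linear
  independence in the triangular decomposition.
\<close>

lemma coords_pbw:
  assumes "set h \<subseteq> torus_gens"
  shows "coords (word (map GE u @ h @ map GF w)) = Poly_Mapping.single (u, kdegs h, ldegs h, w) 1"
proof (induction u)
  case Nil
  show ?case using assms
  proof (induction h)
    case Nil
    show ?case by (induction w) (simp_all add: coords_one coords_gen ops_single)
  next
    case (Cons g h)
    then show ?case by (simp add: coords_gen act_torus ops_single add.commute)
  qed
next
  case (Cons j u)
  then show ?case by (simp add: coords_gen ops_single)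
qed

subsection \<open>Spanning\<close>

lemma torus_ew: "set h \<subseteq> torus_gens \<Longrightarrow>
    word h \<cdot> ew u = weight (kdegs h) (ldegs h) (wt u) \<odot>\<^sub>U (ew u \<cdot> word h)"
proof (induction h)
  case (Cons g h)
  have g: "gen g \<cdot> ew u = weight (kdeg g) (ldeg g) (wt u) \<odot>\<^sub>U (ew u \<cdot> gen g)"
  proof (induction u)
    case (Cons j u)
    have "gen g \<cdot> ew (j # u) = (gen g \<cdot> gen (GE j)) \<cdot> ew u" by (simp add: U.m_assoc)
    also have "\<dots> = gweight g j \<odot>\<^sub>U (gen (GE j) \<cdot> (gen g \<cdot> ew u))"
      using Cons.prems \<open>set (g # h) \<subseteq> torus_gens\<close> by (simp add: gen_rels(4) U.m_assoc U.smult_mult_l)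
    finally show ?case by (simp only: Cons) (simp add: U.smult_mult_r U.m_assoc weight_add flip: U.smult_assoc)
  qed simp
  have "word (g # h) \<cdot> ew u = gen g \<cdot> (word h \<cdot> ew u)" by (simp add: U.m_assoc)
  also have "\<dots> = weight (kdegs h) (ldegs h) (wt u) \<odot>\<^sub>U ((gen g \<cdot> ew u) \<cdot> word h)"
    using Cons by (simp add: U.smult_mult_r U.m_assoc)
  finally show ?case by (simp only: g) (simp add: U.smult_mult_l U.m_assoc weight_add mult.commute flip: U.smult_assoc)
qed simp

lemma torus_fw: "set h \<subseteq> torus_gens \<Longrightarrow>
    word h \<cdot> fw u = inverse (weight (kdegs h) (ldegs h) (wt u)) \<odot>\<^sub>U (fw u \<cdot> word h)"
proof (induction h)
  case (Cons g h)
  have g: "gen g \<cdot> fw u = inverse (weight (kdeg g) (ldeg g) (wt u)) \<odot>\<^sub>U (fw u \<cdot> gen g)"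
  proof (induction u)
    case (Cons j u)
    have "gen g \<cdot> fw (j # u) = (gen g \<cdot> gen (GF j)) \<cdot> fw u" by (simp add: U.m_assoc)
    also have "\<dots> = inverse (gweight g j) \<odot>\<^sub>U (gen (GF j) \<cdot> (gen g \<cdot> fw u))"
      using Cons.prems \<open>set (g # h) \<subseteq> torus_gens\<close> by (simp add: gen_rels(5) U.m_assoc U.smult_mult_l)
    finally show ?case by (simp only: Cons) (simp add: U.smult_mult_r U.m_assoc weight_add flip: U.smult_assoc)
  qed simp
  have "word (g # h) \<cdot> fw u = gen g \<cdot> (word h \<cdot> fw u)" by (simp add: U.m_assoc)
  also have "\<dots> = inverse (weight (kdegs h) (ldegs h) (wt u)) \<odot>\<^sub>U ((gen g \<cdot> fw u) \<cdot> word h)"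
    using Cons by (simp add: U.smult_mult_r U.m_assoc)
  finally show ?case by (simp only: g) (simp add: U.smult_mult_l U.m_assoc weight_add mult.commute flip: U.smult_assoc)
qed simp

definition pbw :: "('i gen list \<Rightarrow>\<^sub>0 'k) set set" where
  "pbw = {word (map GE u @ h @ map GF w) | u h w. set h \<subseteq> torus_gens}"

lemma pbw_carrier: "pbw \<subseteq> carrier (U chi)"
  by (auto simp: pbw_def)

text \<open>
  A letter \<open>F\<^sub>i\<close> is moved through the letters \<open>E\<^sub>j\<close> one at a time. Each commutator leaves a torus letter in
  front of a shorter word, and torus letters can be moved to their place at the cost of a scalar.
\<close>

lemma pbw_closed:
  assumes "x \<in> lin_span (U chi) pbw" shows "gen g \<cdot> x \<in> lin_span (U chi) pbw" (is "_ \<in> ?S")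
proof -
  note sub = U.lin_subspace_span[OF pbw_carrier]
  have lift: "gen g \<cdot> x \<in> ?S" if "\<And>y. y \<in> pbw \<Longrightarrow> gen g \<cdot> y \<in> ?S" "x \<in> ?S" for g x
    by (rule lin_hom_span_into[of "\<lambda>x. gen g \<cdot> x", OF _ U.kspace_axioms U.kspace_axioms sub pbw_carrier])
      (use that in \<open>auto intro!: lin_homI simp: U.r_distr U.smult_mult_r\<close>)
  have mem: "word (map GE u @ h @ map GF w) \<in> ?S" if "set h \<subseteq> torus_gens" for u h w
    using that by (auto simp: pbw_def intro: lin_span.base)
  have E: "gen (GE j) \<cdot> x \<in> ?S" if "x \<in> ?S" for j x
  proof (rule lift[OF _ that])
    fix y assume "y \<in> pbw"
    then obtain u h w where y: "y = word (map GE u @ h @ map GF w)" "set h \<subseteq> torus_gens" by (auto simp: pbw_def)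
    then show "gen (GE j) \<cdot> y \<in> ?S" using mem[of h "j # u" w] by simp
  qed
  have T0: "gen g \<cdot> word (map GE u @ h @ map GF w) \<in> ?S" if "g \<in> torus_gens" "set h \<subseteq> torus_gens" for g u h w
  proof -
    have "gen g \<cdot> word (map GE u @ h @ map GF w) = (word [g] \<cdot> ew u) \<cdot> word (h @ map GF w)"
      by (simp add: word_append U.m_assoc)
    also have "\<dots> = weight (kdegs [g]) (ldegs [g]) (wt u) \<odot>\<^sub>U word (map GE u @ (g # h) @ map GF w)"
      using that(1) by (simp add: torus_ew[of "[g]", simplified] word_append U.m_assoc U.smult_mult_l)
    finally show ?thesis using mem[of "g # h" u w] that by (simp only: lin_subspaceD(4)[OF sub] set_simps insert_subset)
  qed
  have F0: "gen (GF i) \<cdot> word (map GE u @ h @ map GF w) \<in> ?S" if h: "set h \<subseteq> torus_gens" for i u h w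
  proof (induction u)
    case Nil
    let ?c = "weight (kdegs h) (ldegs h) (axis i 1)"
    have "?c \<odot>\<^sub>U (word h \<cdot> gen (GF i)) = gen (GF i) \<cdot> word h"
      using torus_fw[OF h, of "[i]"] by (simp add: U.smult_cancel)
    then have "gen (GF i) \<cdot> word (h @ map GF w) = ?c \<odot>\<^sub>U word (map GE [] @ h @ map GF (i # w))"
      using U.smult_mult_l[of "word h \<cdot> gen (GF i)" "fw w" ?c] by (simp add: word_append U.m_assoc)
    then show ?case using lin_subspaceD(4)[OF sub mem[OF h, of "[]" "i # w"]] by simp
  next
    case (Cons j u)
    let ?x = "word (map GE u @ h @ map GF w)"
    have "gen (GF i) \<cdot> gen (GE j) = gen (GE j) \<cdot> gen (GF i) \<ominus>\<^sub>U
        (if j = i then gen (GK j) \<ominus>\<^sub>U gen (GL j) else \<zero>\<^sub>U)"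
      unfolding EF_rel[of j i] by (simp add: a_minus_def U.a_assoc U.r_neg)
    then have "gen (GF i) \<cdot> word (map GE (j # u) @ h @ map GF w) =
      gen (GE j) \<cdot> (gen (GF i) \<cdot> ?x) \<ominus>\<^sub>U
        (if j = i then gen (GK j) \<cdot> ?x \<ominus>\<^sub>U gen (GL j) \<cdot> ?x else \<zero>\<^sub>U)"
      by (simp add: a_minus_def U.l_distr U.l_minus flip: U.m_assoc)
    moreover have "\<dots> \<in> ?S"
      using E[OF Cons] T0[OF _ h, of "GK j" u w] T0[OF _ h, of "GL j" u w]
      by (auto intro!: U.lin_subspace_minus[OF sub] lin_span.zero)
    ultimately show ?case by simp
  qed
  have pb: "gen g \<cdot> y \<in> ?S" if "y \<in> pbw" for y
  proof -
    from that obtain u h w where y: "y = word (map GE u @ h @ map GF w)" "set h \<subseteq> torus_gens" by (auto simp: pbw_def)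
    show ?thesis
    proof (cases "g \<in> torus_gens")
      case True then show ?thesis using T0 y by simp
    next
      case False then show ?thesis using F0[of h _ u w] E[OF lin_span.base[OF that]] y by (cases g) auto
    qed
  qed
  show ?thesis by (rule lift[OF pb assms])
qed

lemma pbw_span: "carrier (U chi) = lin_span (U chi) pbw"
proof
  note sub = U.lin_subspace_span[OF pbw_carrier]
  show "carrier (U chi) \<subseteq> lin_span (U chi) pbw"
  proof
    fix x assume "x \<in> carrier (U chi)"
    then show "x \<in> lin_span (U chi) pbw"
    proof (induction rule: U_induct)
      case one
      have "word (map GE [] @ [] @ map GF []) \<in> pbw" unfolding pbw_def by fastforce
      then show ?case by (auto intro: lin_span.base)
    qed (auto intro: lin_span.intros pbw_closed)
  qed
qed (rule U.lin_span_closed[OF pbw_carrier])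

subsection \<open>The three subalgebras\<close>

abbreviation "Up \<equiv> carrier (Uplus chi)"
abbreviation "U0 \<equiv> carrier (Uzero chi)"
abbreviation "Um \<equiv> carrier (Uminus chi)"

lemma gens_carrier: "gen ` X \<subseteq> carrier (U chi)" by auto

lemma subset_range_map: "set w \<subseteq> range c \<longleftrightarrow> (\<exists>u. w = map c u)"
  unfolding ex_map_conv by blast

lemma Up_span: "Up = lin_span (U chi) (range ew)"
proof -
  have *: "{word w | w. set w \<subseteq> range GE} = range ew"
    by (auto simp: subset_range_map)
  show ?thesis unfolding Uplus_def by (simp add: U.subalg_gen_words *)
qed

lemma Um_span: "Um = lin_span (U chi) (range fw)"
proof -
  have *: "{word w | w. set w \<subseteq> range GF} = range fw"
    by (auto simp: subset_range_map)
  show ?thesis unfolding Uminus_def by (simp add: U.subalg_gen_words *)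
qed

lemma U0_span: "U0 = lin_span (U chi) {word h | h. set h \<subseteq> torus_gens}"
  unfolding Uzero_def by (simp add: U.subalg_gen_words)

lemma Uplus_kalgebra: "kalgebra (Uplus chi)"
  and Uminus_kalgebra: "kalgebra (Uminus chi)"
  and Uzero_kalgebra: "kalgebra (Uzero chi)"
  unfolding Uplus_def Uminus_def Uzero_def by (rule U.subalg_kalgebra[OF gens_carrier])+

lemma Up_subspace: "lin_subspace (U chi) Up" and Um_subspace: "lin_subspace (U chi) Um" and U0_subspace: "lin_subspace (U chi) U0"
  unfolding Uplus_def Uminus_def Uzero_def by (simp_all add: U.subalg_gen_subspace[OF gens_carrier])

lemma sub_carrier [simp, intro]:
  "x \<in> Up \<Longrightarrow> x \<in> carrier (U chi)" "x \<in> Um \<Longrightarrow> x \<in> carrier (U chi)" "x \<in> U0 \<Longrightarrow> x \<in> carrier (U chi)"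
  using Up_subspace Um_subspace U0_subspace by (auto simp: lin_subspace_def)

lemma sub_mult:
  "x \<in> Up \<Longrightarrow> y \<in> Up \<Longrightarrow> x \<cdot> y \<in> Up"
  "x \<in> Um \<Longrightarrow> y \<in> Um \<Longrightarrow> x \<cdot> y \<in> Um"
  "x \<in> U0 \<Longrightarrow> y \<in> U0 \<Longrightarrow> x \<cdot> y \<in> U0"
  unfolding Uplus_def Uminus_def Uzero_def by (simp_all add: subalg_gen.mult)

lemma sub_one [simp]: "\<one>\<^sub>U \<in> Up" "\<one>\<^sub>U \<in> Um" "\<one>\<^sub>U \<in> U0"
  unfolding Uplus_def Uminus_def Uzero_def by (simp_all add: subalg_gen.one)

lemma ew_Up [simp]: "ew u \<in> Up" and fw_Um [simp]: "fw u \<in> Um"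
  unfolding Up_span Um_span by (auto intro: lin_span.base)

lemma torus_U0: "set h \<subseteq> torus_gens \<Longrightarrow> word h \<in> U0"
  unfolding U0_span by (auto intro: lin_span.base)

lemma gen_sub [simp]: "gen (GE j) \<in> Up" "gen (GF j) \<in> Um" "g \<in> torus_gens \<Longrightarrow> gen g \<in> U0"
  using ew_Up[of "[j]"] fw_Um[of "[j]"] torus_U0[of "[g]"] by (auto simp del: ew_Up fw_Um)

lemma pbw_mem: "set h \<subseteq> torus_gens \<Longrightarrow> ew u \<cdot> word h \<cdot> fw w = word (map GE u @ h @ map GF w)"
  by (simp add: word_append U.m_assoc)

subsection \<open>Torus monomials are determined by their degree\<close>

lemma degs_nth:
  "kdegs h $ i = int (count_list h (GK i)) - int (count_list h (GKi i))"
  "ldegs h $ i = int (count_list h (GL i)) - int (count_list h (GLi i))"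
proof (induction h)
  case (Cons g h)
  { case 1 show ?case using Cons by (cases g) (auto simp: axis_def) }
  { case 2 show ?case using Cons by (cases g) (auto simp: axis_def) }
qed simp_all

lemma torus_word_commute: "g \<in> torus_gens \<Longrightarrow> set x \<subseteq> torus_gens \<Longrightarrow> gen g \<cdot> word x = word x \<cdot> gen g"
proof (induction x)
  case (Cons h x)
  have "gen g \<cdot> word (h # x) = gen h \<cdot> (gen g \<cdot> word x)"
    using gen_gen_lcomm[of g h "word x"] Cons.prems by simp
  then show ?case using Cons by (simp add: U.m_assoc)
qed simp

text \<open>
  If the inverse of the first letter occurs later, then the two cancel. Otherwise the degree has a
  nonzero entry, because nothing compensates the first letter.
\<close>

lemma torus_word_one: "set h \<subseteq> torus_gens \<Longrightarrow> kdegs h = 0 \<Longrightarrow> ldegs h = 0 \<Longrightarrow> word h = \<one>\<^sub>U"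
proof (induction h rule: length_induct)
  case (1 h)
  show ?case
  proof (cases h)
    case (Cons g h')
    have g: "g \<in> torus_gens" using 1 Cons by simp
    have z: "kdegs h $ i = 0" "ldegs h $ i = 0" for i using 1 by simp_all
    have "ginv g \<in> set h'"
    proof (rule ccontr)
      assume "ginv g \<notin> set h'"
      then have n: "count_list h (ginv g) = 0" using Cons g by (auto elim: torus_gens_cases simp: count_list_0_iff)
      have p: "count_list h g > 0" using Cons by simp
      from g show False by (cases rule: torus_gens_cases) (use n p z degs_nth[of h] in auto)
    qed
    then obtain x y where xy: "h' = x @ ginv g # y" by (meson split_list)
    have s: "set x \<subseteq> torus_gens" "set y \<subseteq> torus_gens" using 1 Cons xy by auto
    have "word h = (gen g \<cdot> word x) \<cdot> (gen (ginv g) \<cdot> word y)"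
      by (simp add: Cons xy word_append U.m_assoc)
    also have "\<dots> = word (x @ y)"
      unfolding torus_word_commute[OF g s(1)] using g by (simp add: U.m_assoc gen_cancel word_append)
    also have "\<dots> = \<one>\<^sub>U"
      using 1 Cons xy s deg_ginv[OF g] by (intro 1(1)[rule_format]) auto
    finally show ?thesis .
  qed simp
qed

lemma degs_tinv: "set h \<subseteq> torus_gens \<Longrightarrow> kdegs (tinv h) = - kdegs h" "set h \<subseteq> torus_gens \<Longrightarrow> ldegs (tinv h) = - ldegs h"
  by (induction h) (simp_all add: tinv_def deg_ginv)

lemma torus_word_eqI:
  assumes "set h \<subseteq> torus_gens" "set h' \<subseteq> torus_gens" "kdegs h = kdegs h'" "ldegs h = ldegs h'"
  shows "word h = word h'"
proof -
  have "word (h @ tinv h') = \<one>\<^sub>U"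
    by (rule torus_word_one) (use assms tinv_torus[of h'] in \<open>auto simp: degs_tinv\<close>)
  then have "word h \<cdot> word (tinv h') = \<one>\<^sub>U" by (simp add: word_append)
  then show ?thesis using U.inv_unique[of "word h" "word (tinv h')" "word h'"] word_tinv'[OF assms(2)] by simp
qed

text \<open>
  The torus monomial of the given degree, independent of the chosen word by \<open>torus_word_eqI\<close>. The default
  value one keeps \<open>tmon a b\<close> in the torus without an argument that every degree occurs.
\<close>

definition tmon :: "int ^ 'i \<Rightarrow> int ^ 'i \<Rightarrow> ('i gen list \<Rightarrow>\<^sub>0 'k) set" where
  "tmon a b = (if \<exists>h. set h \<subseteq> torus_gens \<and> kdegs h = a \<and> ldegs h = b
     then word (SOME h. set h \<subseteq> torus_gens \<and> kdegs h = a \<and> ldegs h = b) else \<one>\<^sub>U)"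

lemma tmon_degs: "set h \<subseteq> torus_gens \<Longrightarrow> tmon (kdegs h) (ldegs h) = word h"
proof -
  assume h: "set h \<subseteq> torus_gens"
  let ?P = "\<lambda>h'. set h' \<subseteq> torus_gens \<and> kdegs h' = kdegs h \<and> ldegs h' = ldegs h"
  have "?P (SOME h'. ?P h')" by (rule someI[of ?P h]) (simp add: h)
  then have "word (SOME h'. ?P h') = word h" using h by (intro torus_word_eqI) auto
  then show ?thesis using h by (auto simp: tmon_def)
qed

lemma tmon_U0: "tmon a b \<in> U0"
proof (cases "\<exists>h. set h \<subseteq> torus_gens \<and> kdegs h = a \<and> ldegs h = b")
  case True then show ?thesis using tmon_degs torus_U0 by metis
next
  case False
  then have "tmon a b = \<one>\<^sub>U" unfolding tmon_def by (rule if_not_P)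
  then show ?thesis by simp
qed

subsection \<open>Coefficients\<close>

text \<open>
  In the expansion of \<open>x\<close> in the basis of words, this collects the positive parts of the terms with torus
  degree \<open>(a, b)\<close> and without any letter \<open>F\<close>.
\<close>

definition coef :: "int ^ 'i \<Rightarrow> int ^ 'i \<Rightarrow> ('i gen list \<Rightarrow>\<^sub>0 'k) set \<Rightarrow> ('i gen list \<Rightarrow>\<^sub>0 'k) set" where
  "coef a b x = lin_ext (U chi) (\<lambda>(u, a', b', w). if a' = a \<and> b' = b \<and> w = [] then ew u else \<zero>\<^sub>U) (coords x)"

lemma coef_hom: "coef a b \<in> lin_hom (U chi) (U chi)"
  unfolding coef_def[abs_def]
  by (rule lin_hom_comp[OF coords_hom]) (rule U.lin_ext_hom, auto)

lemma counit_fw: "counit chi (fw w) = (if w = [] then 1 else 0)"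
  using alg_homD(2,3)[OF counit(1)] by (cases w) (simp_all add: counit(2))

text \<open>
  The counit appears because it maps an element of the negative part to its coefficient at the empty
  word.
\<close>

lemma coef_triangular:
  assumes e: "e \<in> Up" and h: "set h \<subseteq> torus_gens" and f: "f \<in> Um"
  shows "coef a b (e \<cdot> word h \<cdot> f) =
     (if kdegs h = a \<and> ldegs h = b then counit chi f \<odot>\<^sub>U e else \<zero>\<^sub>U)" (is "_ = ?r e f")
proof -
  note ch [simp] = lin_homD[OF coef_hom]
  note cu = lin_homD[OF alg_homD(1)[OF counit(1)]]
  have 1: "coef a b (ew u \<cdot> word h \<cdot> fw w) = ?r (ew u) (fw w)" for u w
    unfolding pbw_mem[OF h] coef_def coords_pbw[OF h] by (subst U.lin_ext_single) (auto simp: counit_fw)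
  have 2: "coef a b (ew u \<cdot> word h \<cdot> f) = ?r (ew u) f" for u
  proof (rule lin_hom_eq_on_span[where f = "\<lambda>f. coef a b (ew u \<cdot> word h \<cdot> f)" and g = "?r (ew u)"
        and S = "range fw", OF _ _ U.kspace_axioms U.kspace_axioms])
    show "(\<lambda>f. coef a b (ew u \<cdot> word h \<cdot> f)) \<in> lin_hom (U chi) (U chi)"
      by (rule lin_homI) (simp_all add: U.r_distr U.smult_mult_r)
    show "?r (ew u) \<in> lin_hom (U chi) (U chi)"
      by (rule lin_homI) (simp_all add: cu U.smult_l_distr U.smult_assoc)
  qed (use f 1 Um_span in auto)
  show ?thesis
  proof (rule lin_hom_eq_on_span[where f = "\<lambda>e. coef a b (e \<cdot> word h \<cdot> f)" and g = "\<lambda>e. ?r e f"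
        and S = "range ew", OF _ _ U.kspace_axioms U.kspace_axioms])
    show "(\<lambda>e. coef a b (e \<cdot> word h \<cdot> f)) \<in> lin_hom (U chi) (U chi)"
      using f by (intro lin_homI) (simp_all add: U.l_distr U.smult_mult_l)
    show "(\<lambda>e. ?r e f) \<in> lin_hom (U chi) (U chi)"
      by (rule lin_homI) (simp_all add: U.smult_r_distr mult.commute flip: U.smult_assoc)
  qed (use e 2 Up_span in auto)
qed

section \<open>The skew derivations\<close>

definition conjug :: "'i gen list \<Rightarrow> ('i gen list \<Rightarrow>\<^sub>0 'k) set \<Rightarrow> ('i gen list \<Rightarrow>\<^sub>0 'k) set" where
  "conjug h x = word h \<cdot> x \<cdot> word (tinv h)"

lemma conjug_hom: "conjug h \<in> lin_hom (U chi) (U chi)"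
  unfolding conjug_def[abs_def]
  by (rule lin_homI) (simp_all add: U.l_distr U.r_distr U.smult_mult_l U.smult_mult_r)

lemma conjug_closed [simp]: "x \<in> carrier (U chi) \<Longrightarrow> conjug h x \<in> carrier (U chi)"
  by (rule lin_homD(1)[OF conjug_hom])

lemma conjug_commute:
  assumes "set h \<subseteq> torus_gens" "x \<in> carrier (U chi)"
  shows "word h \<cdot> x = conjug h x \<cdot> word h"
  using assms by (simp add: conjug_def U.m_assoc word_tinv')

lemma conjug_tinv:
  assumes "set h \<subseteq> torus_gens" "x \<in> carrier (U chi)"
  shows "conjug (tinv h) (conjug h x) = x"
proof -
  have "conjug (tinv h) (conjug h x) = (word (tinv h) \<cdot> word h) \<cdot> x \<cdot> (word (tinv h) \<cdot> word h)"
    using assms by (simp add: conjug_def U.m_assoc)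
  then show ?thesis using assms by (simp add: word_tinv')
qed

lemma conjug_Up:
  assumes h: "set h \<subseteq> torus_gens" and x: "x \<in> Up" shows "conjug h x \<in> Up"
proof (rule lin_hom_span_into[OF conjug_hom U.kspace_axioms U.kspace_axioms Up_subspace])
  show "x \<in> lin_span (U chi) (range ew)" using x Up_span by simp
  fix y assume "y \<in> range ew"
  then obtain u where u: "y = ew u" by auto
  have "conjug h y = weight (kdegs h) (ldegs h) (wt u) \<odot>\<^sub>U (ew u \<cdot> (word h \<cdot> word (tinv h)))"
    by (simp only: conjug_def u torus_ew[OF h]) (simp add: U.smult_mult_l U.m_assoc)
  then show "conjug h y \<in> Up" using lin_subspaceD(4)[OF Up_subspace ew_Up] by (simp add: word_tinv[OF h])
qed auto

definition comm :: "'i \<Rightarrow> ('i gen list \<Rightarrow>\<^sub>0 'k) set \<Rightarrow> ('i gen list \<Rightarrow>\<^sub>0 'k) set" where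
  "comm i x = x \<cdot> gen (GF i) \<ominus>\<^sub>U gen (GF i) \<cdot> x"

lemma U_minus_interchange:
  assumes "a \<in> carrier (U chi)" "b \<in> carrier (U chi)" "c \<in> carrier (U chi)" "d \<in> carrier (U chi)"
  shows "(a \<oplus>\<^sub>U b) \<ominus>\<^sub>U (c \<oplus>\<^sub>U d) = (a \<ominus>\<^sub>U c) \<oplus>\<^sub>U (b \<ominus>\<^sub>U d)"
  using assms by (simp add: a_minus_def U.minus_add U.a_ac)

lemma comm_hom: "comm i \<in> lin_hom (U chi) (U chi)"
  unfolding comm_def[abs_def]
  by (rule lin_homI) (simp_all add: U.l_distr U.r_distr U.smult_mult_l U.smult_mult_r U_minus_interchange U.smult_minus)

lemma LE_rel: "gen (GE j) \<cdot> gen (GL i) = qcoef chi j i \<odot>\<^sub>U (gen (GL i) \<cdot> gen (GE j))"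
proof -
  have "qcoef chi j i \<noteq> 0" by (simp add: qcoef_def)
  then show ?thesis using gen_rels(4)[of "GL i" j] by (simp add: gweight_simps U.smult_cancel)
qed

text \<open>
  Induction on words, with \<open>[E\<^sub>j y, F\<^sub>i] = E\<^sub>j [y, F\<^sub>i] + \<delta>\<^sub>i\<^sub>j (K\<^sub>i - L\<^sub>i) y\<close>; then \<open>K\<^sub>i\<close> is moved to the right of \<open>y\<close>,
  and \<open>L\<^sub>i\<close> to the left of \<open>E\<^sub>j\<close>.
\<close>

lemma skew_exists:
  assumes "x \<in> Up"
  shows "\<exists>a\<in>Up. \<exists>b\<in>Up. comm i x = a \<cdot> gen (GK i) \<ominus>\<^sub>U gen (GL i) \<cdot> b"
    (is "?P x")
proof -
  note sub = lin_subspaceD[OF Up_subspace]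
  note ch = lin_homD[OF comm_hom]
  have ew: "?P (ew u)" for u
  proof (induction u)
    case Nil
    have "\<zero>\<^sub>U \<in> Up" by (rule sub)
    moreover have "comm i (ew []) = \<zero>\<^sub>U \<cdot> gen (GK i) \<ominus>\<^sub>U gen (GL i) \<cdot> \<zero>\<^sub>U"
      by (simp add: comm_def U.minus_eq_zero_iff a_minus_def U.r_neg)
    ultimately show ?case by blast
  next
    case (Cons j u)
    then obtain a b where ab: "a \<in> Up" "b \<in> Up"
      "comm i (ew u) = a \<cdot> gen (GK i) \<ominus>\<^sub>U gen (GL i) \<cdot> b" by blast
    let ?y = "ew u" and ?E = "gen (GE j)" and ?F = "gen (GF i)" and ?K = "gen (GK i)" and ?L = "gen (GL i)"
    let ?d = "if j = i then ?K \<ominus>\<^sub>U ?L else \<zero>\<^sub>U"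
    \<comment> \<open>the contributions of \<open>(K\<^sub>i - L\<^sub>i) y\<close> to the two skew derivations\<close>
    let ?a' = "if j = i then conjug [GK i] ?y else \<zero>\<^sub>U" and ?b' = "if j = i then ?y else \<zero>\<^sub>U"
    have ab': "?a' \<in> Up" "?b' \<in> Up" using conjug_Up[of "[GK i]" ?y] sub(2) by auto
    note c [simp] = ab(1,2)[THEN sub(5)] ab'[THEN sub(5)]
    have d': "(if j = i then gen (GK j) \<ominus>\<^sub>U gen (GL j) else \<zero>\<^sub>U) = ?d" by auto
    have Ky: "?d \<cdot> ?y = ?a' \<cdot> ?K \<ominus>\<^sub>U ?L \<cdot> ?b'"
      using conjug_commute[of "[GK i]" ?y] by (auto simp: a_minus_def U.l_distr U.l_minus U.r_neg)
    have "comm i (ew (j # u)) = ?E \<cdot> (?y \<cdot> ?F) \<ominus>\<^sub>U ?F \<cdot> ?E \<cdot> ?y"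
      by (simp add: comm_def U.m_assoc)
    also have "\<dots> = ?E \<cdot> (?y \<cdot> ?F \<ominus>\<^sub>U ?F \<cdot> ?y) \<oplus>\<^sub>U (?E \<cdot> ?F \<ominus>\<^sub>U ?F \<cdot> ?E) \<cdot> ?y"
    proof -
      have "p \<ominus>\<^sub>U r = (p \<ominus>\<^sub>U q) \<oplus>\<^sub>U (q \<ominus>\<^sub>U r)"
        if "p \<in> carrier (U chi)" "q \<in> carrier (U chi)" "r \<in> carrier (U chi)" for p q r
        using that by (simp add: a_minus_def U.a_assoc U.r_neg2 U.r_neg1)
      from this[of "?E \<cdot> (?y \<cdot> ?F)" "?E \<cdot> ?F \<cdot> ?y" "?F \<cdot> ?E \<cdot> ?y"]
      show ?thesis by (simp add: a_minus_def U.r_distr U.l_distr U.r_minus U.l_minus U.m_assoc)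
    qed
    also have "\<dots> = ?E \<cdot> (a \<cdot> ?K \<ominus>\<^sub>U ?L \<cdot> b) \<oplus>\<^sub>U (?a' \<cdot> ?K \<ominus>\<^sub>U ?L \<cdot> ?b')"
      using ab(3) by (simp only: comm_def gen_rels(6) d' Ky)
    also have "?E \<cdot> (a \<cdot> ?K \<ominus>\<^sub>U ?L \<cdot> b)
      = (?E \<cdot> a) \<cdot> ?K \<ominus>\<^sub>U (?E \<cdot> ?L) \<cdot> b"
      by (simp add: a_minus_def U.r_distr U.r_minus U.m_assoc)
    also have "(?E \<cdot> ?L) \<cdot> b = ?L \<cdot> (qcoef chi j i \<odot>\<^sub>U (?E \<cdot> b))"
      by (simp add: LE_rel U.smult_mult_l U.smult_mult_r U.m_assoc)
    also have "((?E \<cdot> a) \<cdot> ?K \<ominus>\<^sub>U ?L \<cdot> (qcoef chi j i \<odot>\<^sub>U (?E \<cdot> b))) \<oplus>\<^sub>U (?a' \<cdot> ?K \<ominus>\<^sub>U ?L \<cdot> ?b')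
      = (?E \<cdot> a \<oplus>\<^sub>U ?a') \<cdot> ?K \<ominus>\<^sub>U ?L \<cdot> (qcoef chi j i \<odot>\<^sub>U (?E \<cdot> b) \<oplus>\<^sub>U ?b')"
      using c by (simp add: U.l_distr U.r_distr U_minus_interchange del: if_split)
    finally show ?case
      by (intro bexI[of _ "?E \<cdot> a \<oplus>\<^sub>U ?a'"] bexI[of _ "qcoef chi j i \<odot>\<^sub>U (?E \<cdot> b) \<oplus>\<^sub>U ?b'"])
        (use ab ab' in \<open>auto intro!: sub(3,4) sub_mult(1) simp del: if_split\<close>)
  qed
  have "lin_subspace (U chi) {x \<in> Up. ?P x}"
  proof (rule lin_subspaceI)
    have "comm i \<zero>\<^sub>U = \<zero>\<^sub>U \<cdot> gen (GK i) \<ominus>\<^sub>U gen (GL i) \<cdot> \<zero>\<^sub>U"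
      by (simp add: comm_def)
    then show "\<zero>\<^sub>U \<in> {x \<in> Up. ?P x}" using sub(2) by blast
  next
    fix x y assume "x \<in> {x \<in> Up. ?P x}" "y \<in> {x \<in> Up. ?P x}"
    then obtain a b a' b' where *: "x \<in> Up" "y \<in> Up" "a \<in> Up" "b \<in> Up" "a' \<in> Up" "b' \<in> Up"
      "comm i x = a \<cdot> gen (GK i) \<ominus>\<^sub>U gen (GL i) \<cdot> b"
      "comm i y = a' \<cdot> gen (GK i) \<ominus>\<^sub>U gen (GL i) \<cdot> b'" by blast
    have "comm i (x \<oplus>\<^sub>U y) = (a \<oplus>\<^sub>U a') \<cdot> gen (GK i) \<ominus>\<^sub>U gen (GL i) \<cdot> (b \<oplus>\<^sub>U b')"
      using * by (simp add: ch U.l_distr U.r_distr U_minus_interchange)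
    then show "x \<oplus>\<^sub>U y \<in> {x \<in> Up. ?P x}" using * sub(3) by blast
  next
    fix c x assume "x \<in> {x \<in> Up. ?P x}"
    then obtain a b where *: "x \<in> Up" "a \<in> Up" "b \<in> Up"
      "comm i x = a \<cdot> gen (GK i) \<ominus>\<^sub>U gen (GL i) \<cdot> b" by blast
    have "comm i (c \<odot>\<^sub>U x) = (c \<odot>\<^sub>U a) \<cdot> gen (GK i) \<ominus>\<^sub>U gen (GL i) \<cdot> (c \<odot>\<^sub>U b)"
      using * by (simp add: ch U.smult_mult_l U.smult_mult_r U.smult_minus)
    then show "c \<odot>\<^sub>U x \<in> {x \<in> Up. ?P x}" using * sub(4) by blast
  qed auto
  then have "lin_span (U chi) (range ew) \<subseteq> {x \<in> Up. ?P x}"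
    by (rule lin_span_least) (use ew ew_Up in blast)
  then show ?thesis using assms unfolding Up_span[symmetric] by blast
qed

lemma coef_Up_torus:
  assumes "e \<in> Up" "set h \<subseteq> torus_gens"
  shows "coef a b (e \<cdot> word h) = (if kdegs h = a \<and> ldegs h = b then e else \<zero>\<^sub>U)"
  using coef_triangular[OF assms sub_one(2), of a b] assms alg_homD(2)[OF counit(1)] by simp

lemma axis_one_neq_zero [simp]: "0 \<noteq> axis i (1::int)"
  by (auto simp: axis_eq_0_iff)

text \<open>
  Coefficient maps expect the torus part to the right of the positive part. For \<open>L\<^sub>i b\<close> this produces the
  conjugate of \<open>b\<close>.
\<close>

lemma coef_skew:
  assumes "a \<in> Up" "b \<in> Up"
  shows "coef (axis i 1) 0 (a \<cdot> gen (GK i) \<ominus>\<^sub>U gen (GL i) \<cdot> b) = a"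
    "coef 0 (axis i 1) (a \<cdot> gen (GK i) \<ominus>\<^sub>U gen (GL i) \<cdot> b) = \<ominus>\<^bsub>U chi\<^esub> conjug [GL i] b"
proof -
  have L: "gen (GL i) \<cdot> b = conjug [GL i] b \<cdot> gen (GL i)"
    using conjug_commute[of "[GL i]" b] assms by simp
  have c: "conjug [GL i] b \<in> Up" using conjug_Up[of "[GL i]" b] assms by simp
  have 1: "coef (axis i 1) 0 (a \<cdot> gen (GK i)) = a" "coef 0 (axis i 1) (a \<cdot> gen (GK i)) = \<zero>\<^sub>U"
    using coef_Up_torus[OF assms(1), of "[GK i]"] by simp_all
  have 2: "coef (axis i 1) 0 (conjug [GL i] b \<cdot> gen (GL i)) = \<zero>\<^sub>U"
    "coef 0 (axis i 1) (conjug [GL i] b \<cdot> gen (GL i)) = conjug [GL i] b"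
    using coef_Up_torus[OF c, of "[GL i]"] by simp_all
  show "coef (axis i 1) 0 (a \<cdot> gen (GK i) \<ominus>\<^sub>U gen (GL i) \<cdot> b) = a"
    "coef 0 (axis i 1) (a \<cdot> gen (GK i) \<ominus>\<^sub>U gen (GL i) \<cdot> b) = \<ominus>\<^bsub>U chi\<^esub> conjug [GL i] b"
    unfolding L using assms c
    by (simp_all add: lin_hom_minus[OF coef_hom U.kspace_axioms U.kspace_axioms] 1 2) (simp_all add: a_minus_def)
qed

text \<open>
  The skew derivations as coefficients of the commutator with \<open>F\<^sub>i\<close>. In the second one the conjugation by
  \<open>L\<^sub>i\<^sup>-\<^sup>1\<close> moves \<open>L\<^sub>i\<close> back to the left.
\<close>

definition dK where "dK i = restrict (\<lambda>x. coef (axis i 1) 0 (comm i x)) Up"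
definition dL where "dL i = restrict (\<lambda>x. \<ominus>\<^bsub>U chi\<^esub> conjug [GLi i] (coef 0 (axis i 1) (comm i x))) Up"

lemma dK_dL:
  assumes x: "x \<in> Up"
  shows "dK i x \<in> Up" "dL i x \<in> Up"
    "comm i x = dK i x \<cdot> gen (GK i) \<ominus>\<^sub>U gen (GL i) \<cdot> dL i x"
    "a \<in> Up \<Longrightarrow> b \<in> Up \<Longrightarrow> comm i x = a \<cdot> gen (GK i) \<ominus>\<^sub>U gen (GL i) \<cdot> b \<Longrightarrow> dK i x = a \<and> dL i x = b"
proof -
  show uniq: "dK i x = a \<and> dL i x = b" if "a \<in> Up" "b \<in> Up"
    "comm i x = a \<cdot> gen (GK i) \<ominus>\<^sub>U gen (GL i) \<cdot> b" for a b
  proof -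
    have "conjug [GLi i] (\<ominus>\<^bsub>U chi\<^esub> conjug [GL i] b) = \<ominus>\<^bsub>U chi\<^esub> b"
      using conjug_tinv[of "[GL i]" b] that(2)
      by (simp add: lin_hom_a_inv[OF conjug_hom U.kspace_axioms U.kspace_axioms] tinv_def)
    then show ?thesis using that x by (simp add: dK_def dL_def coef_skew)
  qed
  obtain a b where ab: "a \<in> Up" "b \<in> Up" "comm i x = a \<cdot> gen (GK i) \<ominus>\<^sub>U gen (GL i) \<cdot> b"
    using skew_exists[OF x] by blast
  with uniq[OF ab] show "dK i x \<in> Up" "dL i x \<in> Up"
    "comm i x = dK i x \<cdot> gen (GK i) \<ominus>\<^sub>U gen (GL i) \<cdot> dL i x" by simp_all
qed

lemma Uplus_simps [simp]: "add (Uplus chi) = add (U chi)" "smult (Uplus chi) = smult (U chi)" "zero (Uplus chi) = zero (U chi)"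
  "mult (Uplus chi) = mult (U chi)" "one (Uplus chi) = one (U chi)"
  by (simp_all add: Uplus_def)

lemma Uminus_simps [simp]: "add (Uminus chi) = add (U chi)" "smult (Uminus chi) = smult (U chi)" "zero (Uminus chi) = zero (U chi)"
  "mult (Uminus chi) = mult (U chi)" "one (Uminus chi) = one (U chi)"
  by (simp_all add: Uminus_def)

lemma Uzero_simps [simp]: "add (Uzero chi) = add (U chi)" "smult (Uzero chi) = smult (U chi)" "zero (Uzero chi) = zero (U chi)"
  "mult (Uzero chi) = mult (U chi)" "one (Uzero chi) = one (U chi)"
  by (simp_all add: Uzero_def)

lemma skew_derivs_iff: "skew_derivs chi i f g \<longleftrightarrow> f = dK i \<and> g = dL i"
proof
  assume *: "skew_derivs chi i f g"
  then have fg: "f x \<in> Up" "g x \<in> Up" "comm i x = f x \<cdot> gen (GK i) \<ominus>\<^sub>U gen (GL i) \<cdot> g x"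
    if "x \<in> Up" for x using that by (auto simp: skew_derivs_def comm_def lin_hom_def)
  have "f x = dK i x \<and> g x = dL i x" if "x \<in> Up" for x using dK_dL(4)[OF that fg[OF that]] by simp
  moreover have "f \<in> extensional Up" "g \<in> extensional Up" using * by (auto simp: skew_derivs_def)
  ultimately show "f = dK i \<and> g = dL i"
    by (auto intro!: extensionalityI[of _ Up] simp: dK_def dL_def)
next
  assume *: "f = dK i \<and> g = dL i"
  have ch: "(\<lambda>x. coef (axis i 1) 0 (comm i x)) \<in> lin_hom (U chi) (U chi)"
    by (rule lin_hom_comp[OF comm_hom coef_hom])
  have neg: "(\<lambda>x. \<ominus>\<^bsub>U chi\<^esub> x) \<in> lin_hom (U chi) (U chi)"
    by (rule lin_homI) (simp_all add: U.minus_add U.smult_a_inv)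
  have cl: "(\<lambda>x. \<ominus>\<^bsub>U chi\<^esub> conjug [GLi i] (coef 0 (axis i 1) (comm i x))) \<in> lin_hom (U chi) (U chi)"
    by (rule lin_hom_comp[OF lin_hom_comp[OF lin_hom_comp[OF comm_hom coef_hom] conjug_hom] neg])
  note sub = lin_subspaceD[OF Up_subspace]
  have "dK i \<in> lin_hom (Uplus chi) (Uplus chi)"
    by (rule lin_homI) (use dK_dL(1) sub(3,4) lin_homD(2,3)[OF ch] in \<open>simp_all add: dK_def\<close>)
  moreover have "dL i \<in> lin_hom (Uplus chi) (Uplus chi)"
    by (rule lin_homI) (use dK_dL(2) sub(3,4) lin_homD(2,3)[OF cl] in \<open>simp_all add: dL_def\<close>)
  ultimately show "skew_derivs chi i f g"
    unfolding skew_derivs_def using * dK_dL(3) by (auto simp: dK_def dL_def comm_def)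
qed

lemma deriv_eq: "derivK chi i = dK i" "derivL chi i = dL i"
  by (simp_all add: derivK_def derivL_def skew_derivs_iff)

section \<open>Ideals of the positive part\<close>

text \<open>
  These closure properties are what makes the right ideal of U generated by an ideal \<open>P\<close> of the positive
  part two-sided.
\<close>

definition stable :: "('i gen list \<Rightarrow>\<^sub>0 'k) set set \<Rightarrow> bool" where
  "stable P \<longleftrightarrow> (\<forall>h. set h \<subseteq> torus_gens \<longrightarrow> conjug h ` P \<subseteq> P) \<and> (\<forall>i. dK i ` P \<subseteq> P \<and> dL i ` P \<subseteq> P)"

lemma stableD:
  assumes "stable P" "p \<in> P"
  shows "set h \<subseteq> torus_gens \<Longrightarrow> conjug h p \<in> P" "dK i p \<in> P" "dL i p \<in> P"
  using assms unfolding stable_def by blast+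

lemma subspace_prodI: "x \<in> X \<Longrightarrow> y \<in> Y \<Longrightarrow> z \<in> Z \<Longrightarrow> x \<otimes>\<^bsub>A\<^esub> y \<otimes>\<^bsub>A\<^esub> z \<in> subspace_prod A X Y Z"
  unfolding subspace_prod_def set_mult_def by (rule lin_span.base) blast

lemma subspace_prod_least:
  assumes "lin_subspace A W" "\<And>x y z. x \<in> X \<Longrightarrow> y \<in> Y \<Longrightarrow> z \<in> Z \<Longrightarrow> x \<otimes>\<^bsub>A\<^esub> y \<otimes>\<^bsub>A\<^esub> z \<in> W"
  shows "subspace_prod A X Y Z \<subseteq> W"
  unfolding subspace_prod_def set_mult_def by (rule lin_span_least[OF assms(1)]) (use assms(2) in auto)

lemma prod_subspace:
  assumes "X \<subseteq> carrier (U chi)" "Y \<subseteq> carrier (U chi)" "Z \<subseteq> carrier (U chi)"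
  shows "lin_subspace (U chi) (subspace_prod (U chi) X Y Z)"
  unfolding subspace_prod_def
  by (rule U.lin_subspace_span) (use assms in \<open>auto simp: set_mult_def\<close>)

lemma Up_ideal:
  assumes "ideal P (Uplus chi)"
  shows "P \<subseteq> Up" "lin_subspace (U chi) P" "a \<in> Up \<Longrightarrow> p \<in> P \<Longrightarrow> a \<cdot> p \<in> P" "a \<in> Up \<Longrightarrow> p \<in> P \<Longrightarrow> p \<cdot> a \<in> P"
proof -
  have S: "lin_subspace (Uplus chi) P" by (rule kalgebra.ideal_lin_subspace[OF Uplus_kalgebra assms])
  then show P: "P \<subseteq> Up" by (simp add: lin_subspace_def)
  then have "P \<subseteq> carrier (U chi)" by auto
  then show "lin_subspace (U chi) P" using S by (simp add: lin_subspace_def)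
  show "a \<in> Up \<Longrightarrow> p \<in> P \<Longrightarrow> a \<cdot> p \<in> P" "a \<in> Up \<Longrightarrow> p \<in> P \<Longrightarrow> p \<cdot> a \<in> P"
    using ideal.I_l_closed[OF assms, of p a] ideal.I_r_closed[OF assms, of p a] by simp_all
qed

lemma Um_ideal:
  assumes "ideal M (Uminus chi)"
  shows "M \<subseteq> Um" "lin_subspace (U chi) M" "a \<in> Um \<Longrightarrow> p \<in> M \<Longrightarrow> a \<cdot> p \<in> M" "a \<in> Um \<Longrightarrow> p \<in> M \<Longrightarrow> p \<cdot> a \<in> M"
proof -
  have S: "lin_subspace (Uminus chi) M" by (rule kalgebra.ideal_lin_subspace[OF Uminus_kalgebra assms])
  then show P: "M \<subseteq> Um" by (simp add: lin_subspace_def)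
  then have "M \<subseteq> carrier (U chi)" by auto
  then show "lin_subspace (U chi) M" using S by (simp add: lin_subspace_def)
  show "a \<in> Um \<Longrightarrow> p \<in> M \<Longrightarrow> a \<cdot> p \<in> M" "a \<in> Um \<Longrightarrow> p \<in> M \<Longrightarrow> p \<cdot> a \<in> M"
    using ideal.I_l_closed[OF assms, of p a] ideal.I_r_closed[OF assms, of p a] by simp_all
qed

abbreviation PUU where "PUU P \<equiv> subspace_prod (U chi) P U0 Um"
abbreviation UUM where "UUM M \<equiv> subspace_prod (U chi) Up U0 M"
abbreviation gen_ideal where "gen_ideal P \<equiv> subspace_prod (U chi) (carrier (U chi)) P (carrier (U chi))"

lemma PUU_subspace: "P \<subseteq> Up \<Longrightarrow> lin_subspace (U chi) (PUU P)"
  by (rule prod_subspace) auto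

lemma UUM_subspace: "M \<subseteq> Um \<Longrightarrow> lin_subspace (U chi) (UUM M)"
  by (rule prod_subspace) auto

text \<open>
  Write \<open>u\<close> in triangular form: its positive part is absorbed by \<open>P\<close>. Hence \<open>P U\<^sup>0 U\<^sup>-\<close> is the right ideal
  \<open>P U\<close>.
\<close>

lemma PUU_mult:
  assumes P: "ideal P (Uplus chi)" and p: "p \<in> P" and u: "u \<in> carrier (U chi)"
  shows "p \<cdot> u \<in> PUU P"
proof -
  note I = Up_ideal[OF P]
  have pc: "p \<in> carrier (U chi)" using p I(1) by auto
  have l: "(\<lambda>u. p \<cdot> u) \<in> lin_hom (U chi) (U chi)"
    using pc by (intro lin_homI) (simp_all add: U.r_distr U.smult_mult_r)
  show ?thesis
  proof (rule lin_hom_span_into[OF l U.kspace_axioms U.kspace_axioms PUU_subspace[OF I(1)] pbw_carrier])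
    show "u \<in> lin_span (U chi) pbw" using u pbw_span by simp
    fix y assume "y \<in> pbw"
    then obtain u h w where y: "y = word (map GE u @ h @ map GF w)" "set h \<subseteq> torus_gens" by (auto simp: pbw_def)
    then have "p \<cdot> y = (p \<cdot> ew u) \<cdot> word h \<cdot> fw w"
      using pc by (simp add: word_append U.m_assoc)
    then show "p \<cdot> y \<in> PUU P"
      using subspace_prodI[OF I(4)[OF ew_Up p] torus_U0[OF y(2)] fw_Um] by simp
  qed
qed

lemma PUU_least:
  assumes W: "lin_subspace (U chi) W" and P: "P \<subseteq> Up" and "\<And>p u. p \<in> P \<Longrightarrow> u \<in> carrier (U chi) \<Longrightarrow> p \<cdot> u \<in> W"
  shows "PUU P \<subseteq> W"
proof (rule subspace_prod_least[OF W])
  fix x y z assume "x \<in> P" "y \<in> U0" "z \<in> Um"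
  moreover have "x \<cdot> y \<cdot> z = x \<cdot> (y \<cdot> z)"
    using calculation P by (intro U.m_assoc) auto
  ultimately show "x \<cdot> y \<cdot> z \<in> W" using assms(3) by simp
qed

text \<open>
  \<open>P U\<close> is a right ideal for every \<open>P\<close>. It is also a left ideal once each generator maps \<open>P\<close> into \<open>P U\<close>: the
  \<open>E\<^sub>j\<close> do since \<open>P\<close> is an ideal, the torus letters by stability under conjugation, and the \<open>F\<^sub>i\<close> by
  \<open>F\<^sub>i p = p F\<^sub>i - \<partial>\<^sup>K\<^sub>i(p) K\<^sub>i + L\<^sub>i \<partial>\<^sup>L\<^sub>i(p)\<close>.
\<close>

lemma PUU_ideal:
  assumes P: "ideal P (Uplus chi)" and st: "stable P"
  shows "ideal (PUU P) (U chi)"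
proof -
  note I = Up_ideal[OF P]
  have Pc [simp]: "p \<in> P \<Longrightarrow> p \<in> carrier (U chi)" for p using I(1) by auto
  note S = PUU_subspace[OF I(1)]
  note Sc = lin_subspaceD[OF S]
  have lmul: "a \<cdot> x \<in> PUU P" if "x \<in> PUU P" and "a \<in> carrier (U chi)"
    and *: "\<And>p u. p \<in> P \<Longrightarrow> u \<in> carrier (U chi) \<Longrightarrow> a \<cdot> (p \<cdot> u) \<in> PUU P" for a x
  proof -
    have "(\<lambda>x. a \<cdot> x) \<in> lin_hom (U chi) (U chi)"
      using that(2) by (intro lin_homI) (simp_all add: U.r_distr U.smult_mult_r)
    from lin_hom_preimage[OF this U.kspace_axioms U.kspace_axioms S]
    have "PUU P \<subseteq> {x \<in> carrier (U chi). a \<cdot> x \<in> PUU P}"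
      by (rule PUU_least[OF _ I(1)]) (use * in auto)
    then show ?thesis using that(1) by auto
  qed
  have right: "x \<cdot> a \<in> PUU P" if "x \<in> PUU P" "a \<in> carrier (U chi)" for a x
  proof -
    have "(\<lambda>x. x \<cdot> a) \<in> lin_hom (U chi) (U chi)"
      using that(2) by (intro lin_homI) (simp_all add: U.l_distr U.smult_mult_l)
    from lin_hom_preimage[OF this U.kspace_axioms U.kspace_axioms S]
    have "PUU P \<subseteq> {x \<in> carrier (U chi). x \<cdot> a \<in> PUU P}"
      by (rule PUU_least[OF _ I(1)]) (use that(2) PUU_mult[OF P] in \<open>auto simp: U.m_assoc\<close>)
    then show ?thesis using that(1) by auto
  qed
  have gl: "gen g \<cdot> (p \<cdot> u) \<in> PUU P" if p: "p \<in> P" and u: "u \<in> carrier (U chi)" for g p u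
  proof -
    have torus: "gen g \<cdot> (p \<cdot> u) \<in> PUU P" if g: "g \<in> torus_gens" and p: "p \<in> P" and u: "u \<in> carrier (U chi)" for g p u
    proof -
      have c: "conjug [g] p \<in> P" by (rule stableD(1)[OF st p]) (use g in simp)
      have "gen g \<cdot> (p \<cdot> u) = (word [g] \<cdot> p) \<cdot> u"
        using p u by (simp add: U.m_assoc)
      also have "\<dots> = conjug [g] p \<cdot> (gen g \<cdot> u)"
        using p u g by (subst conjug_commute) (simp_all add: U.m_assoc)
      finally show ?thesis using PUU_mult[OF P c, of "gen g \<cdot> u"] u by simp
    qed
    show ?thesis
    proof (cases g)
      case (GE j)
      then have "gen g \<cdot> (p \<cdot> u) = (gen (GE j) \<cdot> p) \<cdot> u" using p u by (simp add: U.m_assoc)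
      then show ?thesis using PUU_mult[OF P I(3)[OF gen_sub(1) p] u] by simp
    next
      case (GF i)
      have pU: "p \<in> Up" using p I(1) by auto
      have d: "dK i p \<in> P" "dL i p \<in> P" by (rule stableD[OF st p])+
      have "gen (GF i) \<cdot> p = p \<cdot> gen (GF i) \<ominus>\<^sub>U comm i p"
        using p by (simp add: comm_def a_minus_def U.minus_add U.r_neg2)
      then have "gen g \<cdot> (p \<cdot> u) = p \<cdot> (gen (GF i) \<cdot> u) \<ominus>\<^sub>U
          (dK i p \<cdot> (gen (GK i) \<cdot> u) \<ominus>\<^sub>U gen (GL i) \<cdot> (dL i p \<cdot> u))"
        using p u d GF unfolding dK_dL(3)[OF pU]
        by (simp add: a_minus_def U.l_distr U.l_minus U.m_assoc flip: U.m_assoc[of "gen (GF i)"])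
      then show ?thesis
        using PUU_mult[OF P p, of "gen (GF i) \<cdot> u"] PUU_mult[OF P d(1), of "gen (GK i) \<cdot> u"]
          torus[of "GL i", OF _ d(2) u] u
        by (simp add: U.lin_subspace_minus[OF S])
    qed (use torus p u in auto)
  qed
  have left: "a \<cdot> x \<in> PUU P" if "x \<in> PUU P" "a \<in> carrier (U chi)" for a x
    using that(2)
  proof (induction rule: U_induct)
    case (gen g y)
    have "(gen g \<cdot> y) \<cdot> x = gen g \<cdot> (y \<cdot> x)"
      using gen that(1) Sc(5) by (simp add: U.m_assoc)
    then show ?case using lmul[OF gen.IH gen_closed gl] by simp
  qed (use that(1) Sc in \<open>simp_all add: U.l_distr U.smult_mult_l\<close>)
  show ?thesis by (rule U.idealI_subspace[OF S]) (use left right in auto)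
qed

lemma sumI: "x \<in> X \<Longrightarrow> y \<in> Y \<Longrightarrow> x \<oplus>\<^bsub>A\<^esub> y \<in> X <+>\<^bsub>A\<^esub> Y"
  unfolding set_add_def' by (intro UN_I[of x] UN_I[of y]) auto

lemma sumE:
  assumes "z \<in> X <+>\<^bsub>A\<^esub> Y" obtains x y where "x \<in> X" "y \<in> Y" "z = x \<oplus>\<^bsub>A\<^esub> y"
  using assms unfolding set_add_def' by (elim UN_E) simp

lemma sum_subspace:
  assumes "lin_subspace (U chi) X" "lin_subspace (U chi) Y"
  shows "lin_subspace (U chi) (X <+>\<^bsub>U chi\<^esub> Y)"
proof (rule lin_subspaceI)
  note X = lin_subspaceD[OF assms(1)] and Y = lin_subspaceD[OF assms(2)]
  show "X <+>\<^bsub>U chi\<^esub> Y \<subseteq> carrier (U chi)" using X Y by (auto elim!: sumE)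
  show "\<zero>\<^sub>U \<in> X <+>\<^bsub>U chi\<^esub> Y" using sumI[OF X(2) Y(2), of "U chi"] by simp
  show "x \<oplus>\<^sub>U y \<in> X <+>\<^bsub>U chi\<^esub> Y" if "x \<in> X <+>\<^bsub>U chi\<^esub> Y" "y \<in> X <+>\<^bsub>U chi\<^esub> Y" for x y
  proof -
    from that obtain a b c d where *: "a \<in> X" "b \<in> Y" "c \<in> X" "d \<in> Y" "x = a \<oplus>\<^sub>U b" "y = c \<oplus>\<^sub>U d"
      by (elim sumE)
    then have "x \<oplus>\<^sub>U y = (a \<oplus>\<^sub>U c) \<oplus>\<^sub>U (b \<oplus>\<^sub>U d)" using X(5) Y(5) by (simp add: U.a_ac)
    then show ?thesis using sumI[OF X(3) Y(3)] * by simp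
  qed
  show "e \<odot>\<^sub>U x \<in> X <+>\<^bsub>U chi\<^esub> Y" if "x \<in> X <+>\<^bsub>U chi\<^esub> Y" for e x
  proof -
    from that obtain a b where *: "a \<in> X" "b \<in> Y" "x = a \<oplus>\<^sub>U b" by (elim sumE)
    then have "e \<odot>\<^sub>U x = e \<odot>\<^sub>U a \<oplus>\<^sub>U e \<odot>\<^sub>U b" using X(5) Y(5) by (simp add: U.smult_r_distr)
    then show ?thesis using sumI[OF X(4) Y(4)] * by simp
  qed
qed

lemma sum_supset:
  assumes "lin_subspace (U chi) X" "lin_subspace (U chi) Y"
  shows "X \<subseteq> X <+>\<^bsub>U chi\<^esub> Y" "Y \<subseteq> X <+>\<^bsub>U chi\<^esub> Y"
proof -
  note X = lin_subspaceD[OF assms(1)] and Y = lin_subspaceD[OF assms(2)]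
  show "X \<subseteq> X <+>\<^bsub>U chi\<^esub> Y"
  proof
    fix x assume "x \<in> X" then show "x \<in> X <+>\<^bsub>U chi\<^esub> Y" using sumI[OF _ Y(2), of x X "U chi"] X(5) by simp
  qed
  show "Y \<subseteq> X <+>\<^bsub>U chi\<^esub> Y"
  proof
    fix x assume "x \<in> Y" then show "x \<in> X <+>\<^bsub>U chi\<^esub> Y" using sumI[OF X(2), of x Y "U chi"] Y(5) by simp
  qed
qed

lemma sum_least:
  assumes W: "lin_subspace (U chi) W" and XY: "X \<subseteq> W" "Y \<subseteq> W" shows "X <+>\<^bsub>U chi\<^esub> Y \<subseteq> W"
proof
  fix z assume "z \<in> X <+>\<^bsub>U chi\<^esub> Y"
  then show "z \<in> W" by (rule sumE) (use XY lin_subspaceD(3)[OF W] in blast)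
qed

lemma sum_comm:
  assumes "X \<subseteq> carrier (U chi)" "Y \<subseteq> carrier (U chi)" shows "X <+>\<^bsub>U chi\<^esub> Y = Y <+>\<^bsub>U chi\<^esub> X"
proof -
  have "X <+>\<^bsub>U chi\<^esub> Y \<subseteq> Y <+>\<^bsub>U chi\<^esub> X" if "X \<subseteq> carrier (U chi)" "Y \<subseteq> carrier (U chi)" for X Y
  proof
    fix z assume "z \<in> X <+>\<^bsub>U chi\<^esub> Y"
    then obtain x y where *: "x \<in> X" "y \<in> Y" "z = x \<oplus>\<^sub>U y" by (rule sumE)
    then have "z = y \<oplus>\<^sub>U x" using that U.a_comm by blast
    then show "z \<in> Y <+>\<^bsub>U chi\<^esub> X" using sumI[OF *(2,1)] by simp
  qed
  then show ?thesis using assms by blast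
qed

lemma coef_prod:
  assumes e: "e \<in> Up" and y: "y \<in> U0" and f: "f \<in> Um" and P: "lin_subspace (U chi) P" and z: "counit chi f \<odot>\<^sub>U e \<in> P"
  shows "coef a b (e \<cdot> y \<cdot> f) \<in> P"
proof -
  have l: "(\<lambda>y. coef a b (e \<cdot> y \<cdot> f)) \<in> lin_hom (U chi) (U chi)"
    by (rule lin_homI) (use e f lin_homD[OF coef_hom] in \<open>simp_all add: U.l_distr U.r_distr U.smult_mult_l U.smult_mult_r\<close>)
  show ?thesis
    by (rule lin_hom_span_into[OF l U.kspace_axioms U.kspace_axioms P, of "{word h | h. set h \<subseteq> torus_gens}"])
      (use e f y z lin_subspaceD[OF P] U0_span in \<open>auto simp: coef_triangular\<close>)
qed

text \<open>
  Since the counit kills \<open>M\<close>, elements of \<open>U\<^sup>+ U\<^sup>0 M\<close> have no terms without letters \<open>F\<close>, and only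
  \<open>P U\<^sup>0 U\<^sup>-\<close> contributes.
\<close>

lemma coef_PUU_UUM:
  assumes P: "ideal P (Uplus chi)" and M: "M \<subseteq> Um" "\<And>m. m \<in> M \<Longrightarrow> counit chi m = 0"
    and x: "x \<in> PUU P <+>\<^bsub>U chi\<^esub> UUM M"
  shows "coef a b x \<in> P"
proof -
  note I = Up_ideal[OF P]
  note pre = lin_hom_preimage[OF coef_hom U.kspace_axioms U.kspace_axioms I(2)]
  have "PUU P \<subseteq> {x \<in> carrier (U chi). coef a b x \<in> P}"
  proof (rule subspace_prod_least[OF pre])
    fix x y z assume "x \<in> P" "y \<in> U0" "z \<in> Um"
    moreover have "x \<in> Up" using calculation I(1) by auto
    ultimately show "x \<cdot> y \<cdot> z \<in> {x \<in> carrier (U chi). coef a b x \<in> P}"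
      using coef_prod[OF _ _ _ I(2)] lin_subspaceD(4)[OF I(2)] by simp
  qed
  moreover have "UUM M \<subseteq> {x \<in> carrier (U chi). coef a b x \<in> P}"
  proof (rule subspace_prod_least[OF pre])
    fix x y z assume "x \<in> Up" "y \<in> U0" "z \<in> M"
    moreover have "z \<in> Um" using calculation M by auto
    ultimately show "x \<cdot> y \<cdot> z \<in> {x \<in> carrier (U chi). coef a b x \<in> P}"
      using coef_prod[OF _ _ _ I(2)] lin_subspaceD(2)[OF I(2)] M(2) by simp
  qed
  ultimately show ?thesis using sum_least[OF pre] x by blast
qed

text \<open>
  The converse of \<open>PUU_ideal\<close>, under a weaker hypothesis. For \<open>p \<in> P\<close> the conjugates of \<open>p\<close> and the
  commutators \<open>[p, F\<^sub>i]\<close> lie in \<open>U P U\<close>, so their coefficients lie in \<open>P\<close>; these coefficients are the conjugates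
  themselves, \<open>\<partial>\<^sup>K\<^sub>i(p)\<close>, and the negative of a conjugate of \<open>\<partial>\<^sup>L\<^sub>i(p)\<close>.
\<close>

lemma stable_if_gen_ideal:
  assumes P: "ideal P (Uplus chi)" and M: "M \<subseteq> Um" "\<And>m. m \<in> M \<Longrightarrow> counit chi m = 0"
    and J: "gen_ideal P \<subseteq> PUU P <+>\<^bsub>U chi\<^esub> UUM M"
  shows "stable P"
proof -
  note I = Up_ideal[OF P]
  have G: "lin_subspace (U chi) (gen_ideal P)" by (rule prod_subspace) (use I(1) in auto)
  have cf: "coef a b x \<in> P" if "x \<in> gen_ideal P" for a b x
    using coef_PUU_UUM[OF P M, of x a b] that J by auto
  have cj: "conjug h x \<in> P" if h: "set h \<subseteq> torus_gens" and x: "x \<in> P" for h x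
  proof -
    have xU: "x \<in> Up" using x I(1) by auto
    have "conjug h x \<in> gen_ideal P" unfolding conjug_def by (rule subspace_prodI) (use x in auto)
    \<comment> \<open>the conjugate lies in the positive part, so it is its own coefficient of degree zero\<close>
    from cf[OF this, of 0 0] show ?thesis
      using coef_Up_torus[OF conjug_Up[OF h xU], of "[]" 0 0] xU by simp
  qed
  have dd: "dK i x \<in> P \<and> dL i x \<in> P" if x: "x \<in> P" for i x
  proof -
    have xU: "x \<in> Up" using x I(1) by auto
    \<comment> \<open>both halves of the commutator are products with \<open>x\<close> in the middle\<close>
    have "\<one>\<^sub>U \<cdot> x \<cdot> gen (GF i) \<in> gen_ideal P" "gen (GF i) \<cdot> x \<cdot> \<one>\<^sub>U \<in> gen_ideal P"
      by (rule subspace_prodI; use x in auto)+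
    then have c: "comm i x \<in> gen_ideal P" using xU by (simp add: comm_def U.lin_subspace_minus[OF G])
    have "dK i x \<in> P" using cf[OF c, of "axis i 1" 0] xU by (simp add: dK_def)
    moreover have "dL i x \<in> P" unfolding dL_def
      using U.lin_subspace_a_inv[OF I(2) cj[OF _ cf[OF c, of 0 "axis i 1"], of "[GLi i]"]] xU by simp
    ultimately show ?thesis by simp
  qed
  show ?thesis unfolding stable_def using cj dd by blast
qed

section \<open>Passing to the negative part\<close>

lemma phi4_word: "phi4 chi (word w) = word (rev (map swap w))"
  by (induction w) (simp_all add: word_append)

lemma phi4_ew: "phi4 chi (ew u) = fw (rev u)"
  by (simp add: phi4_word comp_def rev_map)

lemma swap_torus_word: "set h \<subseteq> torus_gens \<Longrightarrow> map swap h = h"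
  by (induction h) auto

lemma phi4_image_span: "S \<subseteq> carrier (U chi) \<Longrightarrow> phi4 chi ` lin_span (U chi) S = lin_span (U chi) (phi4 chi ` S)"
  by (rule lin_hom_image_span[OF phi4_lin U.kspace_axioms U.kspace_axioms])

lemma phi4_image_image: "S \<subseteq> carrier (U chi) \<Longrightarrow> phi4 chi ` phi4 chi ` S = S"
  by (force simp: image_image)

lemma phi4_Up: "phi4 chi ` Up = Um"
proof -
  have "range (\<lambda>u. fw (rev u)) = range fw" by (auto simp: image_iff) (metis rev_rev_ident)
  then show ?thesis unfolding Up_span Um_span by (subst phi4_image_span) (auto simp: image_image phi4_ew)
qed

lemma phi4_Um: "phi4 chi ` Um = Up"
  using phi4_image_image[OF lin_subspaceD(1)[OF Up_subspace]] phi4_Up by simp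

lemma phi4_U0: "phi4 chi ` U0 = U0"
proof -
  let ?T = "{word h | h. set h \<subseteq> torus_gens}"
  have "phi4 chi ` ?T \<subseteq> ?T"
  proof (rule image_subsetI)
    fix x assume "x \<in> ?T"
    then obtain h where "x = word h" "set h \<subseteq> torus_gens" by blast
    then have "phi4 chi x = word (rev h)" "set (rev h) \<subseteq> torus_gens" by (simp_all add: phi4_word swap_torus_word)
    then show "phi4 chi x \<in> ?T" by blast
  qed
  then have "phi4 chi ` U0 \<subseteq> U0"
    unfolding U0_span by (subst phi4_image_span) (auto intro!: lin_span_mono)
  moreover from image_mono[OF this, of "phi4 chi"] have "U0 \<subseteq> phi4 chi ` U0"
    by (simp only: phi4_image_image[OF lin_subspaceD(1)[OF U0_subspace]])
  ultimately show ?thesis by blast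
qed

lemma phi4_carrier: "phi4 chi ` carrier (U chi) = carrier (U chi)"
proof -
  have "phi4 chi ` carrier (U chi) \<subseteq> carrier (U chi)" by auto
  moreover from image_mono[OF this, of "phi4 chi"] have "carrier (U chi) \<subseteq> phi4 chi ` carrier (U chi)"
    by (simp only: phi4_image_image subset_refl)
  ultimately show ?thesis by blast
qed

text \<open>
  One inclusion for arbitrary subsets suffices, since \<open>phi4\<close> is an involution.
\<close>

lemma phi4_prod:
  assumes "X \<subseteq> carrier (U chi)" "Y \<subseteq> carrier (U chi)" "Z \<subseteq> carrier (U chi)"
  shows "phi4 chi ` subspace_prod (U chi) X Y Z = subspace_prod (U chi) (phi4 chi ` Z) (phi4 chi ` Y) (phi4 chi ` X)"
proof -
  have sub: "phi4 chi ` subspace_prod (U chi) X Y Z \<subseteq> subspace_prod (U chi) (phi4 chi ` Z) (phi4 chi ` Y) (phi4 chi ` X)"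
    if c: "X \<subseteq> carrier (U chi)" "Y \<subseteq> carrier (U chi)" "Z \<subseteq> carrier (U chi)" for X Y Z
  proof -
    let ?W = "subspace_prod (U chi) (phi4 chi ` Z) (phi4 chi ` Y) (phi4 chi ` X)"
    have W: "lin_subspace (U chi) ?W" by (rule prod_subspace) (use c in auto)
    have "subspace_prod (U chi) X Y Z \<subseteq> {x \<in> carrier (U chi). phi4 chi x \<in> ?W}"
    proof (rule subspace_prod_least[OF lin_hom_preimage[OF phi4_lin U.kspace_axioms U.kspace_axioms W]])
      fix x y z assume *: "x \<in> X" "y \<in> Y" "z \<in> Z"
      then have "x \<in> carrier (U chi)" "y \<in> carrier (U chi)" "z \<in> carrier (U chi)" using c by auto
      moreover have "phi4 chi z \<cdot> phi4 chi y \<cdot> phi4 chi x \<in> ?W"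
        by (intro subspace_prodI imageI *)
      ultimately show "x \<cdot> y \<cdot> z \<in> {x \<in> carrier (U chi). phi4 chi x \<in> ?W}"
        by (simp add: U.m_assoc)
    qed
    then show ?thesis by blast
  qed
  have c: "phi4 chi ` X \<subseteq> carrier (U chi)" "phi4 chi ` Y \<subseteq> carrier (U chi)" "phi4 chi ` Z \<subseteq> carrier (U chi)"
    using assms by auto
  let ?W = "subspace_prod (U chi) (phi4 chi ` Z) (phi4 chi ` Y) (phi4 chi ` X)"
  have "phi4 chi ` phi4 chi ` ?W \<subseteq> phi4 chi ` subspace_prod (U chi) X Y Z"
    using image_mono[OF sub[OF c(3,2,1)], of "phi4 chi"] assms by (simp only: phi4_image_image)
  then have "?W \<subseteq> phi4 chi ` subspace_prod (U chi) X Y Z"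
    by (simp only: phi4_image_image[OF lin_subspaceD(1)[OF prod_subspace[OF c(3,2,1)]]])
  with sub[OF assms] show ?thesis by (rule subset_antisym)
qed

lemma phi4_sum:
  assumes "X \<subseteq> carrier (U chi)" "Y \<subseteq> carrier (U chi)"
  shows "phi4 chi ` (X <+>\<^bsub>U chi\<^esub> Y) = phi4 chi ` X <+>\<^bsub>U chi\<^esub> phi4 chi ` Y"
proof -
  have eq: "phi4 chi (x \<oplus>\<^sub>U y) = phi4 chi x \<oplus>\<^sub>U phi4 chi y" if "x \<in> X" "y \<in> Y" for x y
    by (rule lin_homD(2)[OF phi4_lin]) (use that assms in blast)+
  show ?thesis
  proof (rule subset_antisym)
    show "phi4 chi ` (X <+>\<^bsub>U chi\<^esub> Y) \<subseteq> phi4 chi ` X <+>\<^bsub>U chi\<^esub> phi4 chi ` Y"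
    proof (rule image_subsetI)
      fix z assume "z \<in> X <+>\<^bsub>U chi\<^esub> Y"
      then obtain x y where *: "x \<in> X" "y \<in> Y" "z = x \<oplus>\<^sub>U y" by (rule sumE)
      show "phi4 chi z \<in> phi4 chi ` X <+>\<^bsub>U chi\<^esub> phi4 chi ` Y"
        unfolding *(3) eq[OF *(1,2)] by (intro sumI imageI *)
    qed
    show "phi4 chi ` X <+>\<^bsub>U chi\<^esub> phi4 chi ` Y \<subseteq> phi4 chi ` (X <+>\<^bsub>U chi\<^esub> Y)"
    proof
      fix z assume "z \<in> phi4 chi ` X <+>\<^bsub>U chi\<^esub> phi4 chi ` Y"
      then obtain a b where "a \<in> phi4 chi ` X" "b \<in> phi4 chi ` Y" "z = a \<oplus>\<^sub>U b" by (rule sumE)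
      moreover obtain x where x: "x \<in> X" "a = phi4 chi x" using calculation(1) by (rule imageE)
      moreover obtain y where y: "y \<in> Y" "b = phi4 chi y" using calculation(2) by (rule imageE)
      ultimately have "z = phi4 chi (x \<oplus>\<^sub>U y)" by (simp only: eq[OF x(1) y(1)])
      then show "z \<in> phi4 chi ` (X <+>\<^bsub>U chi\<^esub> Y)" by (rule image_eqI) (rule sumI[OF x(1) y(1)])
    qed
  qed
qed

lemma phi4_subspace: "lin_subspace (U chi) W \<Longrightarrow> lin_subspace (U chi) (phi4 chi ` W)"
proof -
  assume W: "lin_subspace (U chi) W"
  then have "lin_span (U chi) W = W"
    using lin_span_least[OF W, of W] lin_span_superset[of W "U chi"] by auto
  then have "phi4 chi ` W = lin_span (U chi) (phi4 chi ` W)"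
    using phi4_image_span[of W] lin_subspaceD(1)[OF W] by simp
  moreover have "phi4 chi ` W \<subseteq> carrier (U chi)"
    by (rule image_subsetI) (simp add: lin_subspaceD(5)[OF W])
  ultimately show ?thesis using U.lin_subspace_span[of "phi4 chi ` W"] by simp
qed

lemma phi4_ideal:
  assumes "ideal W (U chi)" shows "ideal (phi4 chi ` W) (U chi)"
proof (rule U.idealI_subspace)
  note W = U.ideal_lin_subspace[OF assms]
  show "lin_subspace (U chi) (phi4 chi ` W)" by (rule phi4_subspace[OF W])
  fix a x assume a: "a \<in> carrier (U chi)" and "x \<in> phi4 chi ` W"
  then obtain w where w: "w \<in> W" "x = phi4 chi w" "w \<in> carrier (U chi)" using lin_subspaceD(1)[OF W] by auto
  have "a \<cdot> x = phi4 chi (w \<cdot> phi4 chi a)" "x \<cdot> a = phi4 chi (phi4 chi a \<cdot> w)"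
    using w a by simp_all
  then show "a \<cdot> x \<in> phi4 chi ` W" "x \<cdot> a \<in> phi4 chi ` W"
    using ideal.I_l_closed[OF assms w(1)] ideal.I_r_closed[OF assms w(1)] a by auto
qed

lemma phi4_Um_ideal:
  assumes M: "ideal M (Uminus chi)" shows "ideal (phi4 chi ` M) (Uplus chi)"
proof (rule kalgebra.idealI_subspace[OF Uplus_kalgebra])
  note I = Um_ideal[OF M]
  have "phi4 chi ` M \<subseteq> Up" using I(1) phi4_Um by blast
  then show "lin_subspace (Uplus chi) (phi4 chi ` M)"
    using phi4_subspace[OF I(2)] by (simp add: lin_subspace_def)
  fix a x assume a: "a \<in> Up" and "x \<in> phi4 chi ` M"
  then obtain w where w: "w \<in> M" "x = phi4 chi w" "w \<in> Um" using I(1) by auto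
  have a': "phi4 chi a \<in> Um" using a phi4_Up by blast
  have "a \<cdot> x = phi4 chi (w \<cdot> phi4 chi a)" "x \<cdot> a = phi4 chi (phi4 chi a \<cdot> w)"
    using w a by simp_all
  then show "a \<otimes>\<^bsub>Uplus chi\<^esub> x \<in> phi4 chi ` M" "x \<otimes>\<^bsub>Uplus chi\<^esub> a \<in> phi4 chi ` M"
    using I(3,4)[OF a' w(1)] by auto
qed

lemma phi4_Up_Um: "P \<subseteq> Up \<Longrightarrow> phi4 chi ` P \<subseteq> Um"
  using phi4_Up by blast

lemma phi4_conjug:
  assumes "set h \<subseteq> torus_gens" "x \<in> carrier (U chi)"
  shows "phi4 chi (conjug h x) = conjug (map ginv h) (phi4 chi x)"
proof -
  have *: "map swap h = h" "map swap (tinv h) = tinv h" using swap_torus_word assms tinv_torus by blast+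
  have t: "rev (tinv h) = map ginv h" "tinv (map ginv h) = rev h"
    by (simp_all add: tinv_def comp_def)
  show ?thesis using assms by (simp add: conjug_def phi4_word * t U.m_assoc)
qed

lemma phi4_conjug_stable:
  assumes "X \<subseteq> carrier (U chi)" "\<forall>h. set h \<subseteq> torus_gens \<longrightarrow> conjug h ` X \<subseteq> X" "set h \<subseteq> torus_gens"
  shows "conjug h ` phi4 chi ` X \<subseteq> phi4 chi ` X"
proof -
  have h: "set (map ginv h) \<subseteq> torus_gens" "map ginv (map ginv h) = h" using assms(3) by (auto simp: comp_def)
  have "conjug h (phi4 chi x) \<in> phi4 chi ` X" if "x \<in> X" for x
  proof -
    have "conjug h (phi4 chi x) = phi4 chi (conjug (map ginv h) x)"
      using phi4_conjug[OF h(1), of x] that assms(1) unfolding h(2) by auto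
    then show ?thesis using assms(2) h(1) that by blast
  qed
  then show ?thesis by blast
qed

text \<open>
  The torus is spanned by group-like monomials, and these act by conjugation.
\<close>

lemma adj_stable_iff:
  assumes X: "lin_subspace (U chi) X"
  shows "(\<forall>Y\<in>U0. adj_action chi Y ` X \<subseteq> X) \<longleftrightarrow> (\<forall>h. set h \<subseteq> torus_gens \<longrightarrow> conjug h ` X \<subseteq> X)"
proof
  assume *: "\<forall>Y\<in>U0. adj_action chi Y ` X \<subseteq> X"
  have "conjug h x \<in> X" if "set h \<subseteq> torus_gens" "x \<in> X" for h x
    using adj_torus[OF that(1), of x] * torus_U0[OF that(1)] that(2) lin_subspaceD(5)[OF X] unfolding conjug_def by fastforce
  then show "\<forall>h. set h \<subseteq> torus_gens \<longrightarrow> conjug h ` X \<subseteq> X" by blast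
next
  assume *: "\<forall>h. set h \<subseteq> torus_gens \<longrightarrow> conjug h ` X \<subseteq> X"
  have "adj_action chi Y x \<in> X" if Y: "Y \<in> U0" and x: "x \<in> X" for Y x
  proof (rule lin_hom_span_into[OF adj_lin[of x] U.kspace_axioms U.kspace_axioms X])
    show "Y \<in> lin_span (U chi) {word h | h. set h \<subseteq> torus_gens}" using Y U0_span by simp
    fix y assume "y \<in> {word h | h. set h \<subseteq> torus_gens}"
    then obtain h where h: "set h \<subseteq> torus_gens" "y = word h" by auto
    then show "adj_action chi y x \<in> X"
      using adj_torus[OF h(1), of x] * x lin_subspaceD(5)[OF X] unfolding conjug_def by fastforce
  qed (use x lin_subspaceD(5)[OF X] in auto)
  then show "\<forall>Y\<in>U0. adj_action chi Y ` X \<subseteq> X" by blast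
qed

end

section \<open>The quotient by an ideal pair\<close>

text \<open>
  For fixed \<open>c\<close> the first two arguments lift to the inner tensor product. By uniqueness this lift depends
  linearly on \<open>c\<close>, so it lifts once more.
\<close>

lemma tensor3_lift:
  assumes A: "kspace A" and B: "kspace B" and C: "kspace C" and D: "kspace D"
    and F: "\<And>c. c \<in> carrier C \<Longrightarrow> bilinear_map A B D (\<lambda>a b. F a b c)"
      "\<And>a b. a \<in> carrier A \<Longrightarrow> b \<in> carrier B \<Longrightarrow> F a b \<in> lin_hom C D"
  obtains h where "h \<in> lin_hom (tensor (tensor A B) C) D"
    "\<And>a b c. a \<in> carrier A \<Longrightarrow> b \<in> carrier B \<Longrightarrow> c \<in> carrier C \<Longrightarrow>
       h (pure_tensor (tensor A B) C (pure_tensor A B a b) c) = F a b c"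
proof -
  interpret C: kspace C by fact
  interpret D: kspace D by fact
  interpret AB: tensor_spaces A B using A B by (rule tensor_spaces.intro)
  interpret ABC: tensor_spaces "tensor A B" C using AB.tensor_kspace C by (rule tensor_spaces.intro)
  define \<phi> where "\<phi> w c = tensor_lift A B D (\<lambda>a b. F a b c) w" for w c
  have \<phi>: "(\<lambda>w. \<phi> w c) \<in> lin_hom (tensor A B) D"
    "\<And>a b. a \<in> carrier A \<Longrightarrow> b \<in> carrier B \<Longrightarrow> \<phi> (AB.pt a b) c = F a b c" if "c \<in> carrier C" for c
    unfolding \<phi>_def using AB.tensor_lift[OF F(1)[OF that] D] by auto
  note Fl = lin_homD[OF F(2)]
  have bil: "bilinear_map (tensor A B) C D \<phi>"
  proof (rule bilinear_mapI)
    fix w c c' assume w: "w \<in> carrier (tensor A B)" and c: "c \<in> carrier C" "c' \<in> carrier C"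
    have "(\<lambda>w. \<phi> w c \<oplus>\<^bsub>D\<^esub> \<phi> w c') \<in> lin_hom (tensor A B) D"
      by (rule lin_homI) (simp_all add: lin_homD[OF \<phi>(1)[OF c(1)]] lin_homD[OF \<phi>(1)[OF c(2)]] D.smult_r_distr D.a_ac)
    then show "\<phi> w (c \<oplus>\<^bsub>C\<^esub> c') = \<phi> w c \<oplus>\<^bsub>D\<^esub> \<phi> w c'"
      by (rule AB.tensor_hom_eqI[OF \<phi>(1)[OF C.a_closed[OF c]] _ D _ w]) (use c in \<open>simp add: \<phi>(2) Fl\<close>)
  next
    fix e w c assume w: "w \<in> carrier (tensor A B)" and c: "c \<in> carrier C"
    have "(\<lambda>w. e \<odot>\<^bsub>D\<^esub> \<phi> w c) \<in> lin_hom (tensor A B) D"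
      by (rule lin_homI) (simp_all add: lin_homD[OF \<phi>(1)[OF c]] D.smult_r_distr mult.commute flip: D.smult_assoc)
    then show "\<phi> w (e \<odot>\<^bsub>C\<^esub> c) = e \<odot>\<^bsub>D\<^esub> \<phi> w c"
      by (rule AB.tensor_hom_eqI[OF \<phi>(1)[OF C.smult_closed[OF c]] _ D _ w]) (use c in \<open>simp add: \<phi>(2) Fl\<close>)
  qed (simp_all add: lin_homD[OF \<phi>(1)])
  obtain h where h: "h \<in> lin_hom (tensor (tensor A B) C) D"
    "\<And>w c. w \<in> carrier (tensor A B) \<Longrightarrow> c \<in> carrier C \<Longrightarrow> h (ABC.pt w c) = \<phi> w c"
    using ABC.tensor_ex_lift[OF bil D] by blast
  show ?thesis by (rule that[OF h(1)]) (simp add: h(2) \<phi>(2))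
qed

lemma lin_span_carrier_update: "lin_span (A\<lparr>carrier := Y\<rparr>) S = lin_span A S"
proof -
  have "x \<in> lin_span A S" if "x \<in> lin_span (A\<lparr>carrier := Y\<rparr>) S" for x
    using that by induction (auto intro: lin_span.intros)
  moreover have "x \<in> lin_span (A\<lparr>carrier := Y\<rparr>) S" if "x \<in> lin_span A S" for x
    using that
  proof induction
    case zero show ?case using lin_span.zero[of "A\<lparr>carrier := Y\<rparr>" S] by simp
  next
    case (base x) then show ?case by (rule lin_span.base)
  next
    case (add x y) then show ?case using lin_span.add[of x "A\<lparr>carrier := Y\<rparr>" S y] by simp
  next
    case (smult x c) then show ?case using lin_span.smult[of x "A\<lparr>carrier := Y\<rparr>" S c] by simp
  qed
  ultimately show ?thesis by blast
qed

locale ideal_pair = bichar chi for chi :: "int ^ 'i \<Rightarrow> int ^ 'i \<Rightarrow> 'k::field" +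
  fixes P M :: "('i gen list \<Rightarrow>\<^sub>0 'k) set set"
  assumes P: "ideal P (Uplus chi)" and M: "ideal M (Uminus chi)"
    and P_counit: "\<And>p. p \<in> P \<Longrightarrow> counit chi p = 0" and M_counit: "\<And>m. m \<in> M \<Longrightarrow> counit chi m = 0"
begin

sublocale Upl: kalgebra "Uplus chi" by (rule Uplus_kalgebra)
sublocale Umi: kalgebra "Uminus chi" by (rule Uminus_kalgebra)
sublocale Uze: kalgebra "Uzero chi" by (rule Uzero_kalgebra)

abbreviation "QP \<equiv> quot_alg (Uplus chi) P"
abbreviation "QM \<equiv> quot_alg (Uminus chi) M"
abbreviation "TT \<equiv> tensor (tensor QP (Uzero chi)) QM"

lemmas PI = Up_ideal[OF P] and MI = Um_ideal[OF M]
lemmas P_sub = Upl.ideal_lin_subspace[OF P] and M_sub = Umi.ideal_lin_subspace[OF M]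

sublocale QPs: kspace QP by (rule Upl.quot_kspace[OF P_sub])
sublocale QMs: kspace QM by (rule Umi.quot_kspace[OF M_sub])
sublocale T1: tensor_spaces QP "Uzero chi" ..
sublocale T2: tensor_spaces "tensor QP (Uzero chi)" QM ..

definition cp where "cp x = P +>\<^bsub>Uplus chi\<^esub> x"
definition cm where "cm x = M +>\<^bsub>Uminus chi\<^esub> x"

lemma cp_hom: "cp \<in> lin_hom (Uplus chi) QP" and cm_hom: "cm \<in> lin_hom (Uminus chi) QM"
  unfolding cp_def[abs_def] cm_def[abs_def] by (rule Upl.quot_lin_hom[OF P_sub], rule Umi.quot_lin_hom[OF M_sub])

lemma cp_carrier: "X \<in> carrier QP \<longleftrightarrow> (\<exists>x\<in>Up. X = cp x)" and cm_carrier: "Z \<in> carrier QM \<longleftrightarrow> (\<exists>z\<in>Um. Z = cm z)"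
  unfolding Upl.quot_carrier Umi.quot_carrier cp_def cm_def by auto

lemma cp_cases: assumes "X \<in> carrier QP" obtains x where "x \<in> Up" "X = cp x"
  using iffD1[OF cp_carrier assms] by (elim bexE)

lemma cm_cases: assumes "Z \<in> carrier QM" obtains z where "z \<in> Um" "Z = cm z"
  using iffD1[OF cm_carrier assms] by (elim bexE)

lemma cp_closed [simp]: "x \<in> Up \<Longrightarrow> cp x \<in> carrier QP" and cm_closed [simp]: "z \<in> Um \<Longrightarrow> cm z \<in> carrier QM"
  using cp_hom cm_hom by (simp_all add: lin_homD(1))

lemma cp_eq_iff: "x \<in> Up \<Longrightarrow> y \<in> Up \<Longrightarrow> cp x = cp y \<longleftrightarrow> x \<ominus>\<^sub>U y \<in> P"
proof -
  assume xy: "x \<in> Up" "y \<in> Up"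
  have "\<ominus>\<^bsub>Uplus chi\<^esub> y = \<ominus>\<^bsub>U chi\<^esub> y"
    using Upl.smult_minus_one[OF xy(2)] U.smult_minus_one[OF sub_carrier(1)[OF xy(2)]] by simp
  then have "x \<ominus>\<^bsub>Uplus chi\<^esub> y = x \<ominus>\<^sub>U y" by (simp add: a_minus_def)
  then show ?thesis using Upl.coset_eq_iff[OF P_sub xy] by (simp add: cp_def)
qed

lemma cm_eq_iff: "x \<in> Um \<Longrightarrow> y \<in> Um \<Longrightarrow> cm x = cm y \<longleftrightarrow> x \<ominus>\<^sub>U y \<in> M"
proof -
  assume xy: "x \<in> Um" "y \<in> Um"
  have "\<ominus>\<^bsub>Uminus chi\<^esub> y = \<ominus>\<^bsub>U chi\<^esub> y"
    using Umi.smult_minus_one[OF xy(2)] U.smult_minus_one[OF sub_carrier(2)[OF xy(2)]] by simp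
  then have "x \<ominus>\<^bsub>Uminus chi\<^esub> y = x \<ominus>\<^sub>U y" by (simp add: a_minus_def)
  then show ?thesis using Umi.coset_eq_iff[OF M_sub xy] by (simp add: cm_def)
qed

definition pure3 where "pure3 x y z = T2.pt (T1.pt (cp x) y) (cm z)"

lemma pure3_hom:
  "y \<in> U0 \<Longrightarrow> z \<in> Um \<Longrightarrow> (\<lambda>x. pure3 x y z) \<in> lin_hom (Uplus chi) TT"
  "x \<in> Up \<Longrightarrow> z \<in> Um \<Longrightarrow> (\<lambda>y. pure3 x y z) \<in> lin_hom (Uzero chi) TT"
  "x \<in> Up \<Longrightarrow> y \<in> U0 \<Longrightarrow> (\<lambda>z. pure3 x y z) \<in> lin_hom (Uminus chi) TT"
proof -
  have c: "x \<in> Up \<Longrightarrow> cp x \<in> carrier QP" "z \<in> Um \<Longrightarrow> cm z \<in> carrier QM" for x z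
    using cp_carrier cm_carrier by blast+
  have b1: "y \<in> U0 \<Longrightarrow> (\<lambda>X. T1.pt X y) \<in> lin_hom QP (tensor QP (Uzero chi))"
    "X \<in> carrier QP \<Longrightarrow> T1.pt X \<in> lin_hom (Uzero chi) (tensor QP (Uzero chi))" for X y
    using T1.pt_bilinear by (simp_all add: bilinear_map_def)
  have b2: "Z \<in> carrier QM \<Longrightarrow> (\<lambda>W. T2.pt W Z) \<in> lin_hom (tensor QP (Uzero chi)) TT"
    "W \<in> carrier (tensor QP (Uzero chi)) \<Longrightarrow> T2.pt W \<in> lin_hom QM TT" for W Z
    using T2.pt_bilinear by (simp_all add: bilinear_map_def)
  show "y \<in> U0 \<Longrightarrow> z \<in> Um \<Longrightarrow> (\<lambda>x. pure3 x y z) \<in> lin_hom (Uplus chi) TT"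
    unfolding pure3_def by (rule lin_hom_comp[OF lin_hom_comp[OF cp_hom b1(1)] b2(1)[OF c(2)]])
  show "x \<in> Up \<Longrightarrow> z \<in> Um \<Longrightarrow> (\<lambda>y. pure3 x y z) \<in> lin_hom (Uzero chi) TT"
    unfolding pure3_def by (rule lin_hom_comp[OF b1(2)[OF c(1)] b2(1)[OF c(2)]])
  show "x \<in> Up \<Longrightarrow> y \<in> U0 \<Longrightarrow> (\<lambda>z. pure3 x y z) \<in> lin_hom (Uminus chi) TT"
    unfolding pure3_def by (rule lin_hom_comp[OF cm_hom b2(2)[OF T1.pt_closed[OF c(1)]]])
qed

lemma pure3_eqI:
  assumes C: "kspace C" and f: "f \<in> lin_hom TT C" and g: "g \<in> lin_hom TT C"
    and eq: "\<And>x y z. x \<in> Up \<Longrightarrow> y \<in> U0 \<Longrightarrow> z \<in> Um \<Longrightarrow> f (pure3 x y z) = g (pure3 x y z)" and t: "t \<in> carrier TT"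
  shows "f t = g t"
proof (rule T2.tensor_hom_eqI[OF f g C _ t])
  fix W Z assume W: "W \<in> carrier (tensor QP (Uzero chi))" and Z: "Z \<in> carrier QM"
  have l: "(\<lambda>W. T2.pt W Z) \<in> lin_hom (tensor QP (Uzero chi)) TT"
    using T2.pt_bilinear Z by (simp add: bilinear_map_def)
  obtain z where z: "z \<in> Um" "Z = cm z" using Z by (rule cm_cases)
  show "f (T2.pt W Z) = g (T2.pt W Z)"
  proof (rule T1.tensor_hom_eqI[OF lin_hom_comp[OF l f] lin_hom_comp[OF l g] C _ W])
    fix X y assume X: "X \<in> carrier QP" and y: "y \<in> U0"
    from X obtain x where "x \<in> Up" "X = cp x" by (rule cp_cases)
    then show "f (T2.pt (T1.pt X y) Z) = g (T2.pt (T1.pt X y) Z)"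
      using eq[OF _ y z(1)] z(2) by (simp add: pure3_def)
  qed
qed

text \<open>
  Trilinear maps on the three subalgebras are determined by their values on words.
\<close>

lemma triangular_eqI:
  assumes C: "kspace C"
    and G: "\<And>y z. y \<in> U0 \<Longrightarrow> z \<in> Um \<Longrightarrow> (\<lambda>x. G x y z) \<in> lin_hom (Uplus chi) C"
      "\<And>x z. x \<in> Up \<Longrightarrow> z \<in> Um \<Longrightarrow> (\<lambda>y. G x y z) \<in> lin_hom (Uzero chi) C"
      "\<And>x y. x \<in> Up \<Longrightarrow> y \<in> U0 \<Longrightarrow> (\<lambda>z. G x y z) \<in> lin_hom (Uminus chi) C"
    and H: "\<And>y z. y \<in> U0 \<Longrightarrow> z \<in> Um \<Longrightarrow> (\<lambda>x. H x y z) \<in> lin_hom (Uplus chi) C"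
      "\<And>x z. x \<in> Up \<Longrightarrow> z \<in> Um \<Longrightarrow> (\<lambda>y. H x y z) \<in> lin_hom (Uzero chi) C"
      "\<And>x y. x \<in> Up \<Longrightarrow> y \<in> U0 \<Longrightarrow> (\<lambda>z. H x y z) \<in> lin_hom (Uminus chi) C"
    and eq: "\<And>u h w. set h \<subseteq> torus_gens \<Longrightarrow> G (ew u) (word h) (fw w) = H (ew u) (word h) (fw w)"
    and xyz: "x \<in> Up" "y \<in> U0" "z \<in> Um"
  shows "G x y z = H x y z"
proof -
  let ?T = "{word h | h. set h \<subseteq> torus_gens}"
  have sp: "lin_span (Uplus chi) (range ew) = Up" "lin_span (Uminus chi) (range fw) = Um" "lin_span (Uzero chi) ?T = U0"
    using Up_span Um_span U0_span by (simp_all only: Uplus_def Uminus_def Uzero_def lin_span_carrier_update)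
  have T: "?T \<subseteq> U0" using torus_U0 by blast
  have 1: "G (ew u) (word h) z = H (ew u) (word h) z" if "set h \<subseteq> torus_gens" "z \<in> Um" for u h z
    by (rule lin_hom_eq_on_span[OF G(3)[OF ew_Up torus_U0[OF that(1)]] H(3)[OF ew_Up torus_U0[OF that(1)]] Umi.kspace_axioms C, of "range fw"])
      (use that eq sp in auto)
  have 2: "G (ew u) y z = H (ew u) y z" if "y \<in> U0" "z \<in> Um" for u y z
    by (rule lin_hom_eq_on_span[OF G(2)[OF ew_Up that(2)] H(2)[OF ew_Up that(2)] Uze.kspace_axioms C T])
      (use that 1 sp in auto)
  show ?thesis
    by (rule lin_hom_eq_on_span[OF G(1)[OF xyz(2,3)] H(1)[OF xyz(2,3)] Upl.kspace_axioms C, of "range ew"])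
      (use xyz 2 sp in auto)
qed

text \<open>
  The inverse of the multiplication map, before passing to quotients: it reads off the factors from the
  coordinates.
\<close>

definition split3 where
  "split3 x = lin_ext TT (\<lambda>(u, a, b, w). pure3 (ew u) (tmon a b) (fw w)) (coords x)"

lemma pure3_closed: "x \<in> Up \<Longrightarrow> y \<in> U0 \<Longrightarrow> z \<in> Um \<Longrightarrow> pure3 x y z \<in> carrier TT"
  by (rule lin_homD(1)[OF pure3_hom(1)])

lemma split3_hom: "split3 \<in> lin_hom (U chi) TT"
  unfolding split3_def[abs_def]
  by (rule lin_hom_comp[OF coords_hom]) (rule T2.T.lin_ext_hom, auto intro!: pure3_closed tmon_U0)

lemma triple_hom:
  assumes "f \<in> lin_hom (U chi) C"
  shows "y \<in> U0 \<Longrightarrow> z \<in> Um \<Longrightarrow> (\<lambda>x. f (x \<cdot> y \<cdot> z)) \<in> lin_hom (Uplus chi) C"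
    "x \<in> Up \<Longrightarrow> z \<in> Um \<Longrightarrow> (\<lambda>y. f (x \<cdot> y \<cdot> z)) \<in> lin_hom (Uzero chi) C"
    "x \<in> Up \<Longrightarrow> y \<in> U0 \<Longrightarrow> (\<lambda>z. f (x \<cdot> y \<cdot> z)) \<in> lin_hom (Uminus chi) C"
  by (rule lin_homI; simp add: lin_homD[OF assms] U.l_distr U.r_distr U.smult_mult_l U.smult_mult_r)+

lemma split3_triple:
  assumes "x \<in> Up" "y \<in> U0" "z \<in> Um"
  shows "split3 (x \<cdot> y \<cdot> z) = pure3 x y z"
proof (rule triangular_eqI[OF T2.tensor_kspace triple_hom[OF split3_hom] pure3_hom _ assms])
  fix u w :: "'i list" and h :: "'i gen list" assume h: "set h \<subseteq> torus_gens"
  have c: "pure3 (ew u) (word h) (fw w) \<in> carrier TT" by (rule pure3_closed[OF ew_Up torus_U0[OF h] fw_Um])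
  then show "split3 (ew u \<cdot> word h \<cdot> fw w) = pure3 (ew u) (word h) (fw w)"
    unfolding pbw_mem[OF h] split3_def coords_pbw[OF h] by (subst T2.T.lin_ext_single) (auto simp: tmon_degs h)
qed

abbreviation "N0 \<equiv> PUU P <+>\<^bsub>U chi\<^esub> UUM M"

lemma N0_subspace: "lin_subspace (U chi) N0"
  by (rule sum_subspace[OF PUU_subspace[OF PI(1)] UUM_subspace[OF MI(1)]])

lemma split3_N0:
  assumes "x \<in> N0" shows "split3 x = \<zero>\<^bsub>TT\<^esub>"
proof -
  let ?K = "{x \<in> carrier (U chi). split3 x \<in> {\<zero>\<^bsub>TT\<^esub>}}"
  have "lin_subspace TT {\<zero>\<^bsub>TT\<^esub>}" by (rule lin_subspaceI) auto
  from lin_hom_preimage[OF split3_hom U.kspace_axioms T2.tensor_kspace this] have K: "lin_subspace (U chi) ?K" .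
  have cz: "p \<in> P \<Longrightarrow> cp p = cp \<zero>\<^sub>U" "m \<in> M \<Longrightarrow> cm m = cm \<zero>\<^sub>U" for p m
    using PI(1) MI(1) lin_subspaceD(2)[OF Up_subspace] lin_subspaceD(2)[OF Um_subspace]
    by (subst cp_eq_iff cm_eq_iff; auto simp: a_minus_def)+
  have pz: "pure3 p y z = \<zero>\<^bsub>TT\<^esub>" if "p \<in> P" "y \<in> U0" "z \<in> Um" for p y z
    using lin_hom_zero[OF pure3_hom(1)[OF that(2,3)] Upl.kspace_axioms T2.tensor_kspace] cz(1)[OF that(1)]
    by (simp add: pure3_def)
  have mz: "pure3 x y m = \<zero>\<^bsub>TT\<^esub>" if "x \<in> Up" "y \<in> U0" "m \<in> M" for x y m
    using lin_hom_zero[OF pure3_hom(3)[OF that(1,2)] Umi.kspace_axioms T2.tensor_kspace] cz(2)[OF that(3)]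
    by (simp add: pure3_def)
  have "PUU P \<subseteq> ?K"
  proof (rule subspace_prod_least[OF K])
    fix x y z assume *: "x \<in> P" "y \<in> U0" "z \<in> Um"
    then have "x \<in> Up" using PI(1) by auto
    then show "x \<cdot> y \<cdot> z \<in> ?K" using * by (simp add: split3_triple pz)
  qed
  moreover have "UUM M \<subseteq> ?K"
  proof (rule subspace_prod_least[OF K])
    fix x y z assume *: "x \<in> Up" "y \<in> U0" "z \<in> M"
    then have "z \<in> Um" using MI(1) by auto
    then show "x \<cdot> y \<cdot> z \<in> ?K" using * by (simp add: split3_triple mz)
  qed
  ultimately have "N0 \<subseteq> ?K" by (rule sum_least[OF K])
  then show ?thesis using assms by auto
qed

text \<open>
  Multiplication is well defined on classes modulo \<open>P\<close> and \<open>M\<close>, because changing representatives changes the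
  product by an element of \<open>P U\<^sup>0 U\<^sup>- + U\<^sup>+ U\<^sup>0 M\<close>. This is stated for subspaces \<open>N\<close> because the
  case in which \<open>N\<close> equals this sum is what identifies the kernel.
\<close>

lemma mult_map:
  assumes N: "lin_subspace (U chi) N" and sub: "N0 \<subseteq> N"
  obtains k where "k \<in> lin_hom TT (quot_alg (U chi) N)"
    "\<And>x y z. x \<in> Up \<Longrightarrow> y \<in> U0 \<Longrightarrow> z \<in> Um \<Longrightarrow> k (pure3 x y z) = N +>\<^bsub>U chi\<^esub> (x \<cdot> y \<cdot> z)"
proof -
  let ?Q = "quot_alg (U chi) N"
  let ?\<pi> = "\<lambda>x. N +>\<^bsub>U chi\<^esub> x"
  note \<pi> = U.quot_lin_hom[OF N]
  have Q: "kspace ?Q" by (rule U.quot_kspace[OF N])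
  have PN: "PUU P \<subseteq> N" and MN: "UUM M \<subseteq> N"
    using sub sum_supset[OF PUU_subspace[OF PI(1)] UUM_subspace[OF MI(1)]] by auto
  define rp where "rp X = (SOME x. x \<in> Up \<and> cp x = X)" for X
  define rm where "rm Z = (SOME z. z \<in> Um \<and> cm z = Z)" for Z
  define F where "F X y Z = ?\<pi> (rp X \<cdot> y \<cdot> rm Z)" for X y Z
  have rp: "rp (cp x) \<in> Up" "cp (rp (cp x)) = cp x" if "x \<in> Up" for x
    using someI[of "\<lambda>x'. x' \<in> Up \<and> cp x' = cp x" x] that by (auto simp: rp_def)
  have rm: "rm (cm z) \<in> Um" "cm (rm (cm z)) = cm z" if "z \<in> Um" for z
    using someI[of "\<lambda>z'. z' \<in> Um \<and> cm z' = cm z" z] that by (auto simp: rm_def)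
  have F: "F (cp x) y (cm z) = ?\<pi> (x \<cdot> y \<cdot> z)" if xyz: "x \<in> Up" "y \<in> U0" "z \<in> Um" for x y z
  proof -
    let ?x = "rp (cp x)" and ?z = "rm (cm z)"
    note r = rp[OF xyz(1)] rm[OF xyz(3)]
    have dx: "?x \<ominus>\<^sub>U x \<in> P" using cp_eq_iff[OF r(1) xyz(1)] r(2) by simp
    have dz: "?z \<ominus>\<^sub>U z \<in> M" using cm_eq_iff[OF r(3) xyz(3)] r(4) by simp
    \<comment> \<open>the two representatives are changed one after the other\<close>
    have "?x \<cdot> y \<cdot> ?z \<ominus>\<^sub>U x \<cdot> y \<cdot> z
      = (?x \<ominus>\<^sub>U x) \<cdot> y \<cdot> ?z \<oplus>\<^sub>U x \<cdot> y \<cdot> (?z \<ominus>\<^sub>U z)"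
      using xyz r(1,3) by (simp add: a_minus_def U.l_distr U.r_distr U.l_minus U.r_minus U.a_assoc U.r_neg1)
    also have "\<dots> \<in> N"
      by (rule lin_subspaceD(3)[OF N])
        (use subspace_prodI[OF dx xyz(2) r(3), of "U chi"] subspace_prodI[OF xyz(1,2) dz, of "U chi"] PN MN in auto)
    finally show ?thesis unfolding F_def using xyz r(1,3) by (subst U.coset_eq_iff[OF N]) auto
  qed
  note th = triple_hom[OF \<pi>]
  have Fh: "bilinear_map QP (Uzero chi) ?Q (\<lambda>X y. F X y Z)" if Z: "Z \<in> carrier QM" for Z
  proof -
    obtain z where z: "z \<in> Um" "Z = cm z" using Z by (rule cm_cases)
    show ?thesis
    proof (rule bilinear_mapI)
      fix X y assume X: "X \<in> carrier QP" and y: "y \<in> carrier (Uzero chi)"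
      from X obtain x where x: "x \<in> Up" "X = cp x" by (rule cp_cases)
      show "F X y Z \<in> carrier ?Q" unfolding x(2) z(2) F[OF x(1) y z(1)] by (rule lin_homD(1)[OF th(1)[OF y z(1)] x(1)])
      { fix X' assume "X' \<in> carrier QP"
        then obtain x' where x': "x' \<in> Up" "X' = cp x'" by (rule cp_cases)
        show "F (X \<oplus>\<^bsub>QP\<^esub> X') y Z = F X y Z \<oplus>\<^bsub>?Q\<^esub> F X' y Z"
          unfolding x(2) x'(2) z(2) lin_homD(2)[OF cp_hom x(1) x'(1), symmetric]
          using F x(1) x'(1) y z(1) lin_homD(2)[OF th(1)[OF y z(1)] x(1) x'(1)] Upl.a_closed[OF x(1) x'(1)] by simp }
      { fix y' assume y': "y' \<in> carrier (Uzero chi)"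
        show "F X (y \<oplus>\<^bsub>Uzero chi\<^esub> y') Z = F X y Z \<oplus>\<^bsub>?Q\<^esub> F X y' Z"
          unfolding x(2) z(2)
          using F x(1) y y' z(1) lin_homD(2)[OF th(2)[OF x(1) z(1)] y y'] Uze.a_closed[OF y y'] by simp }
      { fix c
        show "F (c \<odot>\<^bsub>QP\<^esub> X) y Z = c \<odot>\<^bsub>?Q\<^esub> F X y Z"
          unfolding x(2) z(2) lin_homD(3)[OF cp_hom x(1), symmetric]
          using F x(1) y z(1) lin_homD(3)[OF th(1)[OF y z(1)] x(1)] Upl.smult_closed[OF x(1)] by simp
        show "F X (c \<odot>\<^bsub>Uzero chi\<^esub> y) Z = c \<odot>\<^bsub>?Q\<^esub> F X y Z"
          unfolding x(2) z(2)
          using F x(1) y z(1) lin_homD(3)[OF th(2)[OF x(1) z(1)] y] Uze.smult_closed[OF y] by simp }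
    qed
  qed
  have Fl: "F X y \<in> lin_hom QM ?Q" if X: "X \<in> carrier QP" and y: "y \<in> carrier (Uzero chi)" for X y
  proof -
    obtain x where x: "x \<in> Up" "X = cp x" using X by (rule cp_cases)
    show ?thesis
    proof (rule lin_homI)
      fix Z assume "Z \<in> carrier QM"
      then obtain z where z: "z \<in> Um" "Z = cm z" by (rule cm_cases)
      show "F X y Z \<in> carrier ?Q" unfolding x(2) z(2) F[OF x(1) y z(1)] by (rule lin_homD(1)[OF th(1)[OF y z(1)] x(1)])
      { fix Z' assume "Z' \<in> carrier QM"
        then obtain z' where z': "z' \<in> Um" "Z' = cm z'" by (rule cm_cases)
        show "F X y (Z \<oplus>\<^bsub>QM\<^esub> Z') = F X y Z \<oplus>\<^bsub>?Q\<^esub> F X y Z'"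
          unfolding x(2) z(2) z'(2) lin_homD(2)[OF cm_hom z(1) z'(1), symmetric]
          using F x(1) y z(1) z'(1) lin_homD(2)[OF th(3)[OF x(1) y] z(1) z'(1)] Umi.a_closed[OF z(1) z'(1)] by simp }
      { fix c
        show "F X y (c \<odot>\<^bsub>QM\<^esub> Z) = c \<odot>\<^bsub>?Q\<^esub> F X y Z"
          unfolding x(2) z(2) lin_homD(3)[OF cm_hom z(1), symmetric]
          using F x(1) y z(1) lin_homD(3)[OF th(3)[OF x(1) y] z(1)] Umi.smult_closed[OF z(1)] by simp }
    qed
  qed
  obtain k where k: "k \<in> lin_hom TT ?Q"
    "\<And>X y Z. X \<in> carrier QP \<Longrightarrow> y \<in> carrier (Uzero chi) \<Longrightarrow> Z \<in> carrier QM \<Longrightarrow> k (T2.pt (T1.pt X y) Z) = F X y Z"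
    using tensor3_lift[OF QPs.kspace_axioms Uze.kspace_axioms QMs.kspace_axioms Q Fh Fl] by blast
  have "k (pure3 x y z) = N +>\<^bsub>U chi\<^esub> (x \<cdot> y \<cdot> z)" if "x \<in> Up" "y \<in> U0" "z \<in> Um" for x y z
    unfolding pure3_def F[OF that, symmetric] by (rule k(2)) (use that in simp_all)
  with k(1) show ?thesis using that by blast
qed

lemma mult_map_split3:
  assumes N: "lin_subspace (U chi) N" and k: "k \<in> lin_hom TT (quot_alg (U chi) N)"
    "\<And>x y z. x \<in> Up \<Longrightarrow> y \<in> U0 \<Longrightarrow> z \<in> Um \<Longrightarrow> k (pure3 x y z) = N +>\<^bsub>U chi\<^esub> (x \<cdot> y \<cdot> z)"
    and x: "x \<in> carrier (U chi)"
  shows "k (split3 x) = N +>\<^bsub>U chi\<^esub> x"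
proof (rule lin_hom_eq_on_span[OF lin_hom_comp[OF split3_hom k(1)] U.quot_lin_hom[OF N] U.kspace_axioms U.quot_kspace[OF N] pbw_carrier])
  show "x \<in> lin_span (U chi) pbw" using x pbw_span by simp
  fix y assume "y \<in> pbw"
  then obtain u h w where y: "y = word (map GE u @ h @ map GF w)" and h: "set h \<subseteq> torus_gens" by (auto simp: pbw_def)
  show "k (split3 y) = N +>\<^bsub>U chi\<^esub> y"
    unfolding y pbw_mem[OF h, symmetric] using h by (simp add: split3_triple k(2) torus_U0)
qed

lemma gen_ideal_ideal:
  assumes X: "X \<subseteq> carrier (U chi)" shows "ideal (gen_ideal X) (U chi)"
proof (rule U.idealI_subspace)
  show S: "lin_subspace (U chi) (gen_ideal X)" by (rule prod_subspace) (use X in auto)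
  fix a x assume a: "a \<in> carrier (U chi)" and x: "x \<in> gen_ideal X"
  have l: "(\<lambda>x. a \<cdot> x) \<in> lin_hom (U chi) (U chi)" "(\<lambda>x. x \<cdot> a) \<in> lin_hom (U chi) (U chi)"
    using a by (intro lin_homI; simp add: U.r_distr U.l_distr U.smult_mult_r U.smult_mult_l)+
  have "gen_ideal X \<subseteq> {x \<in> carrier (U chi). a \<cdot> x \<in> gen_ideal X}"
  proof (rule subspace_prod_least[OF lin_hom_preimage[OF l(1) U.kspace_axioms U.kspace_axioms S]])
    fix p q r assume *: "p \<in> carrier (U chi)" "q \<in> X" "r \<in> carrier (U chi)"
    then have "(a \<cdot> p) \<cdot> q \<cdot> r \<in> gen_ideal X" using a by (intro subspace_prodI) auto
    then show "p \<cdot> q \<cdot> r \<in> {x \<in> carrier (U chi). a \<cdot> x \<in> gen_ideal X}"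
      using * a X by (simp add: U.m_assoc subset_iff)
  qed
  then show "a \<cdot> x \<in> gen_ideal X" using x by auto
  have "gen_ideal X \<subseteq> {x \<in> carrier (U chi). x \<cdot> a \<in> gen_ideal X}"
  proof (rule subspace_prod_least[OF lin_hom_preimage[OF l(2) U.kspace_axioms U.kspace_axioms S]])
    fix p q r assume *: "p \<in> carrier (U chi)" "q \<in> X" "r \<in> carrier (U chi)"
    then have "p \<cdot> q \<cdot> (r \<cdot> a) \<in> gen_ideal X" using a by (intro subspace_prodI) auto
    then show "p \<cdot> q \<cdot> r \<in> {x \<in> carrier (U chi). x \<cdot> a \<in> gen_ideal X}"
      using * a X by (simp add: U.m_assoc subset_iff)
  qed
  then show "x \<cdot> a \<in> gen_ideal X" using x by auto
qed

lemma gen_ideal_superset: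
  assumes "X \<subseteq> carrier (U chi)" shows "X \<subseteq> gen_ideal X"
proof
  fix x assume x: "x \<in> X"
  then have "\<one>\<^sub>U \<cdot> x \<cdot> \<one>\<^sub>U \<in> gen_ideal X" by (intro subspace_prodI) auto
  then show "x \<in> gen_ideal X" using x assms by (simp add: subset_iff)
qed

lemma gen_ideal_least:
  assumes "ideal W (U chi)" "X \<subseteq> W" shows "gen_ideal X \<subseteq> W"
proof (rule subspace_prod_least[OF U.ideal_lin_subspace[OF assms(1)]])
  fix x y z assume "x \<in> carrier (U chi)" "y \<in> X" "z \<in> carrier (U chi)"
  then show "x \<cdot> y \<cdot> z \<in> W"
    using assms(2) by (intro ideal.I_r_closed[OF assms(1)] ideal.I_l_closed[OF assms(1)]) auto
qed

abbreviation "J0 \<equiv> gen_ideal P <+>\<^bsub>U chi\<^esub> gen_ideal M"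

lemma PM_carrier: "P \<subseteq> carrier (U chi)" "M \<subseteq> carrier (U chi)"
  using PI(1) MI(1) by auto

lemmas J_sub = U.ideal_lin_subspace[OF gen_ideal_ideal[OF PM_carrier(1)]] U.ideal_lin_subspace[OF gen_ideal_ideal[OF PM_carrier(2)]]

lemma genideal_eq: "Idl\<^bsub>U chi\<^esub> (P <+>\<^bsub>U chi\<^esub> M) = J0"
proof
  have S: "P <+>\<^bsub>U chi\<^esub> M \<subseteq> carrier (U chi)"
    using lin_subspaceD(1)[OF sum_subspace[OF PI(2) MI(2)]] .
  have id: "ideal (Idl\<^bsub>U chi\<^esub> (P <+>\<^bsub>U chi\<^esub> M)) (U chi)" by (rule U.genideal_ideal[OF S])
  have sup: "P <+>\<^bsub>U chi\<^esub> M \<subseteq> Idl\<^bsub>U chi\<^esub> (P <+>\<^bsub>U chi\<^esub> M)" by (rule U.genideal_self[OF S])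
  show "J0 \<subseteq> Idl\<^bsub>U chi\<^esub> (P <+>\<^bsub>U chi\<^esub> M)"
    by (rule sum_least[OF U.ideal_lin_subspace[OF id] gen_ideal_least[OF id] gen_ideal_least[OF id]])
      (use sup sum_supset[OF PI(2) MI(2)] in blast)+
  have "ideal J0 (U chi)"
    by (rule U.add_ideals[OF gen_ideal_ideal[OF PM_carrier(1)] gen_ideal_ideal[OF PM_carrier(2)]])
  moreover have "P <+>\<^bsub>U chi\<^esub> M \<subseteq> J0"
    by (rule sum_least[OF sum_subspace[OF J_sub]])
      (use gen_ideal_superset[OF PM_carrier(1)] gen_ideal_superset[OF PM_carrier(2)] sum_supset[OF J_sub] in blast)+
  ultimately show "Idl\<^bsub>U chi\<^esub> (P <+>\<^bsub>U chi\<^esub> M) \<subseteq> J0" by (rule U.genideal_minimal)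
qed

lemma PUU_gen_ideal: "PUU P \<subseteq> gen_ideal P" and UUM_gen_ideal: "UUM M \<subseteq> gen_ideal M"
proof -
  show "PUU P \<subseteq> gen_ideal P"
  proof (rule PUU_least[OF J_sub(1) PI(1)])
    fix p u assume "p \<in> P" "u \<in> carrier (U chi)"
    then show "p \<cdot> u \<in> gen_ideal P"
      using gen_ideal_superset[OF PM_carrier(1)] ideal.I_r_closed[OF gen_ideal_ideal[OF PM_carrier(1)]] by blast
  qed
  show "UUM M \<subseteq> gen_ideal M"
  proof (rule subspace_prod_least[OF J_sub(2)])
    fix x y z assume "x \<in> Up" "y \<in> U0" "z \<in> M"
    then show "x \<cdot> y \<cdot> z \<in> gen_ideal M"
      using gen_ideal_superset[OF PM_carrier(2)] ideal.I_l_closed[OF gen_ideal_ideal[OF PM_carrier(2)], of z "x \<cdot> y"] by auto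
  qed
qed

lemma N0_J0: "N0 \<subseteq> J0"
  by (rule sum_least[OF sum_subspace[OF J_sub]])
    (use PUU_gen_ideal UUM_gen_ideal sum_supset[OF J_sub] in blast)+

text \<open>
  Let \<open>k\<^sub>N\<close> be the multiplication map into \<open>U/N\<close>. It turns \<open>split3\<close> into the projection onto \<open>U/N\<close>. If the map
  into \<open>U/J\<close> is injective and \<open>x \<in> J\<close>, then \<open>split3 x = 0\<close>, and \<open>k\<^sub>N\<close> for \<open>N = P U\<^sup>0 U\<^sup>- + U\<^sup>+ U\<^sup>0 M\<close> shows \<open>x \<in> N\<close>.
  Conversely, \<open>split3\<close> kills \<open>N\<close>; if \<open>J = N\<close> it therefore descends to an inverse on \<open>U/J\<close>.
\<close>

lemma mult_induces_iso_iff: "mult_induces_iso chi P M \<longleftrightarrow> J0 = N0"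
proof -
  let ?Q = "quot_alg (U chi) J0"
  note JS = sum_subspace[OF J_sub]
  have Q: "kspace ?Q" by (rule U.quot_kspace[OF JS])
  have C1: "mult_induces_iso chi P M \<longleftrightarrow> (\<exists>h \<in> lin_hom TT ?Q. bij_betw h (carrier TT) (carrier ?Q) \<and>
     (\<forall>x\<in>Up. \<forall>y\<in>U0. \<forall>z\<in>Um. h (pure3 x y z) = J0 +>\<^bsub>U chi\<^esub> (x \<cdot> y \<cdot> z)))"
    unfolding mult_induces_iso_def Let_def genideal_eq pure3_def cp_def cm_def ..
  show ?thesis
  proof
    assume "mult_induces_iso chi P M"
    then obtain h where h: "h \<in> lin_hom TT ?Q" "bij_betw h (carrier TT) (carrier ?Q)"
      "\<And>x y z. x \<in> Up \<Longrightarrow> y \<in> U0 \<Longrightarrow> z \<in> Um \<Longrightarrow> h (pure3 x y z) = J0 +>\<^bsub>U chi\<^esub> (x \<cdot> y \<cdot> z)"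
      unfolding C1 by blast
    obtain k where k: "k \<in> lin_hom TT (quot_alg (U chi) N0)"
      "\<And>x y z. x \<in> Up \<Longrightarrow> y \<in> U0 \<Longrightarrow> z \<in> Um \<Longrightarrow> k (pure3 x y z) = N0 +>\<^bsub>U chi\<^esub> (x \<cdot> y \<cdot> z)"
      using mult_map[OF N0_subspace subset_refl] by blast
    have "J0 \<subseteq> N0"
    proof
      fix x assume x: "x \<in> J0"
      then have xc: "x \<in> carrier (U chi)" by (rule lin_subspaceD(5)[OF JS])
      have "h (split3 x) = J0 +>\<^bsub>U chi\<^esub> x" by (rule mult_map_split3[OF JS h(1,3) xc])
      also have "\<dots> = \<zero>\<^bsub>?Q\<^esub>" using U.quot_zero_iff[OF JS xc] x by blast
      also have "\<dots> = h \<zero>\<^bsub>TT\<^esub>" using lin_hom_zero[OF h(1) T2.tensor_kspace Q] by simp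
      finally have "split3 x = \<zero>\<^bsub>TT\<^esub>"
        using bij_betw_imp_inj_on[OF h(2)] lin_homD(1)[OF split3_hom xc] T2.T.zero_closed by (auto dest: inj_onD)
      then have "N0 +>\<^bsub>U chi\<^esub> x = \<zero>\<^bsub>quot_alg (U chi) N0\<^esub>"
        using mult_map_split3[OF N0_subspace k xc] lin_hom_zero[OF k(1) T2.tensor_kspace U.quot_kspace[OF N0_subspace]] by simp
      then show "x \<in> N0" using U.quot_zero_iff[OF N0_subspace xc] by simp
    qed
    then show "J0 = N0" using N0_J0 by blast
  next
    assume eq: "J0 = N0"
    obtain k where k: "k \<in> lin_hom TT ?Q"
      "\<And>x y z. x \<in> Up \<Longrightarrow> y \<in> U0 \<Longrightarrow> z \<in> Um \<Longrightarrow> k (pure3 x y z) = J0 +>\<^bsub>U chi\<^esub> (x \<cdot> y \<cdot> z)"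
      using mult_map[OF JS N0_J0] by blast
    have z: "split3 x = \<zero>\<^bsub>TT\<^esub>" if "x \<in> J0" for x using split3_N0 that unfolding eq by blast
    obtain g where g: "g \<in> lin_hom ?Q TT" "\<And>x. x \<in> carrier (U chi) \<Longrightarrow> g (J0 +>\<^bsub>U chi\<^esub> x) = split3 x"
      using U.quot_factor[OF JS split3_hom T2.tensor_kspace z] by blast
    have gk: "g (k t) = t" if "t \<in> carrier TT" for t
      by (rule pure3_eqI[OF T2.tensor_kspace lin_hom_comp[OF k(1) g(1)] lin_hom_id _ that])
        (simp add: k(2) g(2) split3_triple)
    have kg: "k (g q) = q" if q: "q \<in> carrier ?Q" for q
    proof -
      obtain x where "q = J0 +>\<^bsub>U chi\<^esub> x" "x \<in> carrier (U chi)" using q unfolding U.quot_carrier by (rule imageE)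
      then show ?thesis using g(2) mult_map_split3[OF JS k] by simp
    qed
    have "bij_betw k (carrier TT) (carrier ?Q)"
      by (rule bij_betw_byWitness[where f' = g]) (use gk kg lin_homD(1)[OF k(1)] lin_homD(1)[OF g(1)] in auto)
    then show "mult_induces_iso chi P M" unfolding C1 using k by blast
  qed
qed

abbreviation "P' \<equiv> phi4 chi ` M"
abbreviation "M' \<equiv> phi4 chi ` P"

lemma phi4_PUU: "phi4 chi ` PUU P = UUM M'" "phi4 chi ` UUM M = PUU P'"
  using phi4_prod[OF PM_carrier(1) lin_subspaceD(1)[OF U0_subspace] lin_subspaceD(1)[OF Um_subspace]]
    phi4_prod[OF lin_subspaceD(1)[OF Up_subspace] lin_subspaceD(1)[OF U0_subspace] PM_carrier(2)]
  by (simp_all only: phi4_U0 phi4_Um phi4_Up)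

lemma P'_ideal: "ideal P' (Uplus chi)"
  by (rule phi4_Um_ideal[OF M])

text \<open>
  For \<open>M\<close> the statement about \<open>P\<close> is applied to the pair \<open>(phi4 M, phi4 P)\<close>, whose roles in the
  decomposition are interchanged by the antiautomorphism.
\<close>

lemma decomposition_imp_stable: "J0 = N0 \<Longrightarrow> stable P \<and> stable P'"
proof
  assume eq: "J0 = N0"
  have "gen_ideal P \<subseteq> N0" using sum_supset(1)[OF J_sub] eq by simp
  then show "stable P" by (intro stable_if_gen_ideal[OF P MI(1)] M_counit)
  have "gen_ideal M \<subseteq> N0" using sum_supset(2)[OF J_sub] eq by simp
  then have "phi4 chi ` gen_ideal M \<subseteq> phi4 chi ` N0" by (rule image_mono)
  also have "phi4 chi ` gen_ideal M = gen_ideal P'"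
    using phi4_prod[OF subset_refl PM_carrier(2) subset_refl] by (simp only: phi4_carrier)
  also have "phi4 chi ` N0 = UUM M' <+>\<^bsub>U chi\<^esub> PUU P'"
    using phi4_sum[OF lin_subspaceD(1)[OF PUU_subspace[OF PI(1)]] lin_subspaceD(1)[OF UUM_subspace[OF MI(1)]]]
    by (simp only: phi4_PUU)
  also have "\<dots> = PUU P' <+>\<^bsub>U chi\<^esub> UUM M'"
    by (rule sum_comm[OF lin_subspaceD(1)[OF UUM_subspace[OF phi4_Up_Um[OF PI(1)]]]
          lin_subspaceD(1)[OF PUU_subspace[OF Up_ideal(1)[OF P'_ideal]]]])
  finally have *: "gen_ideal P' \<subseteq> PUU P' <+>\<^bsub>U chi\<^esub> UUM M'" .
  have "counit chi m = 0" if m: "m \<in> M'" for m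
  proof -
    obtain p where "m = phi4 chi p" "p \<in> P" using m by (rule imageE)
    then show ?thesis using P_counit counit_phi4[of p] PM_carrier(1) by auto
  qed
  then show "stable P'" by (intro stable_if_gen_ideal[OF P'_ideal phi4_Up_Um[OF PI(1)] _ *])
qed

lemma stable_imp_ideals: "stable P \<Longrightarrow> stable P' \<Longrightarrow> ideal (PUU P) (U chi) \<and> ideal (UUM M) (U chi)"
proof
  show "stable P \<Longrightarrow> ideal (PUU P) (U chi)" by (rule PUU_ideal[OF P])
  assume "stable P'"
  from phi4_ideal[OF PUU_ideal[OF P'_ideal this]]
  have "ideal (phi4 chi ` phi4 chi ` UUM M) (U chi)" by (simp only: phi4_PUU)
  then show "ideal (UUM M) (U chi)"
    by (simp only: phi4_image_image[OF lin_subspaceD(1)[OF UUM_subspace[OF MI(1)]]])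
qed

lemma ideals_imp_decomposition:
  assumes "ideal (PUU P) (U chi)" "ideal (UUM M) (U chi)" shows "J0 = N0"
proof -
  have "P \<subseteq> PUU P"
  proof
    fix p assume p: "p \<in> P"
    show "p \<in> PUU P" using PUU_mult[OF P p U.one_closed] p PM_carrier(1) by auto
  qed
  then have "gen_ideal P \<subseteq> PUU P" by (rule gen_ideal_least[OF assms(1)])
  moreover have "M \<subseteq> UUM M"
  proof
    fix m assume m: "m \<in> M"
    then have "\<one>\<^sub>U \<cdot> \<one>\<^sub>U \<cdot> m \<in> UUM M" by (intro subspace_prodI) auto
    then show "m \<in> UUM M" using m PM_carrier(2) by auto
  qed
  then have "gen_ideal M \<subseteq> UUM M" by (rule gen_ideal_least[OF assms(2)])
  ultimately have "gen_ideal P = PUU P" "gen_ideal M = UUM M" using PUU_gen_ideal UUM_gen_ideal by blast+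
  then show ?thesis by simp
qed

lemma closure_conditions_iff_stable:
  "(\<forall>X\<in>U0. \<forall>i. adj_action chi X ` P \<subseteq> P \<and> adj_action chi X ` M \<subseteq> M \<and>
       derivK chi i ` P \<subseteq> P \<and> derivL chi i ` P \<subseteq> P \<and>
       derivK chi i ` phi4 chi ` M \<subseteq> phi4 chi ` M \<and> derivL chi i ` phi4 chi ` M \<subseteq> phi4 chi ` M)
   \<longleftrightarrow> stable P \<and> stable P'"
proof -
  have M_iff: "(\<forall>h. set h \<subseteq> torus_gens \<longrightarrow> conjug h ` M \<subseteq> M) \<longleftrightarrow> (\<forall>h. set h \<subseteq> torus_gens \<longrightarrow> conjug h ` P' \<subseteq> P')"
  proof
    show "\<forall>h. set h \<subseteq> torus_gens \<longrightarrow> conjug h ` M \<subseteq> M \<Longrightarrow> \<forall>h. set h \<subseteq> torus_gens \<longrightarrow> conjug h ` P' \<subseteq> P'"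
      using phi4_conjug_stable[OF PM_carrier(2)] by blast
    have P'c: "P' \<subseteq> carrier (U chi)" by (rule lin_subspaceD(1)[OF Up_ideal(2)[OF P'_ideal]])
    show "\<forall>h. set h \<subseteq> torus_gens \<longrightarrow> conjug h ` P' \<subseteq> P' \<Longrightarrow> \<forall>h. set h \<subseteq> torus_gens \<longrightarrow> conjug h ` M \<subseteq> M"
      using phi4_conjug_stable[OF P'c] unfolding phi4_image_image[OF PM_carrier(2)] by blast
  qed
  have split: "(\<forall>X\<in>S. \<forall>i. A X \<and> B X \<and> a i \<and> b i \<and> c i \<and> d i) \<longleftrightarrow>
      ((\<forall>X\<in>S. A X) \<and> (\<forall>i. a i \<and> b i)) \<and> ((\<forall>X\<in>S. B X) \<and> (\<forall>i. c i \<and> d i))"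
    if "x \<in> S" for x S and A B :: "_ \<Rightarrow> bool" and a b c d :: "'i \<Rightarrow> bool"
    using that by blast
  show ?thesis
    by (simp only: split[OF sub_one(3)] adj_stable_iff[OF PI(2)] adj_stable_iff[OF MI(2)] M_iff deriv_eq stable_def)
qed

end

theorem proposition4p17:
  fixes chi :: "int ^ 'i \<Rightarrow> int ^ 'i \<Rightarrow> 'k::field"
    and P M :: "('i gen list \<Rightarrow>\<^sub>0 'k) set set"
  assumes "bicharacter chi"
    and "ideal P (Uplus chi)"
    and "P \<subseteq> carrier (Uplus chi) \<inter> a_kernel (U chi) ground_alg (counit chi)"
    and "ideal M (Uminus chi)"
    and "M \<subseteq> carrier (Uminus chi) \<inter> a_kernel (U chi) ground_alg (counit chi)"
  shows "let
      Up = carrier (Uplus chi); U0 = carrier (Uzero chi); Um = carrier (Uminus chi); UU = carrier (U chi);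
      PUU = subspace_prod (U chi) P U0 Um;
      UUM = subspace_prod (U chi) Up U0 M;
      C1 = mult_induces_iso chi P M;
      C2 = (subspace_prod (U chi) UU P UU <+>\<^bsub>U chi\<^esub> subspace_prod (U chi) UU M UU = PUU <+>\<^bsub>U chi\<^esub> UUM);
      C3 = (ideal PUU (U chi) \<and> ideal UUM (U chi));
      C4 = (\<forall>X\<in>U0. \<forall>i.
              adj_action chi X ` P \<subseteq> P \<and> adj_action chi X ` M \<subseteq> M \<and>
              derivK chi i ` P \<subseteq> P \<and> derivL chi i ` P \<subseteq> P \<and>
              derivK chi i ` phi4 chi ` M \<subseteq> phi4 chi ` M \<and>
              derivL chi i ` phi4 chi ` M \<subseteq> phi4 chi ` M)
    in (C1 \<longleftrightarrow> C2) \<and> (C2 \<longleftrightarrow> C3) \<and> (C3 \<longleftrightarrow> C4)"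
proof -
  interpret ideal_pair chi P M
    by (intro ideal_pair.intro bichar.intro ideal_pair_axioms.intro assms(1,2,4))
      (use assms(3,5) in \<open>auto simp: a_kernel_def'\<close>)
  show ?thesis
    unfolding Let_def closure_conditions_iff_stable
    using mult_induces_iso_iff decomposition_imp_stable stable_imp_ideals ideals_imp_decomposition by blast
qed

end
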